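(* For all $\beta>0$, given any integer $k\in\mathbb{N}$ and any $\varepsilon>0$, there exists a smooth and bounded domain $\Omega_\varepsilon\subseteq\mathbb{R}^2$ such that if $u_\beta^\varepsilon$ solves $$-\Delta u_\beta^\varepsilon=1\ \text{ in }\Omega_\varepsilon,\qquad \partial_\nu u_\beta^\varepsilon+\beta u_\beta^\varepsilon=0\ \text{ on }\partial\Omega_\varepsilon,$$ then (i) $\Omega_\varepsilon$ is star-shaped with respect to an interior point; (ii) $u_\beta^\varepsilon$ has at least $k$ maximum points; (iii) $\Omega_\varepsilon$ locally converges to the strip $\mathcal{S}:=\mathbb{R}\times(0,1)$, i.e. for all compact sets $\mathcal{K}\subseteq\mathbb{R}^2$ it holds $|\mathcal{K}\cap(\Omega_\varepsilon\triangle\mathcal{S})|\to0$ as $\varepsilon\to0$; (iv) the curvature of $\partial\Omega_\varepsilon$ changes sign, vanishes at exactly two points, and its minimum goes to $0$ as $\varepsilon\to0$.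
   Context: $\nu$ is the outer unit normal to $\partial\Omega_\varepsilon$, $\triangle$ denotes symmetric difference, and $|\cdot|$ is Lebesgue measure. Curvature is taken with the sign convention that it is positive for a disc. "Maximum points" means local maximum points. *)

theory Defs
  imports "HOL-Analysis.Analysis"
begin

definition partial_deriv :: "'n::finite \<Rightarrow> (real^'n \<Rightarrow> real) \<Rightarrow> real^'n \<Rightarrow> real" where
  "partial_deriv i f x = frechet_derivative f (at x) (axis i 1)"

definition grad :: "(real^'n::finite \<Rightarrow> real) \<Rightarrow> real^'n \<Rightarrow> real^'n" where
  "grad f x = (\<chi> i. partial_deriv i f x)"

definition laplacian :: "(real^'n::finite \<Rightarrow> real) \<Rightarrow> real^'n \<Rightarrow> real" where
  "laplacian f x = (\<Sum>i\<in>UNIV. partial_deriv i (partial_deriv i f) x)"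

(* Meant for open S only, where differentiability within S is differentiability at each point. *)
primrec Ck_on :: "nat \<Rightarrow> (real^'n::finite) set \<Rightarrow> (real^'n \<Rightarrow> real) \<Rightarrow> bool" where
  "Ck_on 0 S f \<longleftrightarrow> continuous_on S f"
| "Ck_on (Suc m) S f \<longleftrightarrow> f differentiable_on S \<and> (\<forall>i. Ck_on m S (partial_deriv i f))"

definition smooth_on :: "(real^'n::finite) set \<Rightarrow> (real^'n \<Rightarrow> real) \<Rightarrow> bool" where
  "smooth_on S f \<longleftrightarrow> (\<forall>m. Ck_on m S f)"

(* As the gradient does not vanish on U, the frontier of \<Omega> inside U is the zero set of \<rho>,
   and \<Omega> lies on one side of it. *)
definition local_defining_function ::
    "(real^'n::finite) set \<Rightarrow> real^'n \<Rightarrow> (real^'n) set \<Rightarrow> (real^'n \<Rightarrow> real) \<Rightarrow> bool" where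
  "local_defining_function \<Omega> p U \<rho> \<longleftrightarrow>
     open U \<and> p \<in> U \<and> smooth_on U \<rho> \<and> (\<forall>x\<in>U. grad \<rho> x \<noteq> 0) \<and>
     U \<inter> \<Omega> = {x \<in> U. \<rho> x < 0}"

definition smooth_bounded_domain :: "(real^'n::finite) set \<Rightarrow> bool" where
  "smooth_bounded_domain \<Omega> \<longleftrightarrow>
     open \<Omega> \<and> connected \<Omega> \<and> \<Omega> \<noteq> {} \<and> bounded \<Omega> \<and>
     (\<forall>p\<in>frontier \<Omega>. \<exists>U \<rho>. local_defining_function \<Omega> p U \<rho>)"

(* The normalised gradient at a frontier point p does not depend on the choice of \<rho>. *)
definition outer_normal :: "(real^'n::finite) set \<Rightarrow> real^'n \<Rightarrow> real^'n" where
  "outer_normal \<Omega> p =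
     (THE \<nu>. \<exists>U \<rho>. local_defining_function \<Omega> p U \<rho> \<and> \<nu> = grad \<rho> p /\<^sub>R norm (grad \<rho> p))"

(* Signed curvature of the frontier at p: (x'y'' - y'x'') / |c'|^3 for any regular curve
   c = (x,y) through p = c(0) in the frontier that keeps \<Omega> on its left, i.e. whose unit tangent
   at p turned clockwise by a right angle is the outer normal.  It is 1/r for a disc of radius r. *)
definition boundary_curvature :: "(real^2) set \<Rightarrow> real^2 \<Rightarrow> real" where
  "boundary_curvature \<Omega> p =
     (THE \<kappa>. \<exists>c c' c'' r. r > 0 \<and> c 0 = p \<and>
        (\<forall>t\<in>{-r<..<r}. c t \<in> frontier \<Omega> \<and> c' t \<noteq> 0 \<and>
           (c has_vector_derivative c' t) (at t) \<and> (c' has_vector_derivative c'' t) (at t)) \<and>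
        outer_normal \<Omega> p = vector [c' 0 $ 2, - (c' 0 $ 1)] /\<^sub>R norm (c' 0) \<and>
        \<kappa> = (c' 0 $ 1 * c'' 0 $ 2 - c' 0 $ 2 * c'' 0 $ 1) / norm (c' 0) ^ 3)"

(* Classical solutions, of class C^2 in \<Omega> and C^1 up to the frontier.  G is the gradient of u,
   extended continuously to the closure of \<Omega>. *)
definition robin_torsion_solution :: "real \<Rightarrow> (real^'n::finite) set \<Rightarrow> (real^'n \<Rightarrow> real) \<Rightarrow> bool" where
  "robin_torsion_solution \<beta> \<Omega> u \<longleftrightarrow>
     Ck_on 2 \<Omega> u \<and>
     (\<forall>x\<in>\<Omega>. - laplacian u x = 1) \<and>
     (\<exists>G. continuous_on (closure \<Omega>) G \<and>
          (\<forall>x\<in>closure \<Omega>. (u has_derivative (\<lambda>h. G x \<bullet> h)) (at x within closure \<Omega>)) \<and>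
          (\<forall>p\<in>frontier \<Omega>. G p \<bullet> outer_normal \<Omega> p + \<beta> * u p = 0))"

definition local_max_points :: "'a::metric_space set \<Rightarrow> ('a \<Rightarrow> real) \<Rightarrow> 'a set" where
  "local_max_points S u = {x \<in> S. \<exists>r>0. \<forall>y\<in>S \<inter> ball x r. u y \<le> u x}"

definition strip :: "(real^2) set" where
  "strip = {x. 0 < x $ 2 \<and> x $ 2 < 1}"

end

(*
Idea. Let u solve the Robin torsion problem on a domain that is thin compared with the scale on
which its width 2 S and midline vary. Then u is close to the one-dimensional profile
(S^2 - Y^2) / 2 + S / beta of the local width, Y being the height above the midline: the profile
misses the equation and the boundary condition by O(1/X), X being the horizontal stretch, and the
comparison principle turns this into uniform closeness. So every strict maximum of the width
creates a local maximum of u, for every solution u.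

The domains are horizontal stretches of one fixed shape Y^2 < 1/4 - q(t), Y = y - 1/2 + b t^2.
The polynomial q is a small multiple of the product of the (t^2 - j^2)^2, so that the width has its
maxima at the integers j. The bend b dominates the curvature of the width wherever q oscillates,
so that the upper arc is convex and the lower one concave there; further out q, q' and q'' are
increasing, so that the curvature of the lower arc changes sign exactly once on each side.
Stretching preserves the signs of the curvature and makes its negative part O(1/X^2).
*)
theory Submission
  imports Defs
begin

section \<open>Gradients and polynomial functions\<close>

text \<open>The bend is there for the zero count of the curvature: on a straight symmetric shape, a
  width with several maxima puts inflections on both arcs. On the bent lower arc the curvature
  numerator, divided by the cube of the half-width, is a function increasing beyond \<open>T\<close>
  minus the constant \<open>16 * b\<close>, which leaves one zero per side. The order of the choices
  matters. With \<open>q\<close> a multiple \<eta> of a fixed \<open>p\<close>, and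
  \<open>b = C * \<eta>\<close>, the two sides of the curvature condition scale alike, so
  \<open>C\<close> is fixed before \<eta>. A small \<eta> then gives star-shapedness up to a point
  beyond which the growth of \<open>p\<close> alone gives it. The profile contains a square root
  that is singular at the tips, so the comparison cannot be global. It is run near one
  cross-section: a quadratic penalty in \<open>t\<close> beats a crude global bound outside a unit
  window, and stretching makes its derivatives small inside. The tips also rule out graphs as
  boundary curves; factoring \<open>te^2 - t^2\<close> out of the squared half-width gives a regular
  parametrisation through them.\<close>

lemma has_derivative_grad:
  fixes f :: "real^'n::finite \<Rightarrow> real"
  assumes "f differentiable (at x)"
  shows "(f has_derivative (\<lambda>h. grad f x \<bullet> h)) (at x)"
proof -
  let ?D = "frechet_derivative f (at x)"
  have D: "(f has_derivative ?D) (at x)"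
    using assms frechet_derivative_works by blast
  then have lin: "linear ?D"
    by (simp add: has_derivative_linear)
  have "?D h = grad f x \<bullet> h" for h
  proof -
    have "?D h = ?D (\<Sum>i\<in>UNIV. (h $ i) *\<^sub>R axis i 1)"
      by (metis basis_expansion scalar_mult_eq_scaleR)
    also have "\<dots> = (\<Sum>i\<in>UNIV. (h $ i) *\<^sub>R ?D (axis i 1))"
      by (simp add: linear_sum[OF lin] linear_cmul[OF lin])
    also have "\<dots> = grad f x \<bullet> h"
      by (simp add: grad_def partial_deriv_def inner_vec_def mult.commute)
    finally show ?thesis .
  qed
  then show ?thesis
    using D by (metis (no_types, lifting) ext)
qed

lemma grad_eqI:
  fixes f :: "real^'n::finite \<Rightarrow> real"
  assumes "(f has_derivative (\<lambda>h. v \<bullet> h)) (at x)"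
  shows "grad f x = v"
proof -
  have "frechet_derivative f (at x) = (\<lambda>h. v \<bullet> h)"
    using assms frechet_derivative_at by fastforce
  then show ?thesis
    by (simp add: grad_def partial_deriv_def vec_eq_iff inner_axis)
qed

text \<open>Stability under \<open>partial_deriv\<close> lets an induction on the order prove
  smoothness; this is why the defining functions below are polynomials.\<close>

lemma real_polynomial_partial_deriv:
  fixes f :: "real^'n::finite \<Rightarrow> real"
  assumes "real_polynomial_function f"
  shows "real_polynomial_function (partial_deriv i f)"
proof -
  have D: "(g has_derivative frechet_derivative g (at x)) (at x)"
    if "real_polynomial_function g" for g :: "real^'n \<Rightarrow> real" and x
    using that differentiable_at_real_polynomial_function frechet_derivative_works by blast
  have fD: "frechet_derivative g (at x) = D" if "(g has_derivative D) (at x)"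
    for g :: "real^'n \<Rightarrow> real" and x D
    using frechet_derivative_at[OF that] by simp
  show ?thesis
    using assms
  proof (induction rule: real_polynomial_function.induct)
    case (linear f)
    then have "partial_deriv i f = (\<lambda>x. f (axis i 1))"
      using frechet_derivative_at[OF bounded_linear_imp_has_derivative[OF linear]]
      by (auto simp: partial_deriv_def fun_eq_iff)
    then show ?case by auto
  next
    case (const c)
    then show ?case
      by (simp add: partial_deriv_def[abs_def] real_polynomial_function.intros(2))
  next
    case (add f g)
    have "partial_deriv i (\<lambda>x. f x + g x) x = partial_deriv i f x + partial_deriv i g x" for x
      using fD[OF has_derivative_add[OF D[OF add.hyps(1)] D[OF add.hyps(2)]]]
      by (simp add: partial_deriv_def)
    with add show ?case by (simp add: real_polynomial_function.intros(3))
  next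
    case (mult f g)
    have "partial_deriv i (\<lambda>x. f x * g x) x =
        f x * partial_deriv i g x + partial_deriv i f x * g x" for x
      using fD[OF has_derivative_mult[OF D[OF mult.hyps(1)] D[OF mult.hyps(2)]]]
      by (simp add: partial_deriv_def)
    with mult show ?case
      by (simp add: real_polynomial_function.intros(3,4))
  qed
qed

lemma real_polynomial_smooth_on:
  fixes f :: "real^'n::finite \<Rightarrow> real"
  assumes "real_polynomial_function f"
  shows "smooth_on S f"
proof -
  have "Ck_on m S f" for m
    using assms
  proof (induction m arbitrary: f)
    case 0
    then show ?case
      using differentiable_on_real_polynomial_function differentiable_imp_continuous_on by fastforce
  next
    case (Suc m)
    then show ?case
      by (simp add: differentiable_on_real_polynomial_function real_polynomial_partial_deriv)
  qed
  then show ?thesis by (simp add: smooth_on_def)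
qed

lemma real_polynomial_function_poly:
  assumes "real_polynomial_function f"
  shows "real_polynomial_function (\<lambda>x. poly p (f x))"
proof (induction p)
  case (pCons a p)
  then show ?case
    using assms by (auto intro!: real_polynomial_function.intros(3,4))
qed auto

lemma real_polynomial_grad_continuous:
  fixes f :: "real^'n::finite \<Rightarrow> real"
  assumes "real_polynomial_function f"
  shows "continuous_on S (grad f)"
  unfolding grad_def
  using assms
  by (intro continuous_on_vec_lambda differentiable_imp_continuous_on
      differentiable_on_real_polynomial_function real_polynomial_partial_deriv)

section \<open>Outer normal and curvature of a sublevel set\<close>

lemma has_derivative_along_line_at:
  fixes f :: "'a::real_normed_vector \<Rightarrow> real"
  assumes "(f has_derivative D) (at (x + t *\<^sub>R d))"
  shows "((\<lambda>s. f (x + s *\<^sub>R d)) has_real_derivative D d) (at t)"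
proof -
  have lin: "linear D" using assms has_derivative_linear by blast
  have "((\<lambda>s::real. x + s *\<^sub>R d) has_derivative (\<lambda>s. s *\<^sub>R d)) (at t)"
    by (auto intro!: derivative_eq_intros)
  then have "((\<lambda>s. f (x + s *\<^sub>R d)) has_derivative (\<lambda>s. D (s *\<^sub>R d))) (at t)"
    using assms by (rule has_derivative_compose)
  then show ?thesis
    by (simp add: has_field_derivative_def linear_cmul[OF lin] mult_commute_abs)
qed

lemma has_derivative_along_line:
  fixes f :: "'a::real_normed_vector \<Rightarrow> real"
  assumes "(f has_derivative D) (at x)"
  shows "((\<lambda>s. f (x + s *\<^sub>R d)) has_real_derivative D d) (at 0)"
  using has_derivative_along_line_at[of f D x 0 d] assms by simp

lemma DERIV_zero_if_constant_on:
  fixes f :: "real \<Rightarrow> real"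
  assumes "open S" "t \<in> S" "\<And>s. s \<in> S \<Longrightarrow> f s = a"
  shows "(f has_real_derivative 0) (at t)"
  by (rule has_field_derivative_transform_within_open[of "\<lambda>_. a" 0 t S])
    (use assms in auto)

text \<open>Openness keeps \<open>p\<close> outside \<open>\<Omega>\<close>, so the value is not
  negative; a positive one would persist on a neighbourhood that misses \<open>\<Omega>\<close>,
  although \<open>p\<close> lies in the closure.\<close>

lemma local_defining_function_frontier:
  assumes "local_defining_function \<Omega> p U \<rho>" "open \<Omega>" "p \<in> frontier \<Omega>"
  shows "\<rho> p = 0"
proof (rule ccontr)
  assume "\<rho> p \<noteq> 0"
  have U: "open U" "p \<in> U" "U \<inter> \<Omega> = {x \<in> U. \<rho> x < 0}"
    using assms by (auto simp: local_defining_function_def)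
  have "continuous_on U \<rho>"
    using assms Ck_on.simps(1) unfolding local_defining_function_def smooth_on_def by blast
  have "p \<notin> \<Omega>" using assms by (simp add: frontier_def interior_open)
  with U \<open>\<rho> p \<noteq> 0\<close> have "\<rho> p > 0" by force
  define W where "W = U \<inter> \<rho> -` {0<..}"
  have "open W" "p \<in> W"
    using U \<open>\<rho> p > 0\<close> continuous_open_preimage[OF \<open>continuous_on U \<rho>\<close> U(1) open_greaterThan]
    by (auto simp: W_def)
  moreover have "p \<in> closure \<Omega>" using assms by (simp add: frontier_def)
  ultimately have "W \<inter> \<Omega> \<noteq> {}"
    using open_Int_closure_eq_empty[of W \<Omega>] by blast
  then obtain z where "z \<in> \<Omega>" "z \<in> U" "\<rho> z > 0" by (auto simp: W_def)
  then show False using U by force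
qed

text \<open>Short rays from \<open>p\<close> see the sign of the directional derivative. This
  describes the boundary without reference to \<open>\<rho>\<close>: it makes the normal independent
  of the defining function and supplies inward directions at boundary maxima.\<close>

lemma local_defining_function_sides:
  assumes ldf: "local_defining_function \<Omega> p U \<rho>" and "\<rho> p = 0"
  shows "grad \<rho> p \<bullet> d < 0 \<Longrightarrow> \<exists>e>0. \<forall>s. 0 < s \<and> s < e \<longrightarrow> p + s *\<^sub>R d \<in> \<Omega>"
    and "grad \<rho> p \<bullet> d > 0 \<Longrightarrow> \<exists>e>0. \<forall>s. 0 < s \<and> s < e \<longrightarrow> p + s *\<^sub>R d \<notin> \<Omega>"
proof -
  have U: "open U" "p \<in> U" "U \<inter> \<Omega> = {x \<in> U. \<rho> x < 0}"
    using assms by (auto simp: local_defining_function_def)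
  have "\<rho> differentiable_on U"
    using ldf Ck_on.simps(2)[of 0 U \<rho>] unfolding local_defining_function_def smooth_on_def by blast
  then have "\<rho> differentiable (at p)"
    using U by (metis at_within_open differentiable_on_def)
  from has_derivative_along_line[OF has_derivative_grad[OF this], of d]
  have D: "((\<lambda>s. \<rho> (p + s *\<^sub>R d)) has_real_derivative grad \<rho> p \<bullet> d) (at 0)" .
  have "((\<lambda>s::real. p + s *\<^sub>R d) \<longlongrightarrow> p + 0 *\<^sub>R d) (at 0)"
    by (intro tendsto_intros)
  then have "\<forall>\<^sub>F s in at 0. p + s *\<^sub>R d \<in> U"
    using U by (simp add: topological_tendstoD)
  then obtain e1 where e1: "e1 > 0" "\<And>s. s \<noteq> 0 \<Longrightarrow> \<bar>s\<bar> < e1 \<Longrightarrow> p + s *\<^sub>R d \<in> U"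
    by (auto simp: eventually_at dist_real_def)
  {
    assume "grad \<rho> p \<bullet> d < 0"
    from DERIV_neg_dec_right[OF D this] obtain e2 where
      e2: "e2 > 0" "\<And>s. 0 < s \<Longrightarrow> s < e2 \<Longrightarrow> \<rho> (p + s *\<^sub>R d) < 0"
      using assms by auto
    show "\<exists>e>0. \<forall>s. 0 < s \<and> s < e \<longrightarrow> p + s *\<^sub>R d \<in> \<Omega>"
    proof (intro exI[of _ "min e1 e2"] conjI allI impI)
      fix s assume s: "0 < s \<and> s < min e1 e2"
      then have "p + s *\<^sub>R d \<in> {x \<in> U. \<rho> x < 0}" using e1 e2 by auto
      then show "p + s *\<^sub>R d \<in> \<Omega>" using U by blast
    qed (use e1 e2 in auto)
  }
  {
    assume "grad \<rho> p \<bullet> d > 0"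
    from DERIV_pos_inc_right[OF D this] obtain e2 where
      e2: "e2 > 0" "\<And>s. 0 < s \<Longrightarrow> s < e2 \<Longrightarrow> \<rho> (p + s *\<^sub>R d) > 0"
      using assms by auto
    show "\<exists>e>0. \<forall>s. 0 < s \<and> s < e \<longrightarrow> p + s *\<^sub>R d \<notin> \<Omega>"
    proof (intro exI[of _ "min e1 e2"] conjI allI impI)
      fix s assume s: "0 < s \<and> s < min e1 e2"
      then have "p + s *\<^sub>R d \<in> U" "\<rho> (p + s *\<^sub>R d) > 0" using e1 e2 by auto
      then show "p + s *\<^sub>R d \<notin> \<Omega>" using U by force
    qed (use e1 e2 in auto)
  }
qed

text \<open>If two defining functions had different unit normals, the difference of the normals
  would point into \<open>\<Omega>\<close> for one of them and out of it for the other.\<close>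

lemma outer_normal_eq:
  assumes "local_defining_function \<Omega> p U \<rho>" "open \<Omega>" "p \<in> frontier \<Omega>"
  shows "outer_normal \<Omega> p = grad \<rho> p /\<^sub>R norm (grad \<rho> p)"
  unfolding outer_normal_def
proof (rule the_equality)
  show "\<exists>U' \<rho>'. local_defining_function \<Omega> p U' \<rho>' \<and>
      grad \<rho> p /\<^sub>R norm (grad \<rho> p) = grad \<rho>' p /\<^sub>R norm (grad \<rho>' p)"
    using assms by blast
next
  fix \<nu> assume "\<exists>U \<rho>. local_defining_function \<Omega> p U \<rho> \<and> \<nu> = grad \<rho> p /\<^sub>R norm (grad \<rho> p)"
  then obtain V \<sigma> where s: "local_defining_function \<Omega> p V \<sigma>"
    and \<nu>: "\<nu> = grad \<sigma> p /\<^sub>R norm (grad \<sigma> p)" by blast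
  define \<mu> where "\<mu> = grad \<rho> p /\<^sub>R norm (grad \<rho> p)"
  have nz: "grad \<rho> p \<noteq> 0" "grad \<sigma> p \<noteq> 0"
    using assms s by (auto simp: local_defining_function_def)
  then have unit: "norm \<mu> = 1" "norm \<nu> = 1"
    and eq: "grad \<rho> p = norm (grad \<rho> p) *\<^sub>R \<mu>" "grad \<sigma> p = norm (grad \<sigma> p) *\<^sub>R \<nu>"
    by (auto simp: \<mu>_def \<nu>)
  show "\<nu> = \<mu>"
  proof (rule ccontr)
    assume "\<nu> \<noteq> \<mu>"
    then have "(\<nu> - \<mu>) \<bullet> (\<nu> - \<mu>) > 0" by simp
    moreover have u2: "\<mu> \<bullet> \<mu> = 1" "\<nu> \<bullet> \<nu> = 1" using unit by (simp_all add: dot_square_norm)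
    ultimately have "\<mu> \<bullet> \<nu> < 1" by (simp add: algebra_simps inner_commute)
    then have "\<mu> \<bullet> (\<nu> - \<mu>) < 0" "\<nu> \<bullet> (\<nu> - \<mu>) > 0"
      using u2 by (auto simp: inner_diff_right inner_commute)
    then have "grad \<rho> p \<bullet> (\<nu> - \<mu>) < 0" "grad \<sigma> p \<bullet> (\<nu> - \<mu>) > 0"
      using nz eq by (metis inner_scaleR_left mult_pos_neg zero_less_norm_iff,
          metis inner_scaleR_left mult_pos_pos nz(2) zero_less_norm_iff eq(2))
    from local_defining_function_sides(1)[OF assms(1) local_defining_function_frontier[OF assms] this(1)]
      local_defining_function_sides(2)[OF s local_defining_function_frontier[OF s assms(2,3)] this(2)]
    obtain e1 e2 where "e1 > 0" "e2 > 0"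
      "\<And>t. 0 < t \<Longrightarrow> t < e1 \<Longrightarrow> p + t *\<^sub>R (\<nu> - \<mu>) \<in> \<Omega>"
      "\<And>t. 0 < t \<Longrightarrow> t < e2 \<Longrightarrow> p + t *\<^sub>R (\<nu> - \<mu>) \<notin> \<Omega>"
      by blast
    then show False
      using field_lbound_gt_zero[of e1 e2] by blast
  qed
qed

section \<open>Regular polynomial sublevel sets\<close>

locale regular_sublevel_set =
  fixes \<Omega> :: "(real^'n::finite) set" and \<rho> :: "real^'n \<Rightarrow> real"
  assumes polynomial: "real_polynomial_function \<rho>"
    and sublevel: "\<Omega> = {z. \<rho> z < 0}"
    and regular: "\<rho> z = 0 \<Longrightarrow> grad \<rho> z \<noteq> 0"
begin

lemma continuous_rho: "continuous_on S \<rho>"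
  using polynomial differentiable_on_real_polynomial_function differentiable_imp_continuous_on
  by blast

lemma open_sublevel: "open \<Omega>"
  unfolding sublevel by (intro open_Collect_less continuous_rho continuous_on_const)

lemma has_derivative_rho: "(\<rho> has_derivative (\<lambda>h. grad \<rho> z \<bullet> h)) (at z)"
  by (intro has_derivative_grad differentiable_at_real_polynomial_function polynomial)

text \<open>One neighbourhood serves all frontier points: the set where the gradient does not
  vanish, open because the gradient is continuous.\<close>

lemma local_defining_function_rho:
  assumes "\<rho> p = 0"
  shows "local_defining_function \<Omega> p {z. grad \<rho> z \<noteq> 0} \<rho>"
proof -
  have "open {z. grad \<rho> z \<noteq> 0}"
    by (intro open_Collect_neq real_polynomial_grad_continuous polynomial continuous_on_const)
  then show ?thesis
    using assms regular polynomial real_polynomial_smooth_on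
    by (auto simp: local_defining_function_def sublevel)
qed

lemma frontier_eq: "frontier \<Omega> = {z. \<rho> z = 0}"
proof (intro equalityI subsetI)
  fix z assume z: "z \<in> frontier \<Omega>"
  have "closed {z. \<rho> z \<le> 0}"
    by (intro closed_Collect_le continuous_rho continuous_on_const)
  then have "closure \<Omega> \<subseteq> {z. \<rho> z \<le> 0}"
    by (intro closure_minimal) (auto simp: sublevel)
  then show "z \<in> {z. \<rho> z = 0}"
    using z open_sublevel by (auto simp: frontier_def interior_open) (use sublevel in force)
next
  fix z assume "z \<in> {z. \<rho> z = 0}"
  then have z: "\<rho> z = 0" by simp
  \<comment> \<open>A regular zero is a limit of points of \<open>\<Omega>\<close>, since moving
    against the gradient decreases \<open>\<rho>\<close>.\<close>
  have "grad \<rho> z \<bullet> (- grad \<rho> z) < 0" using regular[OF z] by simp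
  from local_defining_function_sides(1)[OF local_defining_function_rho[OF z] z this]
  obtain e where e: "e > 0" "\<And>s. 0 < s \<Longrightarrow> s < e \<Longrightarrow> z + s *\<^sub>R (- grad \<rho> z) \<in> \<Omega>" by blast
  have "((\<lambda>s::real. z + s *\<^sub>R (- grad \<rho> z)) \<longlongrightarrow> z + 0 *\<^sub>R (- grad \<rho> z)) (at_right 0)"
    by (intro tendsto_intros)
  moreover have "\<forall>\<^sub>F s in at_right 0. z + s *\<^sub>R (- grad \<rho> z) \<in> closure \<Omega>"
    unfolding eventually_at_right_field
    using e by (intro exI[of _ e]) (meson closure_subset subsetD)
  ultimately have "z \<in> closure \<Omega>"
    using Lim_in_closed_set[OF closed_closure] trivial_limit_at_right_real by fastforce
  then show "z \<in> frontier \<Omega>"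
    using open_sublevel z by (simp add: frontier_def interior_open sublevel)
qed

lemma outer_normal_sublevel:
  assumes "\<rho> p = 0"
  shows "outer_normal \<Omega> p = grad \<rho> p /\<^sub>R norm (grad \<rho> p)"
  using outer_normal_eq[OF local_defining_function_rho[OF assms] open_sublevel] assms
  by (simp add: frontier_eq)

lemma smooth_bounded_domain_sublevel:
  assumes "connected \<Omega>" "\<Omega> \<noteq> {}" "bounded \<Omega>"
  shows "smooth_bounded_domain \<Omega>"
  using assms open_sublevel local_defining_function_rho frontier_eq
  by (auto simp: smooth_bounded_domain_def)

end

text \<open>Differentiating \<open>\<rho> (c t) = 0\<close> twice expresses the curvature of any admissible curve
  by the first two derivatives of \<open>\<rho>\<close>.\<close>

lemma boundary_curvature_sublevel:
  fixes \<Omega> :: "(real^2) set" and c c' c'' :: "real \<Rightarrow> real^2"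
  assumes reg: "regular_sublevel_set \<Omega> \<rho>"
    and hess: "(grad \<rho> has_derivative H) (at p)"
    and r: "r > 0" and c0: "c 0 = p"
    and curve: "\<And>t. t \<in> {-r<..<r} \<Longrightarrow> c t \<in> frontier \<Omega> \<and> c' t \<noteq> 0 \<and>
           (c has_vector_derivative c' t) (at t) \<and> (c' has_vector_derivative c'' t) (at t)"
  defines "\<tau> \<equiv> vector [- (grad \<rho> p $ 2), grad \<rho> p $ 1]"
  shows "boundary_curvature \<Omega> p = (\<tau> \<bullet> H \<tau>) / norm (grad \<rho> p) ^ 3"
proof -
  interpret regular_sublevel_set \<Omega> \<rho> by (rule reg)
  have p0: "\<rho> p = 0" using curve[of 0] r c0 frontier_eq by auto
  define n where "n = outer_normal \<Omega> p"
  have n: "n = grad \<rho> p /\<^sub>R norm (grad \<rho> p)" using outer_normal_sublevel p0 n_def by simp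
  have linH: "linear H" using hess has_derivative_linear by blast
  \<comment> \<open>Uniqueness half of the definite description: the orientation condition forces
    \<open>c' 0\<close> to be a positive multiple of \<open>\<tau>\<close>, so every admissible
    curve yields the same value.\<close>
  have key: "\<kappa> = (\<tau> \<bullet> H \<tau>) / norm (grad \<rho> p) ^ 3"
    if "r > 0" "c 0 = p" and cv: "\<forall>t\<in>{-r<..<r}. c t \<in> frontier \<Omega> \<and> c' t \<noteq> 0 \<and>
           (c has_vector_derivative c' t) (at t) \<and> (c' has_vector_derivative c'' t) (at t)"
      and on: "n = vector [c' 0 $ 2, - (c' 0 $ 1)] /\<^sub>R norm (c' 0)"
      and \<kappa>: "\<kappa> = (c' 0 $ 1 * c'' 0 $ 2 - c' 0 $ 2 * c'' 0 $ 1) / norm (c' 0) ^ 3"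
    for c c' c'' :: "real \<Rightarrow> real^2" and r \<kappa>
  proof -
    have tang: "grad \<rho> (c t) \<bullet> c' t = 0" if "t \<in> {-r<..<r}" for t
    proof -
      have "(c has_derivative (\<lambda>s. s *\<^sub>R c' t)) (at t)"
        using cv that by (simp add: has_vector_derivative_def)
      from has_derivative_compose[OF this has_derivative_rho]
      have "((\<lambda>t. \<rho> (c t)) has_real_derivative grad \<rho> (c t) \<bullet> c' t) (at t)"
        by (simp add: has_field_derivative_def mult_commute_abs)
      moreover have "((\<lambda>t. \<rho> (c t)) has_real_derivative 0) (at t)"
        by (rule DERIV_zero_if_constant_on[of "{-r<..<r}" _ _ 0]) (use that cv frontier_eq in auto)
      ultimately show ?thesis by (rule DERIV_unique)
    qed
    have "(c has_derivative (\<lambda>s. s *\<^sub>R c' 0)) (at 0)" "(c' has_derivative (\<lambda>s. s *\<^sub>R c'' 0)) (at 0)"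
      using cv \<open>r > 0\<close> by (simp_all add: has_vector_derivative_def)
    from has_derivative_inner[OF has_derivative_compose[OF this(1)] this(2), of "grad \<rho>" H] hess
    have "((\<lambda>t. grad \<rho> (c t) \<bullet> c' t) has_derivative
        (\<lambda>h. grad \<rho> p \<bullet> h *\<^sub>R c'' 0 + H (h *\<^sub>R c' 0) \<bullet> c' 0)) (at 0)"
      by (simp add: \<open>c 0 = p\<close>)
    then have "((\<lambda>t. grad \<rho> (c t) \<bullet> c' t) has_real_derivative
        (grad \<rho> p \<bullet> c'' 0 + H (c' 0) \<bullet> c' 0)) (at 0)"
      unfolding has_field_derivative_def
      by (rule has_derivative_eq_rhs) (simp add: fun_eq_iff linear_cmul[OF linH] algebra_simps)
    moreover have "((\<lambda>t. grad \<rho> (c t) \<bullet> c' t) has_real_derivative 0) (at 0)"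
      by (rule DERIV_zero_if_constant_on[of "{-r<..<r}" _ _ 0]) (use \<open>r > 0\<close> tang in auto)
    ultimately have second: "grad \<rho> p \<bullet> c'' 0 + H (c' 0) \<bullet> c' 0 = 0" by (rule DERIV_unique)
    define R where "R = norm (grad \<rho> p)"
    define L where "L = norm (c' 0)"
    have R: "R > 0" using regular[OF p0] by (simp add: R_def)
    have L: "L > 0" using cv \<open>r > 0\<close> by (simp add: L_def)
    have "grad \<rho> p = R *\<^sub>R n" using n R by (simp add: R_def)
    then have g: "grad \<rho> p $ 1 = R * (c' 0 $ 2 / L)" "grad \<rho> p $ 2 = - (R * (c' 0 $ 1 / L))"
      using on by (simp_all add: L_def divide_inverse_commute)
    have "c' 0 = (L / R) *\<^sub>R \<tau>"
      using L R by (simp add: \<tau>_def g vec_eq_iff forall_2)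
    then have "H (c' 0) \<bullet> c' 0 = (L / R)\<^sup>2 * (\<tau> \<bullet> H \<tau>)"
      by (simp add: linear_cmul[OF linH] inner_commute power2_eq_square)
    moreover have "grad \<rho> p \<bullet> c'' 0 = - R * L\<^sup>2 * \<kappa>"
      unfolding \<kappa> L_def[symmetric] using L
      by (simp add: inner_vec_def UNIV_2 g field_simps power2_eq_square power3_eq_cube)
    ultimately have "R * L\<^sup>2 * \<kappa> = (L / R)\<^sup>2 * (\<tau> \<bullet> H \<tau>)" using second by simp
    then show ?thesis
      using R L by (simp add: R_def[symmetric] field_simps power2_eq_square power3_eq_cube)
  qed
  \<comment> \<open>Existence half: the supplied curve may run in either direction, so either it or
    its reversal keeps \<open>\<Omega>\<close> on its left.\<close>
  have ex: "\<exists>c c' c'' r. r > 0 \<and> c 0 = p \<and>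
        (\<forall>t\<in>{-r<..<r}. c t \<in> frontier \<Omega> \<and> c' t \<noteq> 0 \<and>
           (c has_vector_derivative c' t) (at t) \<and> (c' has_vector_derivative c'' t) (at t)) \<and>
        n = vector [c' 0 $ 2, - (c' 0 $ 1)] /\<^sub>R norm (c' 0)"
  proof -
    define m :: "real^2" where "m = vector [c' 0 $ 2, - (c' 0 $ 1)] /\<^sub>R norm (c' 0)"
    have c'0: "c' 0 \<noteq> 0" using curve[of 0] r by simp
    have "((\<lambda>t. \<rho> (c t)) has_real_derivative grad \<rho> p \<bullet> c' 0) (at 0)"
    proof -
      have "(c has_derivative (\<lambda>s. s *\<^sub>R c' 0)) (at 0)"
        using curve[of 0] r by (simp add: has_vector_derivative_def)
      from has_derivative_compose[OF this has_derivative_rho] show ?thesis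
        by (simp add: has_field_derivative_def mult_commute_abs c0)
    qed
    moreover have "((\<lambda>t. \<rho> (c t)) has_real_derivative 0) (at 0)"
      by (rule DERIV_zero_if_constant_on[of "{-r<..<r}" _ _ 0]) (use r curve frontier_eq in auto)
    ultimately have "grad \<rho> p \<bullet> c' 0 = 0" by (rule DERIV_unique)
    then have "n \<bullet> c' 0 = 0" by (simp add: n)
    then have orth: "n $ 1 * c' 0 $ 1 + n $ 2 * c' 0 $ 2 = 0"
      by (simp add: inner_vec_def UNIV_2)
    have "norm n = 1" using regular[OF p0] by (simp add: n)
    then have unit: "(n $ 1)\<^sup>2 + (n $ 2)\<^sup>2 = 1"
      by (simp add: norm_vec_def L2_set_def UNIV_2)
    have L: "(norm (c' 0))\<^sup>2 = (c' 0 $ 1)\<^sup>2 + (c' 0 $ 2)\<^sup>2" "norm (c' 0) > 0"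
      using c'0 by (simp add: norm_vec_def L2_set_def UNIV_2, simp)
    \<comment> \<open>\<open>k\<close> is the cosine of the angle between the outer normal and the
      tangent turned clockwise. Both are unit vectors orthogonal to the curve, so \<open>k\<close>
      is 1 or -1, and -1 calls for the reversal.\<close>
    define k where "k = (n $ 1 * c' 0 $ 2 - n $ 2 * c' 0 $ 1) / norm (c' 0)"
    have "n $ 1 * (norm (c' 0))\<^sup>2 = (n $ 1 * c' 0 $ 2 - n $ 2 * c' 0 $ 1) * c' 0 $ 2"
      "n $ 2 * (norm (c' 0))\<^sup>2 = - (n $ 1 * c' 0 $ 2 - n $ 2 * c' 0 $ 1) * c' 0 $ 1"
      using L(1) orth by algebra+
    then have nk: "n $ 1 = k * c' 0 $ 2 / norm (c' 0)" "n $ 2 = - k * c' 0 $ 1 / norm (c' 0)"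
      using L(2) by (simp_all add: k_def field_simps power2_eq_square)
    have "k\<^sup>2 = 1"
    proof -
      have "k\<^sup>2 * ((c' 0 $ 1)\<^sup>2 + (c' 0 $ 2)\<^sup>2) = (norm (c' 0))\<^sup>2"
        using unit L(2) unfolding nk by (simp add: field_simps power2_eq_square)
      then show ?thesis using L by (metis mult_cancel_right1 zero_less_power less_irrefl)
    qed
    then have "k = 1 \<or> k = -1" by (simp add: power2_eq_1_iff)
    then show ?thesis
    proof
      assume "k = 1"
      then have "n = m"
        using nk by (simp add: m_def vec_eq_iff forall_2 divide_inverse_commute)
      then show ?thesis using r c0 curve m_def
        by (intro exI[of _ c] exI[of _ c'] exI[of _ c''] exI[of _ r]) auto
    next
      assume k: "k = -1"
      define d where "d t = c (- t)" for t
      define d' where "d' t = - c' (- t)" for t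
      define d'' where "d'' t = c'' (- t)" for t
      have "d t \<in> frontier \<Omega> \<and> d' t \<noteq> 0 \<and>
           (d has_vector_derivative d' t) (at t) \<and> (d' has_vector_derivative d'' t) (at t)"
        if "t \<in> {-r<..<r}" for t
      proof -
        have cv: "(c has_vector_derivative c' (-t)) (at (-t))" "(c' has_vector_derivative c'' (-t)) (at (-t))"
          using curve[of "-t"] that by auto
        have minus: "((\<lambda>t::real. - t) has_real_derivative -1) (at t)"
          by (auto intro!: derivative_eq_intros)
        have "(d has_vector_derivative d' t) (at t)"
          using vector_diff_chain_at[of "\<lambda>t. - t" "-1" t c "c' (-t)"] cv minus
          by (simp add: d_def[abs_def] d'_def o_def has_real_derivative_iff_has_vector_derivative)
        moreover have "((\<lambda>t. c' (- t)) has_vector_derivative - c'' (-t)) (at t)"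
          using vector_diff_chain_at[of "\<lambda>t. - t" "-1" t c' "c'' (-t)"] cv minus
          by (simp add: o_def has_real_derivative_iff_has_vector_derivative)
        from has_vector_derivative_minus[OF this] have "(d' has_vector_derivative d'' t) (at t)"
          by (simp add: d'_def[abs_def] d''_def)
        ultimately show ?thesis using curve[of "-t"] that by (auto simp: d_def d'_def)
      qed
      moreover have "n = vector [d' 0 $ 2, - (d' 0 $ 1)] /\<^sub>R norm (d' 0)"
        using nk k by (simp add: d'_def vec_eq_iff forall_2 divide_inverse_commute)
      moreover have "d 0 = p" using c0 by (simp add: d_def)
      ultimately show ?thesis using r by blast
    qed
  qed
  show ?thesis
    unfolding boundary_curvature_def n_def[symmetric]
  proof (rule the_equality)
    obtain c c' c'' r where *: "r > 0 \<and> c 0 = p \<and>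
        (\<forall>t\<in>{-r<..<r}. c t \<in> frontier \<Omega> \<and> c' t \<noteq> 0 \<and>
           (c has_vector_derivative c' t) (at t) \<and> (c' has_vector_derivative c'' t) (at t)) \<and>
        n = vector [c' 0 $ 2, - (c' 0 $ 1)] /\<^sub>R norm (c' 0)"
      using ex by blast
    then have "\<tau> \<bullet> H \<tau> / norm (grad \<rho> p) ^ 3 =
        (c' 0 $ 1 * c'' 0 $ 2 - c' 0 $ 2 * c'' 0 $ 1) / norm (c' 0) ^ 3"
      by (intro key[symmetric, of r c c' c'']) auto
    with * show "\<exists>c c' c'' r. r > 0 \<and> c 0 = p \<and>
        (\<forall>t\<in>{-r<..<r}. c t \<in> frontier \<Omega> \<and> c' t \<noteq> 0 \<and>
           (c has_vector_derivative c' t) (at t) \<and> (c' has_vector_derivative c'' t) (at t)) \<and>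
        n = vector [c' 0 $ 2, - (c' 0 $ 1)] /\<^sub>R norm (c' 0) \<and>
        \<tau> \<bullet> H \<tau> / norm (grad \<rho> p) ^ 3 =
          (c' 0 $ 1 * c'' 0 $ 2 - c' 0 $ 2 * c'' 0 $ 1) / norm (c' 0) ^ 3"
      by blast
  qed (use key in blast)
qed

section \<open>Comparison for the Robin problem\<close>

text \<open>Only component \<open>i\<close> of the gradient is differentiated, and only along axis
  \<open>i\<close>, which suits both \<open>u\<close> and comparison functions with explicit
  gradients. A positive \<open>k\<close> would make the slope positive just after the critical
  point, and the mean value theorem would give a larger value.\<close>

lemma interior_max_second_derivative:
  fixes w :: "real^'n::finite \<Rightarrow> real" and g :: "real^'n \<Rightarrow> real^'n"
  assumes "open S" "x \<in> S" and mx: "\<And>y. y \<in> S \<Longrightarrow> w y \<le> w x"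
    and D: "\<And>y. y \<in> S \<Longrightarrow> (w has_derivative (\<lambda>h. g y \<bullet> h)) (at y)"
    and D2: "((\<lambda>s. g (x + s *\<^sub>R axis i 1) $ i) has_real_derivative k) (at 0)"
  shows "k \<le> 0"
proof (rule ccontr)
  assume "\<not> k \<le> 0"
  let ?l = "\<lambda>s. x + s *\<^sub>R axis i (1::real)"
  have "(?l \<longlongrightarrow> x + 0 *\<^sub>R axis i 1) (at 0)" by (intro tendsto_intros)
  then have "\<forall>\<^sub>F s in at 0. ?l s \<in> S" using assms(1,2) by (simp add: topological_tendstoD)
  then obtain e where e: "e > 0" "\<And>s. s \<noteq> 0 \<Longrightarrow> \<bar>s\<bar> < e \<Longrightarrow> ?l s \<in> S"
    by (auto simp: eventually_at dist_real_def)
  then have inS: "?l s \<in> S" if "\<bar>s\<bar> < e" for s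
    using that assms(2) by (cases "s = 0") auto
  have D1: "((\<lambda>s. w (?l s)) has_real_derivative g (?l s) $ i) (at s)" if "\<bar>s\<bar> < e" for s
    using has_derivative_along_line_at[OF D[OF inS[OF that]]] by (simp add: inner_axis)
  have "g (?l 0) $ i = 0"
    by (rule DERIV_local_max[OF D1[of 0] e(1)]) (use e inS mx in auto)
  with DERIV_pos_inc_right[OF D2] \<open>\<not> k \<le> 0\<close> obtain d where
    d: "d > 0" "\<And>h. 0 < h \<Longrightarrow> h < d \<Longrightarrow> g (?l h) $ i > 0" by auto
  define h where "h = min d e / 2"
  have h: "0 < h" "h < d" "h < e" using d e by (auto simp: h_def)
  have "\<exists>z>0. z < h \<and> w (?l h) - w (?l 0) = (h - 0) * (g (?l z) $ i)"
    by (rule MVT2) (use h D1 in auto)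
  then obtain z where "0 < z" "z < h" "w (?l h) - w (?l 0) = h * (g (?l z) $ i)" by auto
  moreover have "g (?l z) $ i > 0" using d(2)[of z] h calculation by simp
  ultimately have "w (?l h) > w x" using h by (metis add.right_neutral diff_gt_0_iff_gt mult_pos_pos scaleR_zero_left)
  then show False using mx[OF inS[of h]] h by simp
qed

text \<open>The derivative of \<open>w\<close> is known only within the closure, so the argument
  runs along the inward normal on a one-sided interval: a negative outward derivative would make
  \<open>w\<close> increase inwards.\<close>

lemma frontier_max_normal_derivative:
  fixes \<Omega> :: "(real^'n::finite) set"
  assumes ldf: "local_defining_function \<Omega> p U \<rho>" and "open \<Omega>" and p: "p \<in> frontier \<Omega>"
    and mx: "\<And>y. y \<in> closure \<Omega> \<Longrightarrow> w y \<le> w p"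
    and D: "(w has_derivative (\<lambda>h. G \<bullet> h)) (at p within closure \<Omega>)"
  shows "G \<bullet> outer_normal \<Omega> p \<ge> 0"
proof (rule ccontr)
  assume neg: "\<not> G \<bullet> outer_normal \<Omega> p \<ge> 0"
  define d where "d = - outer_normal \<Omega> p"
  have n: "outer_normal \<Omega> p = grad \<rho> p /\<^sub>R norm (grad \<rho> p)"
    by (rule outer_normal_eq[OF assms(1-3)])
  have "grad \<rho> p \<noteq> 0" using ldf by (auto simp: local_defining_function_def)
  then have "grad \<rho> p \<bullet> d < 0" by (simp add: d_def n)
  from local_defining_function_sides(1)[OF ldf local_defining_function_frontier[OF assms(1-3)] this]
  obtain e where e: "e > 0" "\<And>s. 0 < s \<Longrightarrow> s < e \<Longrightarrow> p + s *\<^sub>R d \<in> \<Omega>" by blast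
  have "p \<in> closure \<Omega>" using p by (simp add: frontier_def)
  then have sub: "(\<lambda>s. p + s *\<^sub>R d) ` {0..<e} \<subseteq> closure \<Omega>"
  proof (intro image_subsetI)
    fix s assume "s \<in> {0..<e}"
    with \<open>p \<in> closure \<Omega>\<close> e(2)[of s] closure_subset[of \<Omega>] show "p + s *\<^sub>R d \<in> closure \<Omega>"
      by (cases "s = 0") auto
  qed
  have "((\<lambda>s::real. p + s *\<^sub>R d) has_derivative (\<lambda>s. s *\<^sub>R d)) (at 0 within {0..<e})"
    by (auto intro!: derivative_eq_intros)
  moreover have "(w has_derivative (\<lambda>h. G \<bullet> h)) (at (p + 0 *\<^sub>R d) within (\<lambda>s. p + s *\<^sub>R d) ` {0..<e})"
    using has_derivative_subset[OF D sub] by simp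
  ultimately have "((\<lambda>s. w (p + s *\<^sub>R d)) has_derivative (\<lambda>s. G \<bullet> (s *\<^sub>R d))) (at 0 within {0..<e})"
    by (rule has_derivative_in_compose)
  then have "((\<lambda>s. w (p + s *\<^sub>R d)) has_real_derivative G \<bullet> d) (at 0 within {0..<e})"
    by (simp add: has_field_derivative_def mult_commute_abs)
  moreover have "G \<bullet> d > 0" using neg by (simp add: d_def)
  ultimately obtain r where r: "r > 0" "\<And>h. 0 < h \<Longrightarrow> h < e \<Longrightarrow> h < r \<Longrightarrow> w (p + h *\<^sub>R d) > w p"
    using has_real_derivative_pos_inc_right[of "\<lambda>s. w (p + s *\<^sub>R d)" "G \<bullet> d" 0 "{0..<e}"] by auto
  define h where "h = min e r / 2"
  have "0 < h" "h < e" "h < r" using e r by (auto simp: h_def)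
  then have "w (p + h *\<^sub>R d) > w p" "p + h *\<^sub>R d \<in> closure \<Omega>"
    using r e closure_subset by blast+
  then show False using mx by force
qed

text \<open>\<open>v\<close> is an approximate solution, and \<open>\<psi>\<close> strictly
  dominates its defects in the equation and in the boundary condition. A positive maximum of
  \<open>\<sigma> * (u - v) - \<psi>\<close> with sign \<open>\<sigma>\<close> cannot lie outside
  \<open>N\<close> by \<open>outside\<close>, nor in \<open>\<Omega>\<close> by the second
  derivative test, nor on the frontier by the sign of the normal derivative. Restricting the
  derivatives to \<open>N\<close> allows \<open>v\<close> to be singular elsewhere.\<close>

lemma robin_comparison:
  fixes \<Omega> :: "(real^'n::finite) set"
  assumes dom: "smooth_bounded_domain \<Omega>" and sol: "robin_torsion_solution \<beta> \<Omega> u"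
    and "\<beta> > 0" "open N"
    and cont: "continuous_on (closure \<Omega>) v" "continuous_on (closure \<Omega>) \<psi>"
    and Dv: "\<And>z. z \<in> closure \<Omega> \<inter> N \<Longrightarrow> (v has_derivative (\<lambda>h. gv z \<bullet> h)) (at z)"
    and D\<psi>: "\<And>z. z \<in> closure \<Omega> \<inter> N \<Longrightarrow> (\<psi> has_derivative (\<lambda>h. g\<psi> z \<bullet> h)) (at z)"
    and D2v: "\<And>z i. z \<in> \<Omega> \<inter> N \<Longrightarrow>
        ((\<lambda>s. gv (z + s *\<^sub>R axis i 1) $ i) has_real_derivative hv z i) (at 0)"
    and D2\<psi>: "\<And>z i. z \<in> \<Omega> \<inter> N \<Longrightarrow>
        ((\<lambda>s. g\<psi> (z + s *\<^sub>R axis i 1) $ i) has_real_derivative h\<psi> z i) (at 0)"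
    and interior: "\<And>z. z \<in> \<Omega> \<inter> N \<Longrightarrow>
        \<bar>1 + (\<Sum>i\<in>UNIV. hv z i)\<bar> < - (\<Sum>i\<in>UNIV. h\<psi> z i)"
    and boundary: "\<And>z. z \<in> frontier \<Omega> \<inter> N \<Longrightarrow>
        \<bar>gv z \<bullet> outer_normal \<Omega> z + \<beta> * v z\<bar> < g\<psi> z \<bullet> outer_normal \<Omega> z + \<beta> * \<psi> z"
    and outside: "\<And>z. z \<in> closure \<Omega> - N \<Longrightarrow> \<bar>u z - v z\<bar> \<le> \<psi> z"
    and z: "z \<in> closure \<Omega>"
  shows "\<bar>u z - v z\<bar> \<le> \<psi> z"
proof -
  have \<Omega>: "open \<Omega>" "bounded \<Omega>" and ldf: "\<forall>p\<in>frontier \<Omega>. \<exists>U \<rho>. local_defining_function \<Omega> p U \<rho>"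
    using dom by (auto simp: smooth_bounded_domain_def)
  obtain G where G: "\<And>x. x \<in> closure \<Omega> \<Longrightarrow> (u has_derivative (\<lambda>h. G x \<bullet> h)) (at x within closure \<Omega>)"
    and Gb: "\<And>p. p \<in> frontier \<Omega> \<Longrightarrow> G p \<bullet> outer_normal \<Omega> p + \<beta> * u p = 0"
    using sol by (auto simp: robin_torsion_solution_def)
  have contu: "continuous_on (closure \<Omega>) u"
    using G has_derivative_continuous continuous_on_eq_continuous_within by blast
  have u1: "u differentiable (at x)" and u2: "partial_deriv i u differentiable (at x)"
    if "x \<in> \<Omega>" for x i
    using sol that \<Omega>(1) at_within_open[OF that \<Omega>(1)]
    by (auto simp: robin_torsion_solution_def numeral_2_eq_2 differentiable_on_def) metis
  have main: "\<sigma> * (u z - v z) \<le> \<psi> z" if \<sigma>: "\<sigma> = 1 \<or> \<sigma> = -1" for \<sigma> :: real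
  proof -
    define w where "w x = \<sigma> * (u x - v x) - \<psi> x" for x
    have cw: "continuous_on (closure \<Omega>) w"
      unfolding w_def[abs_def] by (intro continuous_intros contu cont)
    have cpt: "compact (closure \<Omega>)" and ne: "closure \<Omega> \<noteq> {}"
      using \<Omega> z by auto
    obtain x where x: "x \<in> closure \<Omega>" and mx: "\<And>y. y \<in> closure \<Omega> \<Longrightarrow> w y \<le> w x"
      using continuous_attains_sup[OF cpt ne cw] by metis
    have "w x \<le> 0"
    proof (rule ccontr)
      assume pos: "\<not> w x \<le> 0"
      have "x \<in> N"
      proof (rule ccontr)
        assume "x \<notin> N"
        then have "\<bar>u x - v x\<bar> \<le> \<psi> x" using outside x by auto
        then show False using pos \<sigma> by (auto simp: w_def)
      qed
      show False
      proof (cases "x \<in> \<Omega>")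
        case True
        define S where "S = \<Omega> \<inter> N"
        have S: "open S" "x \<in> S" using \<Omega> \<open>open N\<close> \<open>x \<in> N\<close> True by (auto simp: S_def)
        define g where "g y = \<sigma> *\<^sub>R (grad u y - gv y) - g\<psi> y" for y
        have Dw: "(w has_derivative (\<lambda>h. g y \<bullet> h)) (at y)" if "y \<in> S" for y
        proof -
          have y: "y \<in> closure \<Omega> \<inter> N" "y \<in> \<Omega>" using that closure_subset by (auto simp: S_def)
          show ?thesis
            unfolding w_def[abs_def] g_def
            by (rule has_derivative_eq_rhs[OF has_derivative_diff[OF has_derivative_mult_right[OF
                  has_derivative_diff[OF has_derivative_grad[OF u1[OF y(2)]] Dv[OF y(1)]]] D\<psi>[OF y(1)]]])
              (simp add: inner_diff_left)
        qed
        define k where "k i = \<sigma> * (partial_deriv i (partial_deriv i u) x - hv x i) - h\<psi> x i" for i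
        have "k i \<le> 0" for i
        proof (rule interior_max_second_derivative[OF S _ Dw])
          show "w y \<le> w x" if "y \<in> S" for y
            using mx[of y] that closure_subset by (auto simp: S_def)
          have "((\<lambda>s. partial_deriv i u (x + s *\<^sub>R axis i 1)) has_real_derivative
              grad (partial_deriv i u) x \<bullet> axis i 1) (at 0)"
            by (rule has_derivative_along_line[OF has_derivative_grad[OF u2[OF True]]])
          then have "((\<lambda>s. grad u (x + s *\<^sub>R axis i 1) $ i) has_real_derivative
              partial_deriv i (partial_deriv i u) x) (at 0)"
            by (simp add: grad_def inner_axis)
          then show "((\<lambda>s. g (x + s *\<^sub>R axis i 1) $ i) has_real_derivative k i) (at 0)"
            unfolding g_def k_def using D2v[of x i] D2\<psi>[of x i] S
            by (auto simp: S_def intro!: derivative_eq_intros)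
        qed
        then have "(\<Sum>i\<in>UNIV. k i) \<le> 0" by (simp add: sum_nonpos)
        moreover have "(\<Sum>i\<in>UNIV. k i) = \<sigma> * (laplacian u x - (\<Sum>i\<in>UNIV. hv x i)) - (\<Sum>i\<in>UNIV. h\<psi> x i)"
          by (simp add: k_def laplacian_def sum_subtractf flip: sum_distrib_left)
        moreover have "laplacian u x = -1" using sol True by (force simp: robin_torsion_solution_def)
        ultimately show False using interior[of x] \<sigma> True \<open>x \<in> N\<close> by auto
      next
        case False
        then have fr: "x \<in> frontier \<Omega>" using x \<Omega> by (simp add: frontier_def interior_open)
        then obtain U \<rho> where L: "local_defining_function \<Omega> x U \<rho>" using ldf by blast
        have Dw: "(w has_derivative (\<lambda>h. (\<sigma> *\<^sub>R (G x - gv x) - g\<psi> x) \<bullet> h)) (at x within closure \<Omega>)"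
          unfolding w_def[abs_def]
          by (rule has_derivative_eq_rhs[OF has_derivative_diff[OF has_derivative_mult_right[OF
                has_derivative_diff[OF G[OF x] has_derivative_at_withinI[OF Dv]]]
                has_derivative_at_withinI[OF D\<psi>]]])
            (use x \<open>x \<in> N\<close> in \<open>auto simp: inner_diff_left\<close>)
        have "(\<sigma> *\<^sub>R (G x - gv x) - g\<psi> x) \<bullet> outer_normal \<Omega> x \<ge> 0"
          by (rule frontier_max_normal_derivative[where w = w, OF L \<Omega>(1) fr _ Dw]) (rule mx)
        then have "\<sigma> * (G x \<bullet> outer_normal \<Omega> x - gv x \<bullet> outer_normal \<Omega> x)
            - g\<psi> x \<bullet> outer_normal \<Omega> x \<ge> 0"
          by (simp add: inner_diff_left)
        \<comment> \<open>Adding \<open>\<beta>\<close> times the positive maximum to the normal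
          derivative inequality eliminates \<open>u\<close> through the Robin condition; what
          remains sets the defect of \<open>v\<close> against that of \<open>\<psi>\<close>.\<close>
        moreover have "\<beta> * (\<sigma> * (u x - v x) - \<psi> x) > 0"
          using pos \<open>\<beta> > 0\<close> by (simp add: w_def)
        moreover have "G x \<bullet> outer_normal \<Omega> x = - \<beta> * u x" using Gb[OF fr] by simp
        moreover have "\<bar>gv x \<bullet> outer_normal \<Omega> x + \<beta> * v x\<bar> < g\<psi> x \<bullet> outer_normal \<Omega> x + \<beta> * \<psi> x"
          using boundary fr \<open>x \<in> N\<close> by blast
        ultimately show False using \<sigma> by (auto simp: algebra_simps abs_if split: if_splits)
      qed
    qed
    then show ?thesis using mx[OF z] by (simp add: w_def)
  qed
  show ?thesis using main[of 1] main[of "-1"] by (simp add: abs_le_iff)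
qed

section \<open>Bent profiles\<close>

lemma has_derivative_nth_scaled:
  "((\<lambda>z::real^'n. z $ i / X) has_derivative (\<lambda>h. h $ i / X)) F"
  by (intro bounded_linear_imp_has_derivative bounded_linear_divide bounded_linear_compose
      [OF bounded_linear_divide bounded_linear_vec_nth])

text \<open>\<open>T\<close> separates the oscillating core from the tails, and \<open>te\<close> is
  the tip. \<open>q_inner\<close> keeps the half-width away from 0 on the core; \<open>bend\<close>
  makes the term in \<open>b\<close> decide the curvature sign there; \<open>outer\<close> yields a
  single sign change per tail, the third derivative making \<open>q''\<close> increase;
  \<open>star\<close> is the monotonicity condition used in \<open>radial\<close>.\<close>

locale bent_profile =
  fixes q :: "real poly" and b T te :: real
  assumes q_even: "\<And>t. poly q (- t) = poly q t"
    and q_0: "poly q 0 = 0" and q_nonneg: "\<And>t. 0 \<le> poly q t"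
    and T_pos: "0 < T" and T_less: "T < te" and q_te: "poly q te = 1/4"
    and b_pos: "0 < b"
    and q_inner: "\<And>t. \<bar>t\<bar> \<le> T \<Longrightarrow> poly q t \<le> 1/8"
    and outer: "\<And>t. T \<le> t \<Longrightarrow> 0 < poly (pderiv q) t"
      "\<And>t. T \<le> t \<Longrightarrow> 0 < poly (pderiv (pderiv q)) t"
      "\<And>t. T \<le> t \<Longrightarrow> 0 < poly (pderiv (pderiv (pderiv q))) t"
    and bend: "\<And>t. \<bar>t\<bar> \<le> T \<Longrightarrow>
      \<bar>4 * (1/4 - poly q t) * poly (pderiv (pderiv q)) t + 2 * (poly (pderiv q) t)\<^sup>2\<bar>
        < 16 * b * ((1/4 - poly q t) * sqrt (1/4 - poly q t))"
    and star: "\<And>t. 0 < t \<Longrightarrow> t < te \<Longrightarrow>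
      b * t\<^sup>2 * sqrt (1/4 - poly q t) \<le> 1/4 - poly q t + t * poly (pderiv q) t / 2"
begin

abbreviation "q1 \<equiv> poly (pderiv q)"
abbreviation "q2 \<equiv> poly (pderiv (pderiv q))"

definition g :: "real \<Rightarrow> real" where "g t = 1/4 - poly q t"

lemma te_pos: "0 < te" using T_pos T_less by simp

lemma DERIV_g: "(g has_real_derivative - q1 t) (at t)"
  unfolding g_def[abs_def] by (auto intro!: derivative_eq_intros)

lemma g_le: "g t \<le> 1/4" using q_nonneg by (simp add: g_def)

lemma g_inner: "\<bar>t\<bar> \<le> T \<Longrightarrow> 1/8 \<le> g t" using q_inner[of t] by (simp add: g_def)

lemma g_even: "g (- t) = g t" by (simp add: g_def q_even)

lemma g_abs: "g \<bar>t\<bar> = g t" by (simp add: abs_if g_even)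

lemma q1_odd: "q1 (- t) = - q1 t"
proof -
  have "((\<lambda>t. poly q (- t)) has_real_derivative q1 (- t) * - 1) (at t)"
    by (rule DERIV_chain'[where g = "poly q"]) (auto intro!: derivative_eq_intros)
  moreover have "((\<lambda>t. poly q (- t)) has_real_derivative q1 t) (at t)"
    by (simp add: q_even)
  ultimately have "q1 (- t) * - 1 = q1 t" by (rule DERIV_unique)
  then show ?thesis by simp
qed

lemma q2_even: "q2 (- t) = q2 t"
proof -
  have "((\<lambda>t. q1 (- t)) has_real_derivative q2 (- t) * - 1) (at t)"
    by (rule DERIV_chain'[where g = q1]) (auto intro!: derivative_eq_intros)
  moreover have "((\<lambda>t. q1 (- t)) has_real_derivative - q2 t) (at t)"
    by (auto simp: q1_odd intro!: derivative_eq_intros)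
  ultimately have "q2 (- t) * - 1 = - q2 t" by (rule DERIV_unique)
  then show ?thesis by simp
qed

lemma q_mono: "T \<le> s \<Longrightarrow> s < t \<Longrightarrow> poly q s < poly q t"
  by (rule DERIV_pos_imp_increasing) (use outer(1) poly_DERIV in fastforce)+

lemma q1_mono: "T \<le> s \<Longrightarrow> s < t \<Longrightarrow> q1 s < q1 t"
  by (rule DERIV_pos_imp_increasing) (use outer(2) poly_DERIV in fastforce)+

lemma q2_mono: "T \<le> s \<Longrightarrow> s < t \<Longrightarrow> q2 s < q2 t"
  by (rule DERIV_pos_imp_increasing) (use outer(3) poly_DERIV in fastforce)+

lemma g_te: "g te = 0" by (simp add: g_def q_te)

lemma g_pos_iff: "0 < g t \<longleftrightarrow> \<bar>t\<bar> < te"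
proof -
  have "0 < g t \<longleftrightarrow> t < te" if "t \<ge> 0" for t
  proof (cases "t \<le> T")
    case True
    then show ?thesis using g_inner[of t] that T_less by auto
  next
    case False
    then show ?thesis
      using q_mono[of t te] q_mono[of te t] T_less q_te by (cases t te rule: linorder_cases) (auto simp: g_def)
  qed
  from this[of "\<bar>t\<bar>"] show ?thesis by (simp add: g_abs)
qed

lemma g_zero_iff: "g t = 0 \<longleftrightarrow> \<bar>t\<bar> = te"
proof
  assume "g t = 0"
  show "\<bar>t\<bar> = te"
  proof (rule ccontr)
    assume "\<bar>t\<bar> \<noteq> te"
    then have "te < \<bar>t\<bar>" using \<open>g t = 0\<close> g_pos_iff[of t] by auto
    then have "poly q te < poly q \<bar>t\<bar>" using q_mono[of te "\<bar>t\<bar>"] T_less by simp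
    then show False using \<open>g t = 0\<close> g_abs[of t] q_te by (simp add: g_def)
  qed
next
  assume "\<bar>t\<bar> = te"
  then show "g t = 0" using g_abs[of t] g_te by simp
qed

lemma g_nonneg_iff: "0 \<le> g t \<longleftrightarrow> \<bar>t\<bar> \<le> te"
  using g_pos_iff[of t] g_zero_iff[of t] by (auto simp: le_less)

lemma q1_nonzero: "T \<le> \<bar>t\<bar> \<Longrightarrow> q1 t \<noteq> 0"
  using outer(1)[of t] outer(1)[of "- t"] q1_odd[of t] by (cases "t \<ge> 0") auto

text \<open>The zeros of \<open>g\<close> at the tips are simple. With \<open>t = te * sin s\<close>
  the first factor becomes the square of \<open>te * cos s\<close>, so the square root of
  \<open>g\<close> extends smoothly, with a sign, through the tips.\<close>

lemma g_factor:
  obtains G :: "real poly" where "\<And>t. g t = (te\<^sup>2 - t\<^sup>2) * poly G t" "\<And>t. \<bar>t\<bar> \<le> te \<Longrightarrow> 0 < poly G t"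
proof -
  define P where "P = [:1/4:] - q"
  have P: "poly P t = g t" for t by (simp add: P_def g_def)
  have "poly P te = 0" by (simp add: P g_te)
  then obtain A where A: "P = [:- te, 1:] * A" using poly_eq_0_iff_dvd by (metis dvdE)
  have "poly P (- te) = 0" by (simp add: P g_even g_te)
  then have "poly A (- te) = 0" using te_pos by (simp add: A)
  then obtain B where B: "A = [:- (- te), 1:] * B" using poly_eq_0_iff_dvd by (metis dvdE)
  have gB: "g t = (te\<^sup>2 - t\<^sup>2) * poly (- B) t" for t
    unfolding P[symmetric] by (simp add: A B algebra_simps power2_eq_square)
  moreover have "0 < poly (- B) t" if t: "\<bar>t\<bar> \<le> te" for t
  proof (cases "\<bar>t\<bar> < te")
    case True
    then have "0 < te\<^sup>2 - t\<^sup>2" using abs_square_less_1 by (metis abs_of_pos diff_gt_0_iff_gt power2_abs power_strict_mono abs_ge_zero zero_less_numeral)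
    moreover have "0 < g t" using True g_pos_iff by simp
    ultimately show ?thesis unfolding gB using zero_less_mult_pos by blast
  next
    case False
    then have t: "\<bar>t\<bar> = te" using that by simp
    \<comment> \<open>At a tip the value of \<open>g\<close> carries no information about the
      cofactor, but its derivative does: there \<open>q1 t\<close> is \<open>2 * t\<close> times the
      cofactor and has the sign of \<open>t\<close>.\<close>
    have "(g has_real_derivative - 2 * t * poly (- B) t + (te\<^sup>2 - t\<^sup>2) * poly (pderiv (- B)) t) (at t)"
      unfolding gB[abs_def] by (auto intro!: derivative_eq_intros simp del: poly_minus)
    then have "- q1 t = - 2 * t * poly (- B) t + (te\<^sup>2 - t\<^sup>2) * poly (pderiv (- B)) t"
      using DERIV_g DERIV_unique by blast
    then have eq: "q1 t = 2 * t * poly (- B) t" using t by auto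
    show ?thesis
    proof (cases "t \<ge> 0")
      case True
      then have "0 < 2 * t * poly (- B) t" "0 < 2 * t"
        using outer(1)[of t] T_less t te_pos unfolding eq by auto
      then show ?thesis by (rule zero_less_mult_pos)
    next
      case False
      then have "q1 t < 0" using outer(1)[of "- t"] T_less t q1_odd[of t] by simp
      then have "0 < - (2 * t) * poly (- B) t" "0 < - (2 * t)" using False unfolding eq by auto
      then show ?thesis by (rule zero_less_mult_pos)
    qed
  qed
  ultimately show ?thesis using that by blast
qed

text \<open>\<open>4 Y\<^sup>2 q'' + 16 b Y\<^sup>3 + 2 q'\<^sup>2\<close> is the numerator of the curvature at height \<open>Y\<close> above the
  midline; on the lower arc \<open>Y = - sqrt g\<close> it becomes \<open>bending\<close>.\<close>

definition bending :: "real \<Rightarrow> real" where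
  "bending t = 4 * g t * q2 t + 2 * (q1 t)\<^sup>2 - 16 * b * (g t * sqrt (g t))"

lemma bending_inner: "\<bar>t\<bar> \<le> T \<Longrightarrow> bending t < 0"
  using bend[of t] by (simp add: bending_def g_def abs_less_iff)

text \<open>On the core, \<open>bend\<close> bounds the first two terms below by another
  \<open>- 16 * b\<close> times the cube of \<open>sqrt (g t)\<close>, whence 32; in the tails these
  two terms are nonnegative.\<close>

lemma bending_lower: "\<bar>t\<bar> \<le> te \<Longrightarrow> bending t \<ge> - 32 * b * (g t * sqrt (g t))"
proof (cases "\<bar>t\<bar> \<le> T")
  case True
  then show ?thesis using bend[of t] by (simp add: bending_def g_def abs_less_iff)
next
  case False
  assume t: "\<bar>t\<bar> \<le> te"
  then have "0 \<le> g t" by (simp add: g_nonneg_iff)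
  moreover have "0 < q2 t" using outer(2)[of t] outer(2)[of "- t"] q2_even[of t] False by (cases "t \<ge> 0") auto
  moreover have "0 \<le> b * (g t * sqrt (g t))" using b_pos \<open>0 \<le> g t\<close> by simp
  moreover have "0 \<le> 4 * g t * q2 t" using calculation by simp
  moreover have "16 * b * (g t * sqrt (g t)) = 16 * (b * (g t * sqrt (g t)))"
    "- 32 * b * (g t * sqrt (g t)) = - 32 * (b * (g t * sqrt (g t)))" by simp_all
  ultimately show ?thesis unfolding bending_def using zero_le_power2[of "q1 t"] by linarith
qed

text \<open>The tips are included: there \<open>g\<close> vanishes and only the nonzero
  \<open>q1\<close> keeps the expression positive.\<close>

lemma upper_positive: "\<bar>t\<bar> \<le> te \<Longrightarrow> 4 * g t * q2 t + 2 * (q1 t)\<^sup>2 + 16 * b * (g t * sqrt (g t)) > 0"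
proof (cases "\<bar>t\<bar> \<le> T")
  case True
  then show ?thesis using bend[of t] by (simp add: g_def abs_less_iff)
next
  case False
  assume t: "\<bar>t\<bar> \<le> te"
  then have "0 \<le> g t" by (simp add: g_nonneg_iff)
  moreover have "0 < q2 t" using outer(2)[of t] outer(2)[of "- t"] q2_even[of t] False by (cases "t \<ge> 0") auto
  moreover have "0 \<le> b * (g t * sqrt (g t))" using b_pos \<open>0 \<le> g t\<close> by simp
  moreover have "0 \<le> 4 * g t * q2 t" using calculation by simp
  moreover have "0 < (q1 t)\<^sup>2" using q1_nonzero False by simp
  ultimately show ?thesis by (simp add: add_pos_nonneg add_nonneg_pos)
qed

text \<open>\<open>bending\<close> is negative on the core and positive at the tip, where only the
  term in \<open>q1\<close> survives, so a zero exists in between. Uniqueness needs a monotone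
  quantity, and evenness transfers the result to negative \<open>t\<close>.\<close>

lemma bending_zero:
  obtains t0 where "T < t0" "t0 < te" "\<And>t. \<bar>t\<bar> \<le> te \<Longrightarrow> bending t = 0 \<longleftrightarrow> \<bar>t\<bar> = t0"
proof -
  have even: "bending \<bar>t\<bar> = bending t" for t
    by (simp add: bending_def abs_if g_even q1_odd q2_even)
  have "continuous_on {T..te} bending"
    unfolding bending_def[abs_def] g_def by (intro continuous_intros)
  moreover have "bending T \<le> 0" using bending_inner[of T] T_pos by simp
  moreover have te: "0 < bending te"
    using q1_nonzero[of te] T_less te_pos by (simp add: bending_def g_te)
  ultimately obtain t0 where t0: "T \<le> t0" "t0 \<le> te" "bending t0 = 0"
    using IVT'[of bending T 0 te] T_less by auto
  then have strict: "T < t0" "t0 < te"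
    using te bending_inner[of T] T_pos by (auto simp: le_less)
  \<comment> \<open>Dividing by the positive \<open>g t * sqrt (g t)\<close> isolates the bend as
    the constant \<open>16 * b\<close>. In the tail both quotients increase: \<open>q1\<close> and
    \<open>q2\<close> grow while \<open>g\<close> decreases.\<close>
  define n where "n t = 4 * q2 t / sqrt (g t) + 2 * (q1 t)\<^sup>2 / (g t * sqrt (g t))" for t
  have n: "bending t = g t * sqrt (g t) * (n t - 16 * b)" if "\<bar>t\<bar> < te" for t
  proof -
    have "0 < g t" using that g_pos_iff by simp
    then show ?thesis by (simp add: bending_def n_def field_simps)
  qed
  have mono: "n s < n t" if "T \<le> s" "s < t" "t < te" for s t
  proof -
    have g: "0 < g t" "g t < g s"
      using that T_pos g_pos_iff[of t] q_mono[of s t] by (auto simp: g_def)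
    then have sg: "0 < sqrt (g t)" "sqrt (g t) < sqrt (g s)" by auto
    have q: "0 < q2 s" "q2 s < q2 t" "0 < q1 s" "q1 s < q1 t"
      using that outer q1_mono q2_mono by auto
    have "4 * q2 s / sqrt (g s) < 4 * q2 t / sqrt (g t)"
      by (rule frac_less) (use q sg in auto)
    moreover have "2 * (q1 s)\<^sup>2 / (g s * sqrt (g s)) < 2 * (q1 t)\<^sup>2 / (g t * sqrt (g t))"
    proof (rule frac_less)
      show "g t * sqrt (g t) \<le> g s * sqrt (g s)"
        by (rule mult_mono) (use g sg in auto)
    qed (use q g sg in \<open>auto intro: power_strict_mono\<close>)
    ultimately show ?thesis by (simp add: n_def)
  qed
  have zero: "bending t = 0 \<longleftrightarrow> t = t0" if "0 \<le> t" "t \<le> te" for t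
  proof
    assume z: "bending t = 0"
    have tT: "T < t" using bending_inner[of t] z that by (cases "t \<le> T") auto
    have "t \<noteq> te" using z te by auto
    then have lt: "t < te" using that by simp
    have gp: "0 < g t * sqrt (g t)" "0 < g t0 * sqrt (g t0)"
      using lt that strict T_pos g_pos_iff[of t] g_pos_iff[of t0] by auto
    have "g t * sqrt (g t) * (n t - 16 * b) = 0" using n[of t] z that lt by simp
    then have "n t = 16 * b" using gp(1) by (metis mult_eq_0_iff less_irrefl right_minus_eq)
    moreover have "g t0 * sqrt (g t0) * (n t0 - 16 * b) = 0" using n[of t0] t0(3) strict T_pos by simp
    then have "n t0 = 16 * b" using gp(2) by (metis mult_eq_0_iff less_irrefl right_minus_eq)
    ultimately show "t = t0"
      using mono[of t t0] mono[of t0 t] tT strict lt by (cases t t0 rule: linorder_cases) auto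
  qed (use t0 in simp)
  show ?thesis
  proof (rule that[OF strict])
    show "bending t = 0 \<longleftrightarrow> \<bar>t\<bar> = t0" if "\<bar>t\<bar> \<le> te" for t
      using zero[of "\<bar>t\<bar>"] that even[of t] by simp
  qed
qed

text \<open>This is the estimate for the point at fraction \<open>l\<close> of a segment from the
  centre. The term \<open>l * (1 - l) * (b * t\<^sup>2)\<close> is what the quadratic midline loses
  on being interpolated linearly.\<close>

lemma radial:
  assumes l: "0 \<le> l" "l \<le> 1" and t: "\<bar>t\<bar> < te"
  shows "l * sqrt (g t) + l * (1 - l) * (b * t\<^sup>2) \<le> sqrt (g (l * t))"
proof -
  have main: "l * sqrt (g t) + l * (1 - l) * (b * t\<^sup>2) \<le> sqrt (g (l * t))" if t: "0 < t" "t < te" for t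
  proof (cases "l = 0")
    case True
    then show ?thesis by (simp add: g_def q_0)
  next
    case False
    then have l0: "0 < l" using l by simp
    \<comment> \<open>\<open>- r s\<close> is the slope of the line from the centre
      \<open>(0, 1/2)\<close> to the lower arc over \<open>s\<close>, in unstretched coordinates.
      \<open>star\<close> says exactly that the derivative of \<open>r\<close> is not
      positive.\<close>
    define r where "r s = sqrt (g s) / s + b * s" for s
    have "r t \<le> r (l * t)"
    proof (rule DERIV_nonpos_imp_nonincreasing[of "l * t" t r])
      show "l * t \<le> t" using l t by (simp add: mult_left_le_one_le)
    next
      fix s assume s: "l * t \<le> s" "s \<le> t"
      then have s0: "0 < s" "s < te" using l0 t by (auto intro: less_le_trans[OF mult_pos_pos])
      then have gs: "0 < g s" using g_pos_iff[of s] by simp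
      have "(r has_real_derivative (- q1 s / (2 * sqrt (g s)) * s - sqrt (g s)) / s\<^sup>2 + b) (at s)"
        unfolding r_def[abs_def] using gs s0
        by (auto intro!: derivative_eq_intros DERIV_g[THEN DERIV_chain2] simp: field_simps power2_eq_square)
      moreover have "(- q1 s / (2 * sqrt (g s)) * s - sqrt (g s)) / s\<^sup>2 + b =
          (b * s\<^sup>2 * sqrt (g s) - (g s + s * q1 s / 2)) / (s\<^sup>2 * sqrt (g s))"
        using gs s0 by (simp add: field_simps flip: power2_eq_square)
      moreover have "\<dots> \<le> 0"
        using star[of s] s0 gs by (intro divide_nonpos_pos) (auto simp: g_def)
      ultimately show "\<exists>y. (r has_real_derivative y) (at s) \<and> y \<le> 0" by auto
    qed
    then have "l * t * r t \<le> l * t * r (l * t)" using l0 t by simp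
    moreover have "l * t * r t = l * sqrt (g t) + l * (b * t\<^sup>2)"
      using t by (simp add: r_def algebra_simps power2_eq_square)
    moreover have "l * t * r (l * t) = sqrt (g (l * t)) + l * l * (b * t\<^sup>2)"
      using t l0 by (simp add: r_def algebra_simps power2_eq_square)
    ultimately show ?thesis by (simp add: algebra_simps)
  qed
  show ?thesis
  proof (cases "t = 0")
    case True
    then show ?thesis using l by (simp add: g_def q_0)
  next
    case False
    then have "l * sqrt (g \<bar>t\<bar>) + l * (1 - l) * (b * \<bar>t\<bar>\<^sup>2) \<le> sqrt (g (l * \<bar>t\<bar>))"
      using main[of "\<bar>t\<bar>"] t by simp
    then show ?thesis using g_abs[of t] g_abs[of "l * t"] l by (simp add: abs_mult)
  qed
qed

end

section \<open>The stretched domains\<close>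

context bent_profile
begin

definition offset :: "real \<Rightarrow> real^2 \<Rightarrow> real" where
  "offset X z = z $ 2 - 1/2 + b * (z $ 1 / X)\<^sup>2"

definition rho :: "real \<Rightarrow> real^2 \<Rightarrow> real" where
  "rho X z = (offset X z)\<^sup>2 - g (z $ 1 / X)"

definition dom :: "real \<Rightarrow> (real^2) set" where
  "dom X = {z. rho X z < 0}"

definition grad_rho :: "real \<Rightarrow> real^2 \<Rightarrow> real^2" where
  "grad_rho X z = vector [(q1 (z $ 1 / X) + 4 * b * (z $ 1 / X) * offset X z) / X, 2 * offset X z]"

lemma real_polynomial_rho: "real_polynomial_function (rho X)"
proof -
  have x: "real_polynomial_function (\<lambda>z::real^2. z $ 1 / X)"
    by (intro real_polynomial_function.intros(1) bounded_linear_divide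
        bounded_linear_compose[OF bounded_linear_divide bounded_linear_vec_nth])
  have y: "real_polynomial_function (\<lambda>z::real^2. z $ 2)"
    by (intro real_polynomial_function.intros(1) bounded_linear_vec_nth)
  show ?thesis
    unfolding rho_def[abs_def] offset_def g_def
    by (intro real_polynomial_function_diff real_polynomial_function.intros(2-)
        real_polynomial_function_power real_polynomial_function_poly x y)
qed

lemma has_derivative_offset:
  "(offset X has_derivative (\<lambda>h. h $ 2 + 2 * b * (z $ 1 / X) * (h $ 1 / X))) (at z)"
  unfolding offset_def[abs_def]
  by (rule has_derivative_nth_scaled bounded_linear_imp_has_derivative[OF bounded_linear_vec_nth]
      derivative_eq_intros refl)+ (simp add: fun_eq_iff)

lemma has_derivative_poly_scaled:
  "((\<lambda>z::real^2. poly p (z $ 1 / X)) has_derivative (\<lambda>h. h $ 1 / X * poly (pderiv p) (z $ 1 / X))) (at z)"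
  by (rule DERIV_compose_FDERIV[OF poly_DERIV has_derivative_nth_scaled])

lemma grad_rho_eq: "grad (rho X) z = grad_rho X z"
proof (rule grad_eqI)
  show "(rho X has_derivative (\<lambda>h. grad_rho X z \<bullet> h)) (at z)"
    unfolding rho_def[abs_def] g_def
    by (rule has_derivative_offset has_derivative_poly_scaled derivative_eq_intros refl)+
      (simp add: fun_eq_iff grad_rho_def inner_vec_def UNIV_2 algebra_simps add_divide_distrib power2_eq_square)
qed

definition hess_rho :: "real \<Rightarrow> real^2 \<Rightarrow> real^2 \<Rightarrow> real^2" where
  "hess_rho X z h = vector
    [(q2 (z $ 1 / X) + 8 * b\<^sup>2 * (z $ 1 / X)\<^sup>2 + 4 * b * offset X z) / X\<^sup>2 * h $ 1 + 4 * b * (z $ 1 / X) / X * h $ 2,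
     4 * b * (z $ 1 / X) / X * h $ 1 + 2 * h $ 2]"

lemma has_derivative_vector_2:
  fixes f1 f2 :: "'a::real_normed_vector \<Rightarrow> real"
  assumes "(f1 has_derivative D1) F" "(f2 has_derivative D2) F"
  shows "((\<lambda>z. vector [f1 z, f2 z] :: real^2) has_derivative (\<lambda>h. vector [D1 h, D2 h])) F"
proof -
  have eq: "(vector [a, b] :: real^2) = a *\<^sub>R axis 1 1 + b *\<^sub>R axis 2 1" for a b
    by (simp add: vec_eq_iff forall_2 axis_def)
  show ?thesis
    unfolding eq by (intro has_derivative_add has_derivative_scaleR_left assms)
qed

lemma has_derivative_grad_rho: "(grad_rho X has_derivative hess_rho X z) (at z)"
proof -
  have D1: "((\<lambda>z. (q1 (z $ 1 / X) + 4 * b * (z $ 1 / X) * offset X z) / X) has_derivative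
      (\<lambda>h. hess_rho X z h $ 1)) (at z)"
    by (rule has_derivative_eq_rhs, (rule has_derivative_nth_scaled has_derivative_offset has_derivative_poly_scaled
        bounded_linear.has_derivative[OF bounded_linear_divide] derivative_eq_intros refl)+)
      (simp add: fun_eq_iff hess_rho_def algebra_simps add_divide_distrib power2_eq_square)
  have D2: "((\<lambda>z. 2 * offset X z) has_derivative (\<lambda>h. hess_rho X z h $ 2)) (at z)"
    by (rule has_derivative_offset derivative_eq_intros refl)+
      (simp add: fun_eq_iff hess_rho_def algebra_simps)
  have "(vector [hess_rho X z h $ 1, hess_rho X z h $ 2] :: real^2) = hess_rho X z h" for h
    by (simp add: vec_eq_iff forall_2)
  then show ?thesis
    using has_derivative_vector_2[OF D1 D2] by (simp add: grad_rho_def[abs_def])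
qed

lemma rho_zero_iff: "rho X z = 0 \<longleftrightarrow> (offset X z)\<^sup>2 = g (z $ 1 / X)"
  by (auto simp: rho_def)

lemma rho_zero_le: "rho X z = 0 \<Longrightarrow> \<bar>z $ 1 / X\<bar> \<le> te"
  using g_nonneg_iff[of "z $ 1 / X"] zero_le_power2[of "offset X z"] by (simp add: rho_zero_iff)

text \<open>A vanishing second gradient component means that the point lies on the midline. On the
  zero set this happens only at the tips, where the first component is \<open>q1\<close> over
  \<open>X\<close> and hence nonzero.\<close>

lemma regular_sublevel_set_dom:
  assumes "X > 0"
  shows "regular_sublevel_set (dom X) (rho X)"
proof
  show "real_polynomial_function (rho X)" by (rule real_polynomial_rho)
  show "dom X = {z. rho X z < 0}" by (rule dom_def)
  fix z assume z: "rho X z = 0"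
  show "grad (rho X) z \<noteq> 0"
  proof
    assume *: "grad (rho X) z = 0"
    then have Y: "offset X z = 0" by (simp add: grad_rho_eq grad_rho_def vec_eq_iff forall_2)
    then have "q1 (z $ 1 / X) = 0"
      using * assms by (simp add: grad_rho_eq grad_rho_def vec_eq_iff forall_2)
    moreover have "g (z $ 1 / X) = 0" using z Y by (simp add: rho_zero_iff)
    ultimately show False using q1_nonzero[of "z $ 1 / X"] g_zero_iff T_less by simp
  qed
qed

lemma frontier_dom: "X > 0 \<Longrightarrow> frontier (dom X) = {z. rho X z = 0}"
  by (rule regular_sublevel_set.frontier_eq[OF regular_sublevel_set_dom])

lemma dom_bounds:
  assumes "X > 0" "rho X z \<le> 0"
  shows "\<bar>z $ 1 / X\<bar> \<le> te" "\<bar>offset X z\<bar> \<le> 1/2" "\<bar>z $ 2 - 1/2\<bar> \<le> 1/2 + b * te\<^sup>2"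
proof -
  have le: "(offset X z)\<^sup>2 \<le> g (z $ 1 / X)" using assms by (simp add: rho_def)
  then have "0 \<le> g (z $ 1 / X)" by (meson order_trans zero_le_power2)
  then show t: "\<bar>z $ 1 / X\<bar> \<le> te" by (simp add: g_nonneg_iff)
  have "(offset X z)\<^sup>2 \<le> (1/2)\<^sup>2"
    using le g_le[of "z $ 1 / X"] by (simp add: power2_eq_square)
  then show Y: "\<bar>offset X z\<bar> \<le> 1/2" using abs_le_square_iff[of "offset X z" "1/2"] by simp
  have "(z $ 1 / X)\<^sup>2 \<le> te\<^sup>2" using t abs_le_square_iff[of "z $ 1 / X" te] te_pos by simp
  then have "0 \<le> b * (z $ 1 / X)\<^sup>2" "b * (z $ 1 / X)\<^sup>2 \<le> b * te\<^sup>2"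
    using b_pos by (auto intro: mult_left_mono)
  then show "\<bar>z $ 2 - 1/2\<bar> \<le> 1/2 + b * te\<^sup>2"
    using Y unfolding offset_def by linarith
qed

lemma starlike_dom:
  assumes "X > 0"
  shows "starlike (dom X)"
proof -
  define a :: "real^2" where "a = vector [0, 1/2]"
  have a: "a \<in> dom X" by (simp add: a_def dom_def rho_def offset_def g_def q_0)
  moreover have "closed_segment a z \<subseteq> dom X" if z: "z \<in> dom X" for z
  proof
    fix w assume "w \<in> closed_segment a z"
    then obtain l where l: "0 \<le> l" "l \<le> 1" "w = (1 - l) *\<^sub>R a + l *\<^sub>R z"
      by (auto simp: in_segment)
    define t where "t = z $ 1 / X"
    have w1: "w $ 1 / X = l * t" by (simp add: l a_def t_def)
    \<comment> \<open>The height above the midline is not linear along the segment, because the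
      midline is a parabola.\<close>
    have w2: "offset X w = l * offset X z - l * (1 - l) * (b * t\<^sup>2)"
      unfolding offset_def w1 by (simp add: l a_def t_def[symmetric] algebra_simps power2_eq_square)
    have sq: "(offset X z)\<^sup>2 < g t" using z by (simp add: dom_def rho_def t_def)
    then have "0 < g t" by (meson le_less_trans zero_le_power2)
    then have t: "\<bar>t\<bar> < te" by (simp add: g_pos_iff)
    have Y: "\<bar>offset X z\<bar> < sqrt (g t)" using sq by (simp add: real_less_rsqrt)
    show "w \<in> dom X"
    proof (cases "l = 0")
      case True
      then show ?thesis using a l by simp
    next
      case False
      then have "l * \<bar>offset X z\<bar> < l * sqrt (g t)" using Y l by simp
      moreover have "0 \<le> l * (1 - l) * (b * t\<^sup>2)" using l b_pos by simp
      moreover have "\<bar>l * offset X z\<bar> = l * \<bar>offset X z\<bar>" using l by (simp add: abs_mult)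
      \<comment> \<open>The correction pushes \<open>w\<close> downwards relative to the midline;
        estimating absolute values covers the upper and the lower arc by the one inequality
        \<open>radial\<close>.\<close>
      ultimately have "\<bar>offset X w\<bar> < sqrt (g (l * t))"
        using radial[OF l(1,2) t] unfolding w2 by linarith
      then have "\<bar>offset X w\<bar>\<^sup>2 < (sqrt (g (l * t)))\<^sup>2"
        by (intro power_strict_mono) auto
      moreover have "0 \<le> g (l * t)"
      proof -
        have "0 < sqrt (g (l * t))" using \<open>\<bar>offset X w\<bar> < sqrt (g (l * t))\<close> by linarith
        then show ?thesis by simp
      qed
      ultimately show ?thesis by (simp add: dom_def rho_def w1)
    qed
  qed
  ultimately show ?thesis unfolding starlike_def by blast
qed

lemma smooth_bounded_domain_dom:
  assumes "X > 0"
  shows "smooth_bounded_domain (dom X)"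
proof (rule regular_sublevel_set.smooth_bounded_domain_sublevel[OF regular_sublevel_set_dom[OF assms]])
  show "connected (dom X)" by (rule starlike_imp_connected[OF starlike_dom[OF assms]])
  have "vector [0, 1/2] \<in> dom X" by (simp add: dom_def rho_def offset_def g_def q_0)
  then show "dom X \<noteq> {}" by blast
  have "norm z \<le> te * X + (1 + b * te\<^sup>2)" if "z \<in> dom X" for z
  proof -
    have r: "rho X z \<le> 0" using that by (simp add: dom_def)
    have "\<bar>z $ 1\<bar> \<le> te * X" using dom_bounds(1)[OF assms r] assms by (simp add: abs_divide divide_le_eq)
    moreover have "\<bar>z $ 2\<bar> \<le> 1 + b * te\<^sup>2" using dom_bounds(3)[OF assms r] by linarith
    moreover have "norm z \<le> \<bar>z $ 1\<bar> + \<bar>z $ 2\<bar>"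
      using norm_le_l1_cart[of z] by (simp add: UNIV_2)
    ultimately show ?thesis by linarith
  qed
  then show "bounded (dom X)" by (meson boundedI)
qed

text \<open>The curvature is defined through curves, so one must be exhibited through every frontier
  point. As graphs over \<open>t\<close> the arcs have vertical tangents at the tips; the angle
  \<open>s\<close> with \<open>t = te * sin s\<close> avoids this.\<close>

lemma frontier_curve:
  assumes "X > 0" "rho X p = 0"
  obtains c c' c'' :: "real \<Rightarrow> real^2" where "c 0 = p"
    "\<And>s. c s \<in> frontier (dom X) \<and> c' s \<noteq> 0 \<and>
      (c has_vector_derivative c' s) (at s) \<and> (c' has_vector_derivative c'' s) (at s)"
proof -
  obtain G where G: "\<And>t. g t = (te\<^sup>2 - t\<^sup>2) * poly G t" and G_pos: "\<And>t. \<bar>t\<bar> \<le> te \<Longrightarrow> 0 < poly G t"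
    using g_factor by blast
  define t where "t s = te * sin s" for s
  have t_le: "\<bar>t s\<bar> \<le> te" for s
    using te_pos mult_left_mono[OF abs_sin_le_one, of te] by (simp add: t_def abs_mult)
  have Gt: "0 < poly G (t s)" for s using G_pos t_le by simp
  \<comment> \<open>A square root of \<open>g (t s)\<close> that changes sign with
    \<open>cos s\<close>, so a single formula runs through both arcs and both tips.\<close>
  define Y where "Y s = te * cos s * sqrt (poly G (t s))" for s
  define Y' where "Y' s = - te * sin s * sqrt (poly G (t s)) +
      te * cos s * (poly (pderiv G) (t s) * (te * cos s) / (2 * sqrt (poly G (t s))))" for s
  define c :: "real \<Rightarrow> real^2" where "c s = vector [X * t s, 1/2 - b * (t s)\<^sup>2 + Y s]" for s
  define c' :: "real \<Rightarrow> real^2" where "c' s = vector [X * (te * cos s), - (2 * b * t s * (te * cos s)) + Y' s]" for s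
  have t': "(t has_real_derivative te * cos s) (at s)" for s
    unfolding t_def[abs_def] by (auto intro!: derivative_eq_intros)
  have Gd: "((\<lambda>s. poly P (t s)) has_real_derivative poly (pderiv P) (t s) * (te * cos s)) (at s)" for s P
    by (rule DERIV_chain2[OF poly_DERIV t'])
  have rt: "((\<lambda>s. sqrt (poly G (t s))) has_real_derivative
      poly (pderiv G) (t s) * (te * cos s) / (2 * sqrt (poly G (t s)))) (at s)" for s
  proof -
    have 1: "(sqrt has_real_derivative inverse (sqrt (poly G (t s))) / 2) (at (poly G (t s)))"
      using Gt[of s] by (rule DERIV_real_sqrt)
    have 2: "((\<lambda>s. sqrt (poly G (t s))) has_real_derivative
        inverse (sqrt (poly G (t s))) / 2 * (poly (pderiv G) (t s) * (te * cos s))) (at s)"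
      using 1 Gd by (rule DERIV_chain2)
    have 3: "inverse (sqrt (poly G (t s))) / 2 * (poly (pderiv G) (t s) * (te * cos s)) =
        poly (pderiv G) (t s) * (te * cos s) / (2 * sqrt (poly G (t s)))"
      by (simp only: divide_inverse inverse_mult_distrib mult_ac)
    show ?thesis using 2 unfolding 3 .
  qed
  have tc: "((\<lambda>s. te * cos s) has_real_derivative te * - sin s) (at s)" for s
    by (rule DERIV_cmult[OF DERIV_cos])
  have Y_D: "(Y has_real_derivative Y' s) (at s)" for s
    unfolding Y_def[abs_def]
    by (rule DERIV_cong[OF DERIV_mult[OF tc rt]]) (simp add: Y'_def algebra_simps)
  \<comment> \<open>The second derivative only has to exist: its value cancels when the curvature is
    expressed by \<open>rho\<close>.\<close>
  have "\<exists>d. (Y' has_real_derivative d) (at s)" for s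
  proof -
    have nz: "2 * sqrt (poly G (t s)) \<noteq> 0" using Gt[of s] by simp
    show ?thesis
      unfolding Y'_def[abs_def]
      using DERIV_add[OF DERIV_mult[OF DERIV_cmult[OF DERIV_sin, where c = "- te"] rt]
          DERIV_mult[OF tc DERIV_divide[OF DERIV_mult[OF Gd tc] DERIV_cmult[OF rt] nz]]]
      by blast
  qed
  then obtain Y'' where Y'_D: "\<And>s. (Y' has_real_derivative Y'' s) (at s)" by metis
  have vec: "((\<lambda>s. vector [f1 s, f2 s] :: real^2) has_vector_derivative vector [d1, d2]) (at s)"
    if "(f1 has_real_derivative d1) (at s)" "(f2 has_real_derivative d2) (at s)" for f1 f2 d1 d2 s
  proof -
    have eq: "(\<lambda>h. vector [d1 * h, d2 * h] :: real^2) = (\<lambda>h. h *\<^sub>R vector [d1, d2])"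
      by (simp add: fun_eq_iff vec_eq_iff forall_2)
    show ?thesis
      using has_derivative_vector_2[OF that[unfolded has_field_derivative_def]]
      unfolding has_vector_derivative_def eq .
  qed
  define c'' :: "real \<Rightarrow> real^2" where "c'' s = vector [- (X * (te * sin s)),
      - (2 * b * (te * cos s * (te * cos s) - t s * (te * sin s))) + Y'' s]" for s
  have cD: "(c has_vector_derivative c' s) (at s)" for s
    unfolding c_def[abs_def] c'_def
    by (rule vec; (rule DERIV_cong, (rule t' Y_D derivative_eq_intros refl)+)) (simp_all add: algebra_simps)
  have c'D: "(c' has_vector_derivative c'' s) (at s)" for s
    unfolding c'_def[abs_def] c''_def
    by (rule vec; (rule DERIV_cong, (rule t' Y'_D derivative_eq_intros refl)+)) (simp_all add: algebra_simps)
  have tX: "c s $ 1 / X = t s" and oX: "offset X (c s) = Y s" for s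
    using assms(1) by (simp_all add: c_def offset_def)
  have "(Y s)\<^sup>2 = g (t s)" for s
  proof -
    have "(Y s)\<^sup>2 = te\<^sup>2 * (cos s)\<^sup>2 * poly G (t s)"
      using Gt[of s] by (simp add: Y_def power_mult_distrib)
    also have "te\<^sup>2 * (cos s)\<^sup>2 = te\<^sup>2 - (t s)\<^sup>2"
      by (simp add: t_def power_mult_distrib cos_squared_eq algebra_simps)
    finally show ?thesis by (simp add: G)
  qed
  then have fr: "c s \<in> frontier (dom X)" for s
    using assms(1) by (simp add: frontier_dom rho_zero_iff tX oX)
  have nz: "c' s \<noteq> 0" for s
  proof
    assume *: "c' s = 0"
    then have "cos s = 0" using assms(1) te_pos by (simp add: c'_def vec_eq_iff forall_2)
    then have "sin s \<noteq> 0" using sin_cos_squared_add[of s] by auto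
    moreover have "te * sin s * sqrt (poly G (t s)) = 0"
      using * \<open>cos s = 0\<close> by (simp add: c'_def Y'_def vec_eq_iff forall_2)
    ultimately show False using te_pos Gt[of s] by simp
  qed
  define \<tau> where "\<tau> = p $ 1 / X"
  have \<tau>: "\<bar>\<tau>\<bar> \<le> te" "(offset X p)\<^sup>2 = g \<tau>"
    using rho_zero_le[OF assms(2)] assms(2) by (simp_all add: \<tau>_def rho_zero_iff)
  \<comment> \<open>The rescaled coordinates of \<open>p\<close> lie on the unit circle, which
    supplies the parameter \<open>s0\<close> of \<open>p\<close>.\<close>
  have "(\<tau> / te)\<^sup>2 + (offset X p / (te * sqrt (poly G \<tau>)))\<^sup>2 = 1"
  proof -
    have "(offset X p / (te * sqrt (poly G \<tau>)))\<^sup>2 = (te\<^sup>2 - \<tau>\<^sup>2) / te\<^sup>2"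
      using G_pos[OF \<tau>(1)] \<tau>(2) by (simp add: G power_divide power_mult_distrib)
    then show ?thesis using te_pos by (simp add: power_divide diff_divide_distrib)
  qed
  then obtain s0 where s0: "\<tau> / te = sin s0" "offset X p / (te * sqrt (poly G \<tau>)) = cos s0"
    using sincos_total_2pi[of "offset X p / (te * sqrt (poly G \<tau>))" "\<tau> / te"]
    by (metis add.commute)
  have ts0: "t s0 = \<tau>" using s0 te_pos by (simp add: t_def field_simps)
  have "Y s0 = offset X p"
    using s0(2) te_pos G_pos[OF \<tau>(1)] by (simp add: Y_def ts0 flip: s0(2))
  then have cs0: "c s0 = p"
    using assms(1) by (simp add: c_def ts0 vec_eq_iff forall_2 offset_def \<tau>_def)
  have shift: "((\<lambda>s. f (s0 + s)) has_vector_derivative f') (at s)"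
    if "(f has_vector_derivative f') (at (s0 + s))" for f :: "real \<Rightarrow> real^2" and f' s
  proof -
    have "((\<lambda>s. s0 + s) has_real_derivative 1) (at s)"
      by (auto intro!: derivative_eq_intros)
    then show ?thesis
      using vector_diff_chain_at[of "\<lambda>s. s0 + s" 1 s f f'] that
      by (simp add: o_def has_real_derivative_iff_has_vector_derivative)
  qed
  show ?thesis
    by (rule that[of "\<lambda>s. c (s0 + s)" "\<lambda>s. c' (s0 + s)" "\<lambda>s. c'' (s0 + s)"])
      (use cs0 fr nz shift[OF cD] shift[OF c'D] in auto)
qed

text \<open>In the Hessian form on the tangent, all terms with the factor \<open>b * t\<close>
  cancel, and the stretch contributes the common factor \<open>1 / X\<^sup>2\<close>. The numerator
  therefore does not depend on \<open>X\<close> for given \<open>t\<close> and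
  \<open>Y\<close>.\<close>

lemma curvature_dom:
  assumes "X > 0" "rho X p = 0"
  defines "Y \<equiv> offset X p" and "t \<equiv> p $ 1 / X"
  shows "boundary_curvature (dom X) p =
    (4 * Y\<^sup>2 * q2 t + 16 * b * Y ^ 3 + 2 * (q1 t)\<^sup>2) / (X\<^sup>2 * norm (grad_rho X p) ^ 3)"
proof -
  obtain c c' c'' :: "real \<Rightarrow> real^2" where c: "c 0 = p"
    "\<And>s. c s \<in> frontier (dom X) \<and> c' s \<noteq> 0 \<and>
      (c has_vector_derivative c' s) (at s) \<and> (c' has_vector_derivative c'' s) (at s)"
    using frontier_curve[OF assms(1,2)] by blast
  define \<tau> :: "real^2" where "\<tau> = vector [- (grad_rho X p $ 2), grad_rho X p $ 1]"
  have "boundary_curvature (dom X) p = \<tau> \<bullet> hess_rho X p \<tau> / norm (grad_rho X p) ^ 3"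
  proof -
    have eq: "grad (rho X) = grad_rho X" by (rule ext) (rule grad_rho_eq)
    show ?thesis
      using boundary_curvature_sublevel[OF regular_sublevel_set_dom[OF assms(1)], of "hess_rho X p" p 1 c c' c'']
        has_derivative_grad_rho c
      by (simp add: \<tau>_def eq)
  qed
  moreover have "\<tau> \<bullet> hess_rho X p \<tau> = (4 * Y\<^sup>2 * q2 t + 16 * b * Y ^ 3 + 2 * (q1 t)\<^sup>2) / X\<^sup>2"
    using assms(1)
    by (simp add: \<tau>_def grad_rho_def hess_rho_def inner_vec_def UNIV_2 flip: Y_def t_def)
      (simp add: field_simps power2_eq_square power3_eq_cube)
  ultimately show ?thesis by simp
qed

lemma norm_grad_rho:
  assumes "X > 0" "rho X p = 0"
  shows "0 < norm (grad_rho X p)" "2 * \<bar>offset X p\<bar> \<le> norm (grad_rho X p)"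
  using regular_sublevel_set.regular[OF regular_sublevel_set_dom[OF assms(1)] assms(2)]
    component_le_norm_cart[of "grad_rho X p" 2]
  by (auto simp: grad_rho_eq grad_rho_def abs_mult)

lemma curvature_upper:
  assumes "X > 0" "rho X p = 0" "offset X p \<ge> 0"
  shows "boundary_curvature (dom X) p > 0"
proof -
  define t where "t = p $ 1 / X"
  have Y2: "(offset X p)\<^sup>2 = g t" using assms by (simp add: rho_zero_iff t_def)
  then have Y: "offset X p = sqrt (g t)" using assms(3) by (metis real_sqrt_unique)
  have "0 < 4 * g t * q2 t + 2 * (q1 t)\<^sup>2 + 16 * b * (g t * sqrt (g t))"
    using upper_positive rho_zero_le[OF assms(2)] by (simp add: t_def)
  also have "\<dots> = 4 * (offset X p)\<^sup>2 * q2 t + 16 * b * (offset X p) ^ 3 + 2 * (q1 t)\<^sup>2"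
  proof -
    have "(offset X p) ^ 3 = (offset X p)\<^sup>2 * offset X p"
      by (simp add: power2_eq_square power3_eq_cube)
    also have "\<dots> = g t * offset X p" by (simp only: Y2)
    also have "\<dots> = g t * sqrt (g t)" by (simp only: Y)
    finally show ?thesis by (simp only: Y2)
  qed
  finally show ?thesis
    using norm_grad_rho[OF assms(1,2)] assms(1) by (simp add: curvature_dom[OF assms(1,2)] t_def)
qed

lemma curvature_lower:
  assumes "X > 0" "rho X p = 0" "offset X p \<le> 0"
  shows "offset X p = - sqrt (g (p $ 1 / X))"
    and "boundary_curvature (dom X) p = bending (p $ 1 / X) / (X\<^sup>2 * norm (grad_rho X p) ^ 3)"
proof -
  define t where "t = p $ 1 / X"
  have Y2: "(offset X p)\<^sup>2 = g t" using assms by (simp add: rho_zero_iff t_def)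
  then have "(- offset X p)\<^sup>2 = g t" by simp
  then have "- offset X p = sqrt (g t)" using assms(3) by (metis real_sqrt_unique neg_0_le_iff_le)
  then show Y: "offset X p = - sqrt (g (p $ 1 / X))" by (simp add: t_def)
  have "4 * (offset X p)\<^sup>2 * q2 t + 16 * b * (offset X p) ^ 3 + 2 * (q1 t)\<^sup>2 = bending t"
  proof -
    have "(offset X p) ^ 3 = (offset X p)\<^sup>2 * offset X p"
      by (simp add: power2_eq_square power3_eq_cube)
    also have "\<dots> = g t * offset X p" by (simp only: Y2)
    also have "\<dots> = g t * - sqrt (g t)" by (simp only: Y t_def)
    finally show ?thesis by (simp add: Y2 bending_def)
  qed
  then show "boundary_curvature (dom X) p = bending (p $ 1 / X) / (X\<^sup>2 * norm (grad_rho X p) ^ 3)"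
    by (simp add: curvature_dom[OF assms(1,2)] t_def)
qed

text \<open>Only the lower arc matters. With \<open>s\<close> the half-width, the numerator is at
  least \<open>- 32 * b * s ^ 3\<close> and the gradient has length at least \<open>2 * s\<close>;
  the cubes of \<open>s\<close> cancel, so the bound is uniform up to the tips.\<close>

lemma curvature_bound:
  assumes "X > 0" "rho X p = 0"
  shows "boundary_curvature (dom X) p \<ge> - (4 * b / X\<^sup>2)"
proof (cases "offset X p \<ge> 0")
  case True
  have "0 \<le> 4 * b / X\<^sup>2" using b_pos by simp
  then show ?thesis using curvature_upper[OF assms True] by linarith
next
  case False
  define t where "t = p $ 1 / X"
  define N where "N = norm (grad_rho X p)"
  define s where "s = sqrt (g t)"
  have Y: "offset X p = - s" and k: "boundary_curvature (dom X) p = bending t / (X\<^sup>2 * N ^ 3)"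
    using curvature_lower[OF assms] False by (simp_all add: t_def N_def s_def)
  have s: "0 < s" "s * s = g t"
    using False Y rho_zero_iff[of X p] assms(2) by (auto simp: t_def power2_eq_square)
  have N: "0 < N" "2 * s \<le> N"
    using norm_grad_rho[OF assms] Y s by (auto simp: N_def)
  have "(2 * s) ^ 3 \<le> N ^ 3" by (rule power_mono) (use N s in auto)
  then have "4 * b * (8 * (s * s * s)) \<le> 4 * b * N ^ 3"
    using b_pos by (intro mult_left_mono) (auto simp: power3_eq_cube)
  moreover have "bending t \<ge> - 32 * b * (g t * s)"
    using bending_lower rho_zero_le[OF assms(2)] by (simp add: t_def s_def)
  moreover have "b * (s * s * s) = b * (g t * s)" by (simp add: s)
  ultimately have "- (4 * b) * N ^ 3 \<le> bending t" by linarith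
  then have "- (4 * b) * N ^ 3 / (X\<^sup>2 * N ^ 3) \<le> bending t / (X\<^sup>2 * N ^ 3)"
    using N assms(1) by (intro divide_right_mono) auto
  then show ?thesis using N by (simp add: k)
qed

text \<open>Positivity on the upper arc, tips included, confines the zeros to the lower arc. That
  arc is a graph over \<open>t\<close>, so they correspond to the two zeros of
  \<open>bending\<close>.\<close>

lemma curvature_zero_card:
  assumes "X > 0"
  shows "card {p \<in> frontier (dom X). boundary_curvature (dom X) p = 0} = 2"
proof -
  obtain t0 where t0: "T < t0" "t0 < te" "\<And>t. \<bar>t\<bar> \<le> te \<Longrightarrow> bending t = 0 \<longleftrightarrow> \<bar>t\<bar> = t0"
    using bending_zero by blast
  define P :: "real \<Rightarrow> real^2" where "P t = vector [X * t, 1/2 - b * t\<^sup>2 - sqrt (g t)]" for t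
  have P: "P t $ 1 / X = t" "offset X (P t) = - sqrt (g t)" for t
    using assms by (simp_all add: P_def offset_def)
  have "{p \<in> frontier (dom X). boundary_curvature (dom X) p = 0} = P ` {t0, - t0}"
  proof (intro equalityI subsetI)
    fix p assume "p \<in> {p \<in> frontier (dom X). boundary_curvature (dom X) p = 0}"
    then have p: "rho X p = 0" "boundary_curvature (dom X) p = 0"
      using assms by (auto simp: frontier_dom)
    then have Y: "offset X p \<le> 0" using curvature_upper[OF assms p(1)] by force
    note low = curvature_lower[OF assms p(1) Y]
    have "bending (p $ 1 / X) = 0"
      using low(2) p(2) norm_grad_rho(1)[OF assms p(1)] assms by simp
    then have "p $ 1 / X \<in> {t0, - t0}" using t0(3) rho_zero_le[OF p(1)] by auto
    moreover have "p = P (p $ 1 / X)"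
      using assms low(1) by (simp add: P_def vec_eq_iff forall_2 offset_def)
    ultimately show "p \<in> P ` {t0, - t0}" by blast
  next
    fix p assume "p \<in> P ` {t0, - t0}"
    then obtain t where "t \<in> {t0, - t0}" "p = P t" by blast
    then have t: "\<bar>t\<bar> = t0" "p = P t" using T_pos t0 by auto
    have "0 \<le> g t" using t t0 by (simp add: g_nonneg_iff)
    then have r: "rho X p = 0" by (simp add: rho_zero_iff t P)
    have "boundary_curvature (dom X) p = 0"
      using curvature_lower(2)[OF assms r] \<open>0 \<le> g t\<close> t0(3)[of t] t t0 by (simp add: P)
    then show "p \<in> {p \<in> frontier (dom X). boundary_curvature (dom X) p = 0}"
      using assms r by (simp add: frontier_dom)
  qed
  moreover have "P t0 \<noteq> P (- t0)"
    using P(1)[of t0] P(1)[of "- t0"] t0 T_pos by auto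
  ultimately show ?thesis by simp
qed

lemma curvature_signs:
  assumes "X > 0"
  shows "\<exists>p\<in>frontier (dom X). boundary_curvature (dom X) p < 0"
    and "\<exists>p\<in>frontier (dom X). boundary_curvature (dom X) p > 0"
proof -
  have g0: "g 0 = (1/2)\<^sup>2" by (simp add: g_def q_0 power2_eq_square)
  \<comment> \<open>The two frontier points over \<open>t = 0\<close>, where the midline has height
    1/2 and the half-width is 1/2.\<close>
  have r: "rho X (vector [0, 0]) = 0" "rho X (vector [0, 1]) = 0"
    by (simp_all add: rho_zero_iff offset_def g0)
  have "boundary_curvature (dom X) (vector [0, 0]) < 0"
    using curvature_lower(2)[OF assms r(1)] norm_grad_rho(1)[OF assms r(1)] bending_inner[of 0] T_pos assms
    by (simp add: offset_def divide_less_0_iff zero_less_mult_iff)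
  then show "\<exists>p\<in>frontier (dom X). boundary_curvature (dom X) p < 0"
    using r assms frontier_dom by blast
  have "boundary_curvature (dom X) (vector [0, 1]) > 0"
    using curvature_upper[OF assms r(2)] by (simp add: offset_def)
  then show "\<exists>p\<in>frontier (dom X). boundary_curvature (dom X) p > 0"
    using r assms frontier_dom by blast
qed

text \<open>Continuity is read off the explicit formula rather than the definite description, and
  the frontier is compact. The upper bound 0 comes from a point of negative curvature.\<close>

lemma curvature_attains_min:
  assumes "X > 0"
  shows "\<exists>m \<in> boundary_curvature (dom X) ` frontier (dom X).
    (\<forall>p\<in>frontier (dom X). m \<le> boundary_curvature (dom X) p) \<and> - (4 * b / X\<^sup>2) \<le> m \<and> m \<le> 0"
proof -
  have c1: "continuous_on S (offset X)" for S
    by (intro continuous_at_imp_continuous_on ballI has_derivative_continuous[OF has_derivative_offset])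
  have c2: "continuous_on S (grad_rho X)" for S
    by (intro continuous_at_imp_continuous_on ballI has_derivative_continuous[OF has_derivative_grad_rho])
  have c3: "continuous_on S (\<lambda>p. p $ 1 / X)" for S :: "(real^2) set"
    using assms by (intro continuous_intros) auto
  have nz: "X\<^sup>2 * norm (grad_rho X p) ^ 3 \<noteq> 0" if "p \<in> frontier (dom X)" for p
    using norm_grad_rho(1)[OF assms, of p] that assms by (simp add: frontier_dom)
  have "continuous_on (frontier (dom X)) (\<lambda>p. (4 * (offset X p)\<^sup>2 * q2 (p $ 1 / X)
      + 16 * b * (offset X p) ^ 3 + 2 * (q1 (p $ 1 / X))\<^sup>2) / (X\<^sup>2 * norm (grad_rho X p) ^ 3))"
    by (intro continuous_on_divide continuous_on_add continuous_on_mult continuous_on_power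
        continuous_on_norm continuous_on_const continuous_on_poly c1 c2 c3 ballI nz)
  then have "continuous_on (frontier (dom X)) (boundary_curvature (dom X))"
    by (rule continuous_on_eq) (simp add: frontier_dom[OF assms] curvature_dom[OF assms])
  moreover have "compact (frontier (dom X))"
    using smooth_bounded_domain_dom[OF assms] by (simp add: smooth_bounded_domain_def compact_frontier_bounded)
  moreover obtain p0 where p0: "p0 \<in> frontier (dom X)" "boundary_curvature (dom X) p0 < 0"
    using curvature_signs(1)[OF assms] by blast
  ultimately obtain p where p: "p \<in> frontier (dom X)"
    "\<forall>p'\<in>frontier (dom X). boundary_curvature (dom X) p \<le> boundary_curvature (dom X) p'"
    using continuous_attains_inf[of "frontier (dom X)" "boundary_curvature (dom X)"] by blast
  have "- (4 * b / X\<^sup>2) \<le> boundary_curvature (dom X) p"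
    using curvature_bound[OF assms, of p] p(1) assms by (simp add: frontier_dom)
  then show ?thesis using p p0 by force
qed

text \<open>On a bounded set \<open>z $ 1 / X\<close> tends to 0 uniformly, so the midline
  approaches height 1/2 and the half-width approaches 1/2. The symmetric difference is then confined
  to thin boxes around the two edges of the strip.\<close>

lemma dom_converges:
  assumes "compact K"
  shows "((\<lambda>X. measure lebesgue (K \<inter> sym_diff (dom X) strip)) \<longlongrightarrow> 0) at_top"
proof (rule tendstoI)
  fix e :: real assume e: "e > 0"
  obtain R where R: "R > 0" "\<And>z. z \<in> K \<Longrightarrow> norm z \<le> R"
    using compact_imp_bounded[OF assms] by (metis bounded_pos)
  \<comment> \<open>Each of the two boxes has area \<open>4 * R * d\<close>; with this
    \<open>d\<close> their total is \<open>e / 2\<close>.\<close>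
  define d where "d = e / (16 * R)"
  have d: "d > 0" using e R by (simp add: d_def)
  have "isCont (\<lambda>t. b * t\<^sup>2) 0" "isCont (\<lambda>t. sqrt (g t)) 0"
    unfolding g_def by (intro continuous_intros)+
  then have "((\<lambda>t. b * t\<^sup>2) \<longlongrightarrow> 0) (at 0)" "((\<lambda>t. sqrt (g t)) \<longlongrightarrow> 1/2) (at 0)"
    by (simp_all add: isCont_def g_def q_0 real_sqrt_divide)
  then have "\<forall>\<^sub>F t in at 0. dist (b * t\<^sup>2) 0 < d / 2 \<and> dist (sqrt (g t)) (1/2) < d / 2"
    using d by (intro eventually_conj tendstoD) auto
  then obtain r where r: "r > 0" "\<And>t. t \<noteq> 0 \<Longrightarrow> dist t 0 < r \<Longrightarrow>
      dist (b * t\<^sup>2) 0 < d / 2 \<and> dist (sqrt (g t)) (1/2) < d / 2"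
    unfolding eventually_at by blast
  have near: "b * t\<^sup>2 < d / 2 \<and> 1/2 - d / 2 < sqrt (g t)" if "\<bar>t\<bar> < r" for t
  proof (cases "t = 0")
    case True
    then show ?thesis using d by (simp add: g_def q_0 real_sqrt_divide)
  next
    case False
    then have "\<bar>b * t\<^sup>2\<bar> < d / 2" "\<bar>sqrt (g t) - 1/2\<bar> < d / 2"
      using r(2)[of t] that by (simp_all add: dist_real_def)
    then show ?thesis by linarith
  qed
  define B1 :: "(real^2) set" where "B1 = cbox (vector [- R, - d]) (vector [R, d])"
  define B2 :: "(real^2) set" where "B2 = cbox (vector [- R, 1 - d]) (vector [R, 1 + d])"
  have B: "B1 \<in> lmeasurable" "B2 \<in> lmeasurable" by (simp_all add: B1_def B2_def)
  have ne: "B1 \<noteq> {}" "B2 \<noteq> {}"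
    unfolding B1_def B2_def interval_ne_empty_cart using R d by (auto simp: forall_2)
  have m: "measure lebesgue B1 = 4 * R * d" "measure lebesgue B2 = 4 * R * d"
    using ne unfolding B1_def B2_def
    by (simp_all add: measure_completion content_cbox_cart UNIV_2)
  have bd: "measure lebesgue (K \<inter> sym_diff (dom X) strip) \<le> 8 * R * d" if X: "X > 0" "X > R / r" for X
  proof -
    have sub: "K \<inter> sym_diff (dom X) strip \<subseteq> B1 \<union> B2"
    proof
      fix z assume z: "z \<in> K \<inter> sym_diff (dom X) strip"
      define t where "t = z $ 1 / X"
      have x: "\<bar>z $ 1\<bar> \<le> R" using z R component_le_norm_cart order_trans by blast
      then have "\<bar>t\<bar> \<le> R / X" using X by (simp add: t_def abs_divide divide_right_mono)
      also have "R / X < r" using X r by (simp add: field_simps)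
      finally have t: "b * t\<^sup>2 < d / 2" "1/2 - d / 2 < sqrt (g t)" using near by auto
      have bt: "0 \<le> b * t\<^sup>2" using b_pos by simp
      have sg: "sqrt (g t) \<le> 1/2" using g_le[of t] real_sqrt_le_mono[of "g t" "1/4"] by (simp add: real_sqrt_divide)
      have "z $ 2 \<in> {- d..d} \<union> {1 - d..1 + d}"
      proof (cases "z \<in> dom X")
        case True
        then have "(offset X z)\<^sup>2 < g t" by (simp add: dom_def rho_def t_def)
        then have "\<bar>offset X z\<bar> < sqrt (g t)" by (simp add: real_less_rsqrt)
        then have "- d \<le> z $ 2" "z $ 2 < 1" using t bt sg d by (auto simp: offset_def t_def[symmetric])
        moreover have "z $ 2 \<le> 0 \<or> z $ 2 \<ge> 1" using z True by (auto simp: strip_def)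
        ultimately show ?thesis using d by auto
      next
        case False
        then have "\<not> (offset X z)\<^sup>2 < g t" by (simp add: dom_def rho_def t_def)
        then have "sqrt (g t) \<le> \<bar>offset X z\<bar>"
          by (metis not_le real_sqrt_abs real_sqrt_le_iff)
        then have "1/2 - d / 2 < \<bar>z $ 2 - 1/2 + b * t\<^sup>2\<bar>" using t by (simp add: offset_def t_def[symmetric])
        moreover have "0 < z $ 2" "z $ 2 < 1" using z False by (auto simp: strip_def)
        ultimately show ?thesis using t bt d by (auto simp: abs_if split: if_splits)
      qed
      then show "z \<in> B1 \<union> B2" using x by (auto simp: B1_def B2_def mem_box_cart forall_2)
    qed
    have "open (dom X)" "open strip"
      using regular_sublevel_set.open_sublevel[OF regular_sublevel_set_dom[OF X(1)]]
      by (auto simp: strip_def intro!: open_Collect_conj open_Collect_less continuous_intros)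
    then have "K \<inter> sym_diff (dom X) strip \<in> sets lebesgue"
      using assms by (auto intro!: sets.Int sets.Un sets.Diff borel_open borel_closed sets_completionI_sets
          simp: compact_imp_closed)
    then have "measure lebesgue (K \<inter> sym_diff (dom X) strip) \<le> measure lebesgue (B1 \<union> B2)"
      using sub B by (intro measure_mono_fmeasurable) auto
    also have "\<dots> \<le> measure lebesgue B1 + measure lebesgue B2"
      using B by (intro measure_Un_le) auto
    finally show ?thesis by (simp add: m)
  qed
  have "8 * R * d < e" using e R by (simp add: d_def)
  then have "dist (measure lebesgue (K \<inter> sym_diff (dom X) strip)) 0 < e" if "X > 0" "X > R / r" for X
    using bd[OF that] by simp
  then show "\<forall>\<^sub>F X in at_top. dist (measure lebesgue (K \<inter> sym_diff (dom X) strip)) 0 < e"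
    using eventually_conj[OF eventually_gt_at_top[of "0::real"] eventually_gt_at_top[of "R / r"]]
    by (rule eventually_mono[rotated]) auto
qed

end

section \<open>Solutions on the stretched domains\<close>

lemma axis_nth_2: "(axis 1 1 :: real^2) $ 2 = 0"
  by (simp add: axis_def)

context bent_profile
begin

section \<open>A global barrier and a crude bound for all solutions\<close>

definition halfheight :: real where "halfheight = 1/2 + b * te\<^sup>2"

text \<open>The constant makes the barrier at least \<open>(halfheight + 1) / \<beta>\<close> on the
  domain. In the Robin condition this outweighs the normal derivative, which is at least
  \<open>- halfheight\<close>, and leaves at least 1; the Laplacian of the barrier is -1.\<close>

definition barrier_top :: "real \<Rightarrow> real" where
  "barrier_top \<beta> = halfheight\<^sup>2 / 2 + (halfheight + 1) / \<beta>"

definition barrier :: "real \<Rightarrow> real^2 \<Rightarrow> real" where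
  "barrier \<beta> z = barrier_top \<beta> - (z $ 2 - 1/2)\<^sup>2 / 2"

definition grad_barrier :: "real^2 \<Rightarrow> real^2" where
  "grad_barrier z = vector [0, - (z $ 2 - 1/2)]"

lemma has_derivative_barrier:
  "(barrier \<beta> has_derivative (\<lambda>h. grad_barrier z \<bullet> h)) (at z)"
  unfolding barrier_def[abs_def]
  by (rule has_derivative_eq_rhs, (rule bounded_linear_imp_has_derivative[OF bounded_linear_vec_nth]
      bounded_linear.has_derivative[OF bounded_linear_divide] derivative_eq_intros refl)+)
    (simp add: fun_eq_iff grad_barrier_def inner_vec_def UNIV_2 field_simps)

lemma grad_barrier_deriv:
  "((\<lambda>s. grad_barrier (z + s *\<^sub>R axis i 1) $ i) has_real_derivative (if i = 2 then -1 else 0)) (at 0)"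
proof -
  have "i = 1 \<or> i = 2" using exhaust_2 by blast
  then show ?thesis
  proof
    assume "i = 1"
    then show ?thesis by (simp add: grad_barrier_def)
  next
    assume "i = 2"
    then show ?thesis
      by (simp add: grad_barrier_def axis_def) (auto intro!: derivative_eq_intros)
  qed
qed

lemma closure_dom:
  assumes "X > 0" "z \<in> closure (dom X)"
  shows "rho X z \<le> 0"
  using assms(2) frontier_dom[OF assms(1)] unfolding closure_Un_frontier by (auto simp: dom_def)

lemma outer_normal_dom:
  assumes "X > 0" "rho X z = 0"
  shows "outer_normal (dom X) z = grad_rho X z /\<^sub>R norm (grad_rho X z)"
    and "norm (outer_normal (dom X) z) = 1"
  using regular_sublevel_set.outer_normal_sublevel[OF regular_sublevel_set_dom[OF assms(1)] assms(2)]
    norm_grad_rho(1)[OF assms]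
  by (simp_all add: grad_rho_eq)

lemma barrier_bounds:
  assumes "X > 0" "\<beta> > 0" "rho X z \<le> 0"
  shows "0 \<le> barrier \<beta> z" "barrier \<beta> z \<le> barrier_top \<beta>"
    and "rho X z = 0 \<Longrightarrow> 1 \<le> grad_barrier z \<bullet> outer_normal (dom X) z + \<beta> * barrier \<beta> z"
proof -
  have y: "\<bar>z $ 2 - 1/2\<bar> \<le> halfheight"
    using dom_bounds(3)[OF assms(1,3)] by (simp add: halfheight_def)
  then have h: "0 \<le> halfheight" by linarith
  have "(z $ 2 - 1/2)\<^sup>2 \<le> halfheight\<^sup>2" using y h abs_le_square_iff[of "z $ 2 - 1/2" halfheight] by simp
  then have low: "(halfheight + 1) / \<beta> \<le> barrier \<beta> z" by (simp add: barrier_def barrier_top_def)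
  moreover have "0 \<le> (halfheight + 1) / \<beta>" using h assms by simp
  ultimately show "0 \<le> barrier \<beta> z" by linarith
  show "barrier \<beta> z \<le> barrier_top \<beta>" by (simp add: barrier_def)
  assume z: "rho X z = 0"
  have "norm (grad_barrier z) = \<bar>z $ 2 - 1/2\<bar>"
    by (simp add: grad_barrier_def norm_vec_def L2_set_def UNIV_2)
  then have "\<bar>grad_barrier z \<bullet> outer_normal (dom X) z\<bar> \<le> halfheight"
    using Cauchy_Schwarz_ineq2[of "grad_barrier z" "outer_normal (dom X) z"] outer_normal_dom(2)[OF assms(1) z] y
    by simp
  moreover have "halfheight + 1 \<le> \<beta> * barrier \<beta> z"
    using low assms(2) by (simp add: field_simps)
  ultimately show "1 \<le> grad_barrier z \<bullet> outer_normal (dom X) z + \<beta> * barrier \<beta> z" by linarith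
qed

lemma continuous_barrier: "continuous_on S (barrier \<beta>)"
  by (intro continuous_at_imp_continuous_on ballI has_derivative_continuous[OF has_derivative_barrier])

text \<open>Comparison with \<open>v = 0\<close> on the whole plane. The factor 2 makes the interior
  inequality strict: 1 < 2.\<close>

lemma solution_bound:
  assumes X: "X > 0" and \<beta>: "\<beta> > 0" and sol: "robin_torsion_solution \<beta> (dom X) u"
    and z: "z \<in> closure (dom X)"
  shows "\<bar>u z\<bar> \<le> 2 * barrier_top \<beta>"
proof -
  have "\<bar>u z - 0\<bar> \<le> 2 * barrier \<beta> z"
  proof (rule robin_comparison[OF smooth_bounded_domain_dom[OF X] sol \<beta> open_UNIV, where
        v = "\<lambda>_. 0" and gv = "\<lambda>_. 0" and hv = "\<lambda>_ _. 0" and \<psi> = "\<lambda>z. 2 * barrier \<beta> z"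
        and g\<psi> = "\<lambda>z. 2 *\<^sub>R grad_barrier z" and h\<psi> = "\<lambda>z i. 2 * (if i = 2 then -1 else 0)"])
    show "((\<lambda>z. 2 * barrier \<beta> z) has_derivative (\<lambda>h. 2 *\<^sub>R grad_barrier z \<bullet> h)) (at z)" for z
      using has_derivative_mult_right[OF has_derivative_barrier, of 2 \<beta> z] by simp
    show "((\<lambda>s. (2 *\<^sub>R grad_barrier (z + s *\<^sub>R axis i 1)) $ i) has_real_derivative
        2 * (if i = 2 then -1 else 0)) (at 0)" for z i
      using DERIV_cmult[OF grad_barrier_deriv[of z i], of 2] by simp
    show "\<bar>1 + (\<Sum>i\<in>(UNIV::2 set). 0)\<bar> < (- (\<Sum>i\<in>(UNIV::2 set). 2 * (if i = 2 then - 1 else 0)) :: real)"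
      by (simp add: UNIV_2)
    show "\<bar>0 \<bullet> outer_normal (dom X) z + \<beta> * 0\<bar> <
        2 *\<^sub>R grad_barrier z \<bullet> outer_normal (dom X) z + \<beta> * (2 * barrier \<beta> z)"
      if "z \<in> frontier (dom X) \<inter> UNIV" for z
      using barrier_bounds(3)[OF X \<beta>, of z] that X by (simp add: frontier_dom algebra_simps)
    show "continuous_on (closure (dom X)) (\<lambda>z. 2 * barrier \<beta> z)"
      by (intro continuous_intros continuous_barrier)
  qed (use z in auto)
  then show ?thesis using barrier_bounds(2)[OF X \<beta> closure_dom[OF X z]] by simp
qed

section \<open>Approximation by the profile of the local width\<close>

definition approx :: "real \<Rightarrow> real \<Rightarrow> real^2 \<Rightarrow> real" where
  "approx \<beta> X z = (g (z $ 1 / X) - (offset X z)\<^sup>2) / 2 + sqrt (g (z $ 1 / X)) / \<beta>"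

definition grad_approx :: "real \<Rightarrow> real \<Rightarrow> real^2 \<Rightarrow> real^2" where
  "grad_approx \<beta> X z = (let t = z $ 1 / X in
    vector [(- q1 t / 2 - 2 * b * t * offset X z - q1 t / sqrt (g t) / (2 * \<beta>)) / X, - offset X z])"

text \<open>Only the second derivative along the strip. The one across it is exactly -1, so this is
  the whole defect of \<open>approx\<close> in the equation.\<close>

definition hess_approx :: "real \<Rightarrow> real \<Rightarrow> real^2 \<Rightarrow> real" where
  "hess_approx \<beta> X z = (let t = z $ 1 / X in
    (- q2 t / 2 - 2 * b * (offset X z + 2 * b * t\<^sup>2)
      - (q2 t / sqrt (g t) + (q1 t)\<^sup>2 / (2 * (g t * sqrt (g t)))) / (2 * \<beta>)) / X\<^sup>2)"

lemma has_derivative_chain_scaled: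
  fixes f :: "real \<Rightarrow> real"
  assumes "(f has_real_derivative d) (at (z $ 1 / X))"
  shows "((\<lambda>z::real^2. f (z $ 1 / X)) has_derivative (\<lambda>h. h $ 1 / X * d)) (at z)"
  by (rule DERIV_compose_FDERIV[OF assms has_derivative_nth_scaled])

lemma has_derivative_approx:
  assumes "X > 0" "\<beta> > 0" "0 < g (z $ 1 / X)"
  shows "(approx \<beta> X has_derivative (\<lambda>h. grad_approx \<beta> X z \<bullet> h)) (at z)"
proof -
  have gd: "((\<lambda>z::real^2. g (z $ 1 / X)) has_derivative (\<lambda>h. h $ 1 / X * - q1 (z $ 1 / X))) (at z)"
    by (rule has_derivative_chain_scaled[OF DERIV_g])
  have "((\<lambda>t. sqrt (g t)) has_real_derivative inverse (sqrt (g (z $ 1 / X))) / 2 * - q1 (z $ 1 / X)) (at (z $ 1 / X))"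
    using DERIV_real_sqrt[OF assms(3)] DERIV_g by (rule DERIV_chain2)
  then have sd: "((\<lambda>z::real^2. sqrt (g (z $ 1 / X))) has_derivative
      (\<lambda>h. h $ 1 / X * (inverse (sqrt (g (z $ 1 / X))) / 2 * - q1 (z $ 1 / X)))) (at z)"
    by (rule has_derivative_chain_scaled)
  note div = bounded_linear.has_derivative[OF bounded_linear_divide]
  have ring: "(a / X * - q - (Y * (c + 2 * b * t * (a / X)) + (c + 2 * b * t * (a / X)) * Y)) / 2
      + a / X * (inverse s / 2 * - q) / \<beta>
      = (- q / 2 - 2 * b * t * Y - q / s / (2 * \<beta>)) / X * a + - Y * c"
    if "s \<noteq> 0" for a c q s t Y :: real
    using that assms(1,2) by (simp add: field_simps)
  show ?thesis
    unfolding approx_def[abs_def] power2_eq_square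
    by (rule has_derivative_eq_rhs[OF has_derivative_add[OF div[OF has_derivative_diff[OF gd
            has_derivative_mult[OF has_derivative_offset has_derivative_offset]]] div[OF sd]]])
      (rule ext, rule trans[OF ring], use assms in
        \<open>simp_all add: grad_approx_def Let_def inner_vec_def UNIV_2\<close>)
qed

lemma grad_approx_deriv:
  assumes "X > 0" "\<beta> > 0" "0 < g (z $ 1 / X)"
  shows "((\<lambda>s. grad_approx \<beta> X (z + s *\<^sub>R axis i 1) $ i) has_real_derivative
    (if i = 2 then -1 else hess_approx \<beta> X z)) (at 0)"
proof -
  define t where "t = z $ 1 / X"
  have "i = 1 \<or> i = 2" using exhaust_2 by blast
  then show ?thesis
  proof
    assume i: "i = 1"
    have gt: "0 < g t" using assms by (simp add: t_def)
    have s: "((\<lambda>t. sqrt (g t)) has_real_derivative inverse (sqrt (g t)) / 2 * - q1 t) (at t)"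
      using DERIV_real_sqrt[OF gt] DERIV_g by (rule DERIV_chain2)
    have "((\<lambda>t. q1 t / sqrt (g t)) has_real_derivative
        (q2 t * sqrt (g t) - q1 t * (inverse (sqrt (g t)) / 2 * - q1 t)) / (sqrt (g t) * sqrt (g t))) (at t)"
      using gt by (intro DERIV_divide s poly_DERIV) auto
    moreover have "(q2 t * sqrt (g t) - q1 t * (inverse (sqrt (g t)) / 2 * - q1 t)) / (sqrt (g t) * sqrt (g t))
        = q2 t / sqrt (g t) + (q1 t)\<^sup>2 / (2 * (g t * sqrt (g t)))"
      using gt by (simp add: field_simps power2_eq_square)
    ultimately have "((\<lambda>t. q1 t / sqrt (g t)) has_real_derivative
        q2 t / sqrt (g t) + (q1 t)\<^sup>2 / (2 * (g t * sqrt (g t)))) (at (z $ 1 / X))" by (simp add: t_def)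
    from has_derivative_chain_scaled[OF this]
    have quot: "((\<lambda>z::real^2. q1 (z $ 1 / X) / sqrt (g (z $ 1 / X))) has_derivative
        (\<lambda>h. h $ 1 / X * (q2 t / sqrt (g t) + (q1 t)\<^sup>2 / (2 * (g t * sqrt (g t)))))) (at z)" .
    note div = bounded_linear.has_derivative[OF bounded_linear_divide]
    note mult = has_derivative_mult_right
    have bt: "((\<lambda>z::real^2. 2 * b * (z $ 1 / X)) has_derivative (\<lambda>h. 2 * b * (h $ 1 / X))) (at z)"
      by (rule mult[OF has_derivative_nth_scaled])
    have D: "((\<lambda>z. grad_approx \<beta> X z $ 1) has_derivative (\<lambda>h. (- (h $ 1 / X * q2 t) / 2
        - (2 * b * t * (h $ 2 + 2 * b * t * (h $ 1 / X)) + 2 * b * (h $ 1 / X) * offset X z)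
        - h $ 1 / X * (q2 t / sqrt (g t) + (q1 t)\<^sup>2 / (2 * (g t * sqrt (g t)))) / (2 * \<beta>)) / X)) (at z)"
      unfolding grad_approx_def Let_def vector_2 t_def
      by (rule div has_derivative_diff has_derivative_minus has_derivative_poly_scaled
          has_derivative_mult[OF bt has_derivative_offset] quot[unfolded t_def])+
    have ring: "(- (1 / X * c) / 2 - (2 * b * t * (0 + 2 * b * t * (1 / X)) + 2 * b * (1 / X) * Y)
        - 1 / X * k / (2 * \<beta>)) / X = (- c / 2 - 2 * b * (Y + 2 * b * t\<^sup>2) - k / (2 * \<beta>)) / X\<^sup>2"
      for c Y k
      using assms(1) by (simp add: field_simps power2_eq_square)
    have "((\<lambda>s. grad_approx \<beta> X (z + s *\<^sub>R axis 1 1) $ 1) has_real_derivative hess_approx \<beta> X z) (at 0)"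
      by (rule DERIV_cong[OF has_derivative_along_line[OF D, of "axis 1 1"]])
        (simp only: hess_approx_def Let_def t_def[symmetric] ring axis_nth axis_nth_2)
    then show ?thesis using i by simp
  next
    assume i: "i = 2"
    have "((\<lambda>z. grad_approx \<beta> X z $ 2) has_derivative
        (\<lambda>h. - (h $ 2 + 2 * b * (z $ 1 / X) * (h $ 1 / X)))) (at z)"
      unfolding grad_approx_def Let_def vector_2 by (intro has_derivative_minus has_derivative_offset)
    from has_derivative_along_line[OF this, of "axis 2 1"] show ?thesis
      using i by (simp add: axis_def)
  qed
qed

lemma approx_range:
  assumes "\<beta> > 0" "rho X z \<le> 0"
  shows "0 \<le> approx \<beta> X z" "approx \<beta> X z \<le> g (z $ 1 / X) / 2 + sqrt (g (z $ 1 / X)) / \<beta>"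
    "approx \<beta> X z \<le> 1/8 + 1 / (2 * \<beta>)"
proof -
  define t where "t = z $ 1 / X"
  have le: "(offset X z)\<^sup>2 \<le> g t" using assms by (simp add: rho_def t_def)
  have g: "0 \<le> g t" using le by (meson order_trans zero_le_power2)
  have sg: "sqrt (g t) \<le> 1/2" using g_le[of t] real_sqrt_le_mono[of "g t" "1/4"] by (simp add: real_sqrt_divide)
  show "0 \<le> approx \<beta> X z" using le g assms by (simp add: approx_def t_def)
  show up: "approx \<beta> X z \<le> g (z $ 1 / X) / 2 + sqrt (g (z $ 1 / X)) / \<beta>"
    by (simp add: approx_def)
  have "sqrt (g t) / \<beta> \<le> (1/2) / \<beta>" using sg assms by (intro divide_right_mono) auto
  then show "approx \<beta> X z \<le> 1/8 + 1 / (2 * \<beta>)" using up g_le[of t] by (simp add: t_def)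
qed

lemma continuous_approx: "X > 0 \<Longrightarrow> \<beta> > 0 \<Longrightarrow> continuous_on S (approx \<beta> X)"
  unfolding approx_def offset_def g_def by (intro continuous_intros) auto

lemma derivative_bound:
  obtains Q where "0 < Q" "\<And>t. \<bar>t\<bar> \<le> T \<Longrightarrow> \<bar>q1 t\<bar> \<le> Q \<and> \<bar>q2 t\<bar> \<le> Q"
proof -
  have "compact (poly p ` {-T..T})" for p :: "real poly"
    by (intro compact_continuous_image continuous_intros compact_Icc)
  then have "\<exists>B>0. \<forall>t\<in>{-T..T}. \<bar>poly p t\<bar> \<le> B" for p :: "real poly"
    using compact_imp_bounded bounded_pos by (metis (no_types, lifting) imageI real_norm_def)
  then obtain B1 B2 where "B1 > 0" "\<forall>t\<in>{-T..T}. \<bar>q1 t\<bar> \<le> B1" "B2 > 0" "\<forall>t\<in>{-T..T}. \<bar>q2 t\<bar> \<le> B2"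
    by metis
  then show ?thesis by (intro that[of "max B1 B2"]) (auto simp: abs_le_iff le_max_iff_disj)
qed

text \<open>On the core the half-width is bounded below, so all coefficients are bounded and each
  derivative along the strip costs a factor \<open>1 / X\<close>. On the boundary
  \<open>\<beta> * approx\<close> is the local half-width, which cancels the cross derivative up to
  the tilt of the normal.\<close>

lemma approx_errors:
  assumes "\<beta> > 0"
  obtains C where "0 < C"
    "\<And>X z. X > 0 \<Longrightarrow> rho X z \<le> 0 \<Longrightarrow> \<bar>z $ 1 / X\<bar> \<le> T \<Longrightarrow> \<bar>hess_approx \<beta> X z\<bar> \<le> C / X\<^sup>2"
    "\<And>X z. X > 0 \<Longrightarrow> rho X z = 0 \<Longrightarrow> \<bar>z $ 1 / X\<bar> \<le> T \<Longrightarrow>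
      \<bar>grad_approx \<beta> X z \<bullet> outer_normal (dom X) z + \<beta> * approx \<beta> X z\<bar> \<le> C / X"
proof -
  obtain Q where Q: "0 < Q" "\<And>t. \<bar>t\<bar> \<le> T \<Longrightarrow> \<bar>q1 t\<bar> \<le> Q \<and> \<bar>q2 t\<bar> \<le> Q"
    using derivative_bound by blast
  \<comment> \<open>Over the appropriate power of \<open>X\<close>, these bound the first component
    of \<open>grad_approx\<close>, the first component of \<open>grad_rho\<close>, and
    \<open>hess_approx\<close>, in this order.\<close>
  define C1 where "C1 = Q / 2 + b * T + 3 * Q / (2 * \<beta>)"
  define C2 where "C2 = Q + 2 * b * T"
  define C3 where "C3 = Q / 2 + 2 * b * (1/2 + 2 * b * T\<^sup>2) + (3 * Q + 12 * Q\<^sup>2) / (2 * \<beta>)"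
  have C0: "0 < C1" "0 < C2" "0 < C3"
    using Q b_pos T_pos assms by (auto simp: C1_def C2_def C3_def intro!: add_pos_nonneg)
  have common: "\<bar>offset X z\<bar> \<le> 1/2" "1/3 \<le> sqrt (g t)" "1/24 \<le> g t * sqrt (g t)" "\<bar>q1 t\<bar> \<le> Q" "\<bar>q2 t\<bar> \<le> Q"
    "\<bar>q1 t / sqrt (g t)\<bar> \<le> 3 * Q" "\<bar>q2 t / sqrt (g t)\<bar> \<le> 3 * Q"
    if "X > 0" "rho X z \<le> 0" "\<bar>t\<bar> \<le> T" for X z t
  proof -
    show "\<bar>offset X z\<bar> \<le> 1/2" using dom_bounds(2)[OF that(1,2)] .
    have g: "1/8 \<le> g t" using g_inner[OF that(3)] .
    show s: "1/3 \<le> sqrt (g t)" using g by (intro real_le_rsqrt) (simp add: power2_eq_square)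
    have "1/8 * (1/3) \<le> g t * sqrt (g t)" using g s by (intro mult_mono) auto
    then show "1/24 \<le> g t * sqrt (g t)" by simp
    show q: "\<bar>q1 t\<bar> \<le> Q" "\<bar>q2 t\<bar> \<le> Q" using Q that by auto
    have "\<bar>a / sqrt (g t)\<bar> \<le> 3 * Q" if "\<bar>a\<bar> \<le> Q" for a
    proof -
      have "\<bar>a\<bar> / sqrt (g t) \<le> Q / (1/3)" by (rule frac_le) (use that s Q in auto)
      then show ?thesis using s by (simp add: abs_divide)
    qed
    then show "\<bar>q1 t / sqrt (g t)\<bar> \<le> 3 * Q" "\<bar>q2 t / sqrt (g t)\<bar> \<le> 3 * Q" using q by auto
  qed
  show ?thesis
  proof (rule that[of "C1 + C2 + C3"])
    show "0 < C1 + C2 + C3" using C0 by simp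
  next
    fix X z assume X: "X > 0" and r: "rho X z \<le> 0" and t: "\<bar>z $ 1 / X\<bar> \<le> T"
    define t where "t = z $ 1 / X"
    note c = common[OF X r t, folded t_def]
    have t2: "0 \<le> t\<^sup>2" "t\<^sup>2 \<le> T\<^sup>2" using t abs_le_square_iff[of t T] T_pos by (simp_all add: t_def)
    then have "0 \<le> b * t\<^sup>2" "b * t\<^sup>2 \<le> b * T\<^sup>2" using b_pos by auto
    then have "\<bar>offset X z + 2 * (b * t\<^sup>2)\<bar> \<le> 1/2 + 2 * (b * T\<^sup>2)" using c(1) by linarith
    then have "2 * b * \<bar>offset X z + 2 * (b * t\<^sup>2)\<bar> \<le> 2 * b * (1/2 + 2 * (b * T\<^sup>2))"
      using b_pos by (intro mult_left_mono) auto
    then have e1: "\<bar>2 * b * (offset X z + 2 * b * t\<^sup>2)\<bar> \<le> 2 * b * (1/2 + 2 * b * T\<^sup>2)"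
      using b_pos by (simp add: abs_mult mult.assoc)
    have "(q1 t)\<^sup>2 \<le> Q\<^sup>2" using c(4) Q abs_le_square_iff[of "q1 t" Q] by simp
    then have "(q1 t)\<^sup>2 / (2 * (g t * sqrt (g t))) \<le> Q\<^sup>2 / (2 * (1/24))"
      by (intro frac_le) (use c(3) in auto)
    then have "(q1 t)\<^sup>2 / (2 * (g t * sqrt (g t))) \<le> 12 * Q\<^sup>2" by simp
    moreover have "0 \<le> (q1 t)\<^sup>2 / (2 * (g t * sqrt (g t)))" using c(3) by simp
    ultimately have "\<bar>q2 t / sqrt (g t) + (q1 t)\<^sup>2 / (2 * (g t * sqrt (g t)))\<bar> \<le> 3 * Q + 12 * Q\<^sup>2"
      using c(7) by linarith
    then have "\<bar>(q2 t / sqrt (g t) + (q1 t)\<^sup>2 / (2 * (g t * sqrt (g t)))) / (2 * \<beta>)\<bar> \<le> (3 * Q + 12 * Q\<^sup>2) / (2 * \<beta>)"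
      using assms by (simp add: abs_divide divide_right_mono)
    then have "\<bar>- q2 t / 2 - 2 * b * (offset X z + 2 * b * t\<^sup>2)
        - (q2 t / sqrt (g t) + (q1 t)\<^sup>2 / (2 * (g t * sqrt (g t)))) / (2 * \<beta>)\<bar> \<le> C3"
      using e1 c(5) unfolding C3_def by linarith
    then have "\<bar>hess_approx \<beta> X z\<bar> \<le> C3 / X\<^sup>2"
      using X by (simp add: hess_approx_def Let_def flip: t_def) (simp add: abs_divide divide_right_mono)
    also have "\<dots> \<le> (C1 + C2 + C3) / X\<^sup>2" using C0 X by (intro divide_right_mono) auto
    finally show "\<bar>hess_approx \<beta> X z\<bar> \<le> (C1 + C2 + C3) / X\<^sup>2" .
  next
    fix X z assume X: "X > 0" and r: "rho X z = 0" and t: "\<bar>z $ 1 / X\<bar> \<le> T"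
    have r': "rho X z \<le> 0" using r by simp
    define t where "t = z $ 1 / X"
    define Y where "Y = offset X z"
    note c = common[OF X r' t, folded t_def Y_def]
    define N where "N = norm (grad_rho X z)"
    define p where "p = grad_rho X z $ 1"
    define a where "a = grad_approx \<beta> X z $ 1"
    have N: "0 < N" "2 * \<bar>Y\<bar> \<le> N" using norm_grad_rho[OF X r] by (simp_all add: N_def Y_def)
    have Np: "N \<le> \<bar>p\<bar> + 2 * \<bar>Y\<bar>"
      using norm_le_l1_cart[of "grad_rho X z"] by (simp add: UNIV_2 N_def p_def Y_def grad_rho_def abs_mult)
    have pN: "\<bar>p\<bar> \<le> N" using component_le_norm_cart by (auto simp: N_def p_def)
    have Y2: "Y * Y = g t" using r by (simp add: rho_zero_iff Y_def t_def power2_eq_square)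
    have v: "\<beta> * approx \<beta> X z = \<bar>Y\<bar>"
      using r assms real_sqrt_abs[of Y] by (simp add: approx_def rho_zero_iff Y_def)
    have "outer_normal (dom X) z $ 1 = p / N" "outer_normal (dom X) z $ 2 = 2 * Y / N"
      using outer_normal_dom(1)[OF X r]
      by (simp_all add: N_def p_def Y_def grad_rho_def divide_inverse_commute)
    then have dot: "grad_approx \<beta> X z \<bullet> outer_normal (dom X) z = a * (p / N) - Y * (2 * Y / N)"
      by (simp add: inner_vec_def UNIV_2 a_def) (simp add: grad_approx_def Let_def Y_def)
    \<comment> \<open>The defect left by the tilt. Since \<open>N\<close> is the length of the
      vector with components \<open>p\<close> and \<open>2 * Y\<close>, the factor
      \<open>N - 2 * \<bar>Y\<bar>\<close> is at most \<open>\<bar>p\<bar>\<close>, which is of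
      order \<open>1 / X\<close>.\<close>
    have "\<bar>Y\<bar> - Y * (2 * Y / N) = \<bar>Y\<bar> / N * (N - 2 * \<bar>Y\<bar>)"
    proof -
      have "y - 2 * (y * y) / N = y / N * (N - 2 * y)" for y
        using N(1) by (simp add: field_simps)
      moreover have "Y * (2 * Y / N) = 2 * (\<bar>Y\<bar> * \<bar>Y\<bar>) / N" by simp
      ultimately show ?thesis by metis
    qed
    moreover have "0 \<le> \<bar>Y\<bar> / N * (N - 2 * \<bar>Y\<bar>)" using N by simp
    moreover have "\<bar>Y\<bar> / N * (N - 2 * \<bar>Y\<bar>) \<le> 1 * \<bar>p\<bar>"
      using N Np by (intro mult_mono) auto
    ultimately have e1: "\<bar>\<bar>Y\<bar> - Y * (2 * Y / N)\<bar> \<le> \<bar>p\<bar>" by linarith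
    have "\<bar>p / N\<bar> \<le> 1" using pN N by (simp add: abs_divide)
    then have e2: "\<bar>a * (p / N)\<bar> \<le> \<bar>a\<bar>" by (metis abs_ge_zero abs_mult mult.right_neutral mult_left_mono)
    have tY: "\<bar>b * t * Y\<bar> \<le> b * T * (1/2)"
      unfolding abs_mult using b_pos t c(1) T_pos by (intro mult_mono) (auto simp: t_def)
    have "\<bar>q1 t / sqrt (g t) / (2 * \<beta>)\<bar> \<le> 3 * Q / (2 * \<beta>)"
      by (rule ord_eq_le_trans[OF abs_div_pos[symmetric] divide_right_mono[OF c(6)]]) (use assms in auto)
    then have "\<bar>- q1 t / 2 - 2 * (b * t * Y) - q1 t / sqrt (g t) / (2 * \<beta>)\<bar> \<le> C1"
      using c(4) tY unfolding C1_def by linarith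
    then have a: "\<bar>a\<bar> \<le> C1 / X"
      using X by (simp add: a_def grad_approx_def Let_def flip: t_def Y_def)
        (simp add: abs_divide divide_right_mono mult.assoc)
    have "\<bar>q1 t + 4 * (b * t * Y)\<bar> \<le> C2" using c(4) tY unfolding C2_def by linarith
    then have p: "\<bar>p\<bar> \<le> C2 / X"
      using X by (simp add: p_def grad_rho_def flip: t_def Y_def)
        (simp add: abs_divide divide_right_mono mult.assoc)
    have "\<bar>grad_approx \<beta> X z \<bullet> outer_normal (dom X) z + \<beta> * approx \<beta> X z\<bar> \<le> C1 / X + C2 / X"
      unfolding dot v using e1 e2 a p by linarith
    also have "\<dots> \<le> (C1 + C2 + C3) / X" using C0 X by (simp add: add_divide_distrib)
    finally show "\<bar>grad_approx \<beta> X z \<bullet> outer_normal (dom X) z + \<beta> * approx \<beta> X z\<bar> \<le> (C1 + C2 + C3) / X" .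
  qed
qed

text \<open>The margin 1 in \<open>\<bar>z $ 1 / X\<bar> + 1 \<le> T\<close> keeps a unit window
  around the cross-section of \<open>z\<close> inside the core. The comparison is localised to that
  window, separately for each \<open>z\<close>, with \<open>X0\<close> independent of
  \<open>z\<close> and \<open>u\<close>.\<close>

lemma solution_approx:
  assumes \<beta>: "\<beta> > 0" and e: "e > 0"
  obtains X0 where "X0 > 0" "\<And>X u z. X \<ge> X0 \<Longrightarrow> robin_torsion_solution \<beta> (dom X) u \<Longrightarrow>
    z \<in> closure (dom X) \<Longrightarrow> \<bar>z $ 1 / X\<bar> + 1 \<le> T \<Longrightarrow> \<bar>u z - approx \<beta> X z\<bar> \<le> e * barrier_top \<beta>"
proof -
  obtain C where C: "0 < C"
    "\<And>X z. X > 0 \<Longrightarrow> rho X z \<le> 0 \<Longrightarrow> \<bar>z $ 1 / X\<bar> \<le> T \<Longrightarrow> \<bar>hess_approx \<beta> X z\<bar> \<le> C / X\<^sup>2"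
    "\<And>X z. X > 0 \<Longrightarrow> rho X z = 0 \<Longrightarrow> \<bar>z $ 1 / X\<bar> \<le> T \<Longrightarrow>
      \<bar>grad_approx \<beta> X z \<bullet> outer_normal (dom X) z + \<beta> * approx \<beta> X z\<bar> \<le> C / X"
    using approx_errors[OF \<beta>] by blast
  have bt: "0 < barrier_top \<beta>"
    using \<beta> b_pos by (simp add: barrier_top_def halfheight_def add_nonneg_pos add_pos_nonneg)
  \<comment> \<open>Bounds the modulus of \<open>u\<close> plus that of \<open>approx\<close>, hence
    their difference, on the whole closure.\<close>
  define M where "M = 2 * barrier_top \<beta> + (1/8 + 1 / (2 * \<beta>))"
  have M: "0 < M" using bt \<beta> by (simp add: M_def add_pos_pos)
  \<comment> \<open>Makes \<open>(C + 2 * M) / X < e\<close>: \<open>C\<close> accounts for the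
    defects of \<open>approx\<close> and \<open>2 * M\<close> for the derivatives of the penalty.
    \<open>X0 \<ge> 1\<close> gives the same with the square of \<open>X\<close>.\<close>
  define X0 where "X0 = max 1 ((C + 2 * M) / e + 1)"
  have X0: "X0 \<ge> 1" "X0 > (C + 2 * M) / e" by (simp_all add: X0_def)
  show ?thesis
  proof (rule that[of X0])
    show "X0 > 0" using X0 by simp
  next
    fix X u z
    assume XX: "X \<ge> X0" and sol: "robin_torsion_solution \<beta> (dom X) u"
      and z: "z \<in> closure (dom X)" and zT: "\<bar>z $ 1 / X\<bar> + 1 \<le> T"
    have X: "X \<ge> 1" "X > 0" using XX X0 by auto
    have "(C + 2 * M) / e < X" using XX X0 by linarith
    then have small: "(C + 2 * M) / X < e" using e X by (simp add: field_simps)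
    have "X \<le> X\<^sup>2" using X by (simp add: power2_eq_square)
    then have small2: "(C + 2 * M) / X\<^sup>2 < e"
      using small C M X by (intro le_less_trans[OF divide_left_mono[of X "X\<^sup>2" "C + 2 * M"] small]) auto
    define \<tau> where "\<tau> = z $ 1 / X"
    define N where "N = {y::real^2. \<bar>y $ 1 / X - \<tau>\<bar> < 1}"
    have "open N" unfolding N_def by (intro open_Collect_less continuous_intros) (use X in auto)
    have inT: "\<bar>y $ 1 / X\<bar> \<le> T" if "y \<in> N" for y
      using that zT by (auto simp: N_def \<tau>_def abs_if split: if_splits)
    have gpos: "0 < g (y $ 1 / X)" if "y \<in> N" for y
      using g_inner[OF inT[OF that]] by simp
    \<comment> \<open>The quadratic penalty is at least \<open>M\<close> outside the window and
      vanishes at \<open>z\<close> itself. Its small derivatives inside are absorbed by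
      \<open>e * barrier\<close>, whose Laplacian is \<open>- e\<close> and whose Robin expression
      is at least \<open>e\<close>.\<close>
    define \<psi> where "\<psi> y = M * (y $ 1 / X - \<tau>)\<^sup>2 + e * barrier \<beta> y" for y :: "real^2"
    define g\<psi> :: "real^2 \<Rightarrow> real^2" where
      "g\<psi> y = vector [2 * M * (y $ 1 / X - \<tau>) / X, 0] + e *\<^sub>R grad_barrier y" for y
    define h\<psi> :: "2 \<Rightarrow> real" where "h\<psi> i = (if i = 2 then - e else 2 * M / X\<^sup>2)" for i
    have "\<bar>u z - approx \<beta> X z\<bar> \<le> \<psi> z"
    proof (rule robin_comparison[OF smooth_bounded_domain_dom[OF X(2)] sol \<beta> \<open>open N\<close>, where
          v = "approx \<beta> X" and gv = "grad_approx \<beta> X" and \<psi> = \<psi> and g\<psi> = g\<psi>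
          and hv = "\<lambda>y i. if i = 2 then -1 else hess_approx \<beta> X y" and h\<psi> = "\<lambda>_. h\<psi>"])
      show "continuous_on (closure (dom X)) (approx \<beta> X)"
        by (rule continuous_approx[OF X(2) \<beta>])
      show "continuous_on (closure (dom X)) \<psi>"
        unfolding \<psi>_def by (intro continuous_intros continuous_barrier) (use X in auto)
      show "(approx \<beta> X has_derivative (\<lambda>h. grad_approx \<beta> X y \<bullet> h)) (at y)"
        if "y \<in> closure (dom X) \<inter> N" for y
        by (rule has_derivative_approx) (use X \<beta> gpos that in auto)
      show "((\<lambda>s. grad_approx \<beta> X (y + s *\<^sub>R axis i 1) $ i) has_real_derivative
          (if i = 2 then -1 else hess_approx \<beta> X y)) (at 0)" if "y \<in> dom X \<inter> N" for y i
        by (rule grad_approx_deriv) (use X \<beta> gpos that in auto)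
      show "(\<psi> has_derivative (\<lambda>h. g\<psi> y \<bullet> h)) (at y)" for y
      proof -
        have "((\<lambda>t. M * (t - \<tau>)\<^sup>2) has_real_derivative 2 * M * (y $ 1 / X - \<tau>)) (at (y $ 1 / X))"
          by (auto intro!: derivative_eq_intros)
        from has_derivative_add[OF has_derivative_chain_scaled[OF this]
            has_derivative_mult_right[OF has_derivative_barrier[of \<beta> y], of e]]
        show ?thesis unfolding \<psi>_def
          by (rule has_derivative_eq_rhs)
            (use X in \<open>simp add: fun_eq_iff g\<psi>_def inner_vec_def UNIV_2 field_simps\<close>)
      qed
      show "((\<lambda>s. g\<psi> (y + s *\<^sub>R axis i 1) $ i) has_real_derivative h\<psi> i) (at 0)" for y i
      proof -
        have "i = 1 \<or> i = 2" using exhaust_2 by blast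
        then show ?thesis
        proof
          assume i: "i = 1"
          have "((\<lambda>s. 2 * M * ((y $ 1 + s) / X - \<tau>) / X) has_real_derivative 2 * M / X\<^sup>2) (at 0)"
            using X by (auto intro!: derivative_eq_intros simp: power2_eq_square)
          then show ?thesis using i by (simp add: g\<psi>_def h\<psi>_def grad_barrier_def axis_def)
        next
          assume "i = 2"
          then show ?thesis
            using DERIV_cmult[OF grad_barrier_deriv[of y 2], of e] by (simp add: g\<psi>_def h\<psi>_def)
        qed
      qed
      show "\<bar>1 + (\<Sum>i\<in>UNIV. (if i = (2::2) then -1 else hess_approx \<beta> X y))\<bar> < - (\<Sum>i\<in>UNIV. h\<psi> i)"
        if "y \<in> dom X \<inter> N" for y
      proof -
        have "\<bar>hess_approx \<beta> X y\<bar> \<le> C / X\<^sup>2"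
          using that inT X by (intro C(2)) (auto simp: dom_def)
        then show ?thesis using small2 by (simp add: UNIV_2 h\<psi>_def add_divide_distrib)
      qed
      show "\<bar>grad_approx \<beta> X y \<bullet> outer_normal (dom X) y + \<beta> * approx \<beta> X y\<bar>
          < g\<psi> y \<bullet> outer_normal (dom X) y + \<beta> * \<psi> y" if y: "y \<in> frontier (dom X) \<inter> N" for y
      proof -
        have r: "rho X y = 0" using y X by (simp add: frontier_dom)
        let ?n = "outer_normal (dom X) y"
        have "\<bar>grad_approx \<beta> X y \<bullet> ?n + \<beta> * approx \<beta> X y\<bar> \<le> C / X"
          using y inT X r by (intro C(3)) auto
        moreover have "e * 1 \<le> e * (grad_barrier y \<bullet> ?n + \<beta> * barrier \<beta> y)"
          using barrier_bounds(3)[OF X(2) \<beta>, of y] r e by (intro mult_left_mono) auto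
        moreover have "\<bar>2 * M * (y $ 1 / X - \<tau>) / X * ?n $ 1\<bar> \<le> 2 * M / X"
        proof -
          have "\<bar>2 * M * (y $ 1 / X - \<tau>)\<bar> \<le> 2 * M * 1"
            unfolding abs_mult using y M by (intro mult_mono) (auto simp: N_def)
          then have "\<bar>2 * M * (y $ 1 / X - \<tau>) / X\<bar> \<le> 2 * M / X"
            using X by (simp add: abs_divide divide_right_mono)
          moreover have "\<bar>?n $ 1\<bar> \<le> 1"
            using component_le_norm_cart[of ?n 1] outer_normal_dom(2)[OF X(2) r] by simp
          ultimately have "\<bar>2 * M * (y $ 1 / X - \<tau>) / X\<bar> * \<bar>?n $ 1\<bar> \<le> 2 * M / X * 1"
            using M X by (intro mult_mono) auto
          then show ?thesis by (simp only: abs_mult[symmetric] mult_1_right)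
        qed
        moreover have "0 \<le> \<beta> * (M * (y $ 1 / X - \<tau>)\<^sup>2)" using \<beta> M by simp
        moreover have "g\<psi> y \<bullet> ?n + \<beta> * \<psi> y = 2 * M * (y $ 1 / X - \<tau>) / X * ?n $ 1
            + \<beta> * (M * (y $ 1 / X - \<tau>)\<^sup>2) + e * (grad_barrier y \<bullet> ?n + \<beta> * barrier \<beta> y)"
        proof -
          have "vector [p, 0] \<bullet> ?n = p * ?n $ 1" for p
            by (simp add: inner_vec_def UNIV_2)
          then show ?thesis
            by (simp only: g\<psi>_def \<psi>_def inner_add_left inner_scaleR_left) (simp add: algebra_simps)
        qed
        moreover have "C / X + 2 * M / X < e" using small by (simp add: add_divide_distrib)
        ultimately show ?thesis by linarith
      qed
      show "\<bar>u y - approx \<beta> X y\<bar> \<le> \<psi> y" if y: "y \<in> closure (dom X) - N" for y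
      proof -
        have r: "rho X y \<le> 0" using closure_dom[OF X(2)] y by auto
        have "1 \<le> \<bar>y $ 1 / X - \<tau>\<bar>" using y by (auto simp: N_def)
        then have "1 \<le> (y $ 1 / X - \<tau>)\<^sup>2" using abs_le_square_iff[of 1 "y $ 1 / X - \<tau>"] by simp
        then have "M * 1 \<le> M * (y $ 1 / X - \<tau>)\<^sup>2" using M by (intro mult_left_mono) auto
        moreover have "0 \<le> e * barrier \<beta> y" using barrier_bounds(1)[OF X(2) \<beta> r] e by simp
        moreover have "\<bar>u y - approx \<beta> X y\<bar> \<le> M"
          using solution_bound[OF X(2) \<beta> sol, of y] y approx_range(1,3)[OF \<beta> r]
          unfolding M_def by auto
        ultimately show ?thesis unfolding \<psi>_def by linarith
      qed
    qed (use z in auto)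
    moreover have "\<psi> z = e * barrier \<beta> z" by (simp add: \<psi>_def \<tau>_def)
    moreover have "e * barrier \<beta> z \<le> e * barrier_top \<beta>"
      using barrier_bounds(2)[OF X(2) \<beta> closure_dom[OF X(2) z]] e by (intro mult_left_mono) auto
    ultimately show "\<bar>u z - approx \<beta> X z\<bar> \<le> e * barrier_top \<beta>" by linarith
  qed
qed

text \<open>For each \<open>j\<close>, maximise \<open>u\<close> over the closed slab of half-width
  1/2 around \<open>t = j\<close>. The profile is larger by at least \<open>d\<close> at its centre
  than on the sides of the slab and on the frontier, and \<open>u\<close> differs from it by at most
  \<open>d / 3\<close>, so the maximum point is interior. The open slabs are disjoint, so these
  points are distinct.\<close>

lemma many_local_maxima:
  assumes \<beta>: "\<beta> > 0" and kT: "real k + 1 \<le> T"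
    and top: "\<And>j. j < k \<Longrightarrow> poly q (real j) = 0"
    and valley: "\<And>j. j < k \<Longrightarrow> 0 < poly q (real j - 1/2) \<and> 0 < poly q (real j + 1/2)"
  shows "\<exists>X0>0. \<forall>X\<ge>X0. \<forall>u. robin_torsion_solution \<beta> (dom X) u \<longrightarrow>
    (\<exists>A. A \<subseteq> local_max_points (dom X) u \<and> finite A \<and> card A = k)"
proof -
  define \<mu> where "\<mu> t = g t / 2 + sqrt (g t) / \<beta>" for t
  define m where "m = 1/8 + 1 / (2 * \<beta>)"
  define gap where "gap j = min (m - \<mu> (real j - 1/2)) (m - \<mu> (real j + 1/2))" for j
  \<comment> \<open>The extra 1/8 is the drop of the profile from the centre to the frontier, where
    at most \<open>1 / (2 * \<beta>)\<close> is left of \<open>m\<close>; it also keeps the set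
    nonempty for \<open>k = 0\<close>.\<close>
  define d where "d = Min (insert (1/8) (gap ` {..<k}))"
  have \<mu>_less: "\<mu> t < m" if "0 < poly q t" for t
  proof -
    have "g t < (1/2)\<^sup>2" using that by (simp add: g_def power2_eq_square)
    then have "sqrt (g t) < sqrt ((1/2)\<^sup>2)" by (rule real_sqrt_less_mono)
    then have "sqrt (g t) < 1/2" by simp
    then have "sqrt (g t) / \<beta> < (1/2) / \<beta>" using \<beta> by (rule divide_strict_right_mono)
    then show ?thesis using \<open>g t < (1/2)\<^sup>2\<close> by (simp add: \<mu>_def m_def power2_eq_square)
  qed
  have "0 < gap j" if "j < k" for j using valley[OF that] \<mu>_less by (simp add: gap_def)
  then have d: "0 < d" "d \<le> 1/8"
    unfolding d_def by (subst Min_gr_iff; force) (intro Min_le; simp)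
  have d_gap: "d \<le> gap j" if "j < k" for j using that by (auto simp: d_def intro: Min_le)
  have bt: "0 < barrier_top \<beta>"
    using \<beta> b_pos by (simp add: barrier_top_def halfheight_def add_nonneg_pos add_pos_nonneg)
  define e where "e = d / (3 * barrier_top \<beta>)"
  have e: "e > 0" "e * barrier_top \<beta> = d / 3" using d bt by (simp_all add: e_def)
  obtain X0 where X0: "X0 > 0" "\<And>X u z. X \<ge> X0 \<Longrightarrow> robin_torsion_solution \<beta> (dom X) u \<Longrightarrow>
    z \<in> closure (dom X) \<Longrightarrow> \<bar>z $ 1 / X\<bar> + 1 \<le> T \<Longrightarrow> \<bar>u z - approx \<beta> X z\<bar> \<le> d / 3"
    using solution_approx[OF \<beta> e(1)] unfolding e(2) by blast
  show ?thesis
  proof (intro exI[of _ X0] conjI allI impI X0(1))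
    fix X u assume XX: "X \<ge> X0" and sol: "robin_torsion_solution \<beta> (dom X) u"
    have X: "X > 0" using X0 XX by simp
    have op: "open (dom X)"
      by (rule regular_sublevel_set.open_sublevel[OF regular_sublevel_set_dom[OF X]])
    have "\<exists>p. p \<in> local_max_points (dom X) u \<and> \<bar>p $ 1 / X - real j\<bar> < 1/2" if j: "j < k" for j
    proof -
      define S where "S = closure (dom X) \<inter> {z. \<bar>z $ 1 / X - real j\<bar> \<le> 1/2}"
      have S_T: "\<bar>z $ 1 / X\<bar> + 1 \<le> T" if "z \<in> S" for z
      proof -
        have "\<bar>z $ 1 / X - real j\<bar> \<le> 1/2" using that by (simp add: S_def)
        moreover have "real j + 1 \<le> real k" using j by simp
        ultimately show ?thesis using kT by linarith
      qed
      have near: "\<bar>u z - approx \<beta> X z\<bar> \<le> d / 3" if "z \<in> S" for z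
        using X0(2)[OF XX sol _ S_T[OF that]] that by (simp add: S_def)
      define c :: "real^2" where "c = vector [X * real j, 1/2 - b * (real j)\<^sup>2]"
      have c: "c $ 1 / X = real j" "offset X c = 0" using X by (simp_all add: c_def offset_def)
      have gj: "g (real j) = (1/2)\<^sup>2" using top[OF j] by (simp add: g_def power2_eq_square)
      have cS: "c \<in> S"
        using c gj closure_subset[of "dom X"] by (auto simp: S_def dom_def rho_def)
      have "approx \<beta> X c = m" by (simp add: approx_def c gj m_def power2_eq_square real_sqrt_divide)
      then have uc: "u c \<ge> m - d / 3" using near[OF cS] by linarith
      have "bounded (dom X)"
        using smooth_bounded_domain_dom[OF X] by (simp add: smooth_bounded_domain_def)
      then have "compact (closure (dom X))" by simp
      moreover have "closed {z::real^2. \<bar>z $ 1 / X - real j\<bar> \<le> 1/2}"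
        by (intro closed_Collect_le continuous_intros) (use X in auto)
      ultimately have cpt: "compact S" unfolding S_def by (rule compact_Int_closed)
      obtain G where "\<And>x. x \<in> closure (dom X) \<Longrightarrow>
          (u has_derivative (\<lambda>h. G x \<bullet> h)) (at x within closure (dom X))"
        using sol by (auto simp: robin_torsion_solution_def)
      then have "continuous_on (closure (dom X)) u"
        using has_derivative_continuous continuous_on_eq_continuous_within by metis
      then have "continuous_on S u" by (rule continuous_on_subset) (simp add: S_def)
      then obtain p where p: "p \<in> S" "\<And>z. z \<in> S \<Longrightarrow> u z \<le> u p"
        using continuous_attains_sup[OF cpt] cS by (metis empty_iff)
      have r: "rho X p \<le> 0" using p(1) closure_dom[OF X] by (simp add: S_def)
      \<comment> \<open>Two errors of \<open>d / 3\<close> are lost, one at the centre and one at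
        \<open>p\<close>; a drop of \<open>d\<close> exceeds their sum.\<close>
      have up: "m - d / 3 \<le> approx \<beta> X p + d / 3" using p(2)[OF cS] near[OF p(1)] uc by linarith
      have inner: "\<bar>p $ 1 / X - real j\<bar> < 1/2"
      proof (rule ccontr)
        assume "\<not> \<bar>p $ 1 / X - real j\<bar> < 1/2"
        then have "\<bar>p $ 1 / X - real j\<bar> = 1/2" using p(1) by (simp add: S_def)
        then have "p $ 1 / X = real j - 1/2 \<or> p $ 1 / X = real j + 1/2" by linarith
        then have "\<mu> (p $ 1 / X) \<le> m - d" using d_gap[OF j] by (auto simp: gap_def)
        then show False using approx_range(2)[OF \<beta> r] up d by (simp add: \<mu>_def)
      qed
      have "rho X p \<noteq> 0"
      proof
        assume "rho X p = 0"
        then have "approx \<beta> X p = sqrt (g (p $ 1 / X)) / \<beta>" by (simp add: approx_def rho_zero_iff)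
        moreover have "sqrt (g (p $ 1 / X)) \<le> 1/2"
          using g_le[of "p $ 1 / X"] real_sqrt_le_mono[of "g (p $ 1 / X)" "1/4"] by (simp add: real_sqrt_divide)
        then have "sqrt (g (p $ 1 / X)) / \<beta> \<le> (1/2) / \<beta>" using \<beta> by (intro divide_right_mono) auto
        moreover have "(1/2) / \<beta> = 1 / (2 * \<beta>)" by simp
        ultimately show False using up d unfolding m_def by linarith
      qed
      then have pd: "p \<in> dom X" using r by (simp add: dom_def)
      define V where "V = dom X \<inter> {z. \<bar>z $ 1 / X - real j\<bar> < 1/2}"
      have "open V" unfolding V_def
        by (intro open_Int op open_Collect_less continuous_intros) (use X in auto)
      moreover have "p \<in> V" using pd inner by (simp add: V_def)
      ultimately obtain r where r: "r > 0" "ball p r \<subseteq> V" using open_contains_ball by blast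
      have "V \<subseteq> S" using closure_subset by (auto simp: V_def S_def)
      then have "\<forall>y\<in>dom X \<inter> ball p r. u y \<le> u p" using r p(2) by blast
      then show ?thesis using pd r inner by (auto simp: local_max_points_def)
    qed
    then obtain P where P: "\<And>j. j < k \<Longrightarrow> P j \<in> local_max_points (dom X) u"
      "\<And>j. j < k \<Longrightarrow> \<bar>P j $ 1 / X - real j\<bar> < 1/2"
      by metis
    have "inj_on P {..<k}"
    proof (rule inj_onI)
      fix i j assume "i \<in> {..<k}" "j \<in> {..<k}" "P i = P j"
      then have "\<bar>P i $ 1 / X - real i\<bar> < 1/2" "\<bar>P i $ 1 / X - real j\<bar> < 1/2"
        using P(2)[of i] P(2)[of j] by simp_all
      then show "i = j" by linarith
    qed
    then have "card (P ` {..<k}) = k" by (simp add: card_image)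
    then show "\<exists>A. A \<subseteq> local_max_points (dom X) u \<and> finite A \<and> card A = k"
      using P(1) by (intro exI[of _ "P ` {..<k}"]) auto
  qed
qed

end

section \<open>Existence of a profile with prescribed bumps\<close>

lemma poly_eventually_pos:
  fixes p :: "real poly"
  assumes "lead_coeff p > 0"
  obtains N where "\<And>x. x \<ge> N \<Longrightarrow> poly p x > 0"
  using poly_pinfty_gt_lc[OF assms] assms by (meson less_le_trans)

lemma lead_coeff_pderiv_pos:
  fixes p :: "real poly"
  assumes "lead_coeff p > 0" "0 < degree p"
  shows "lead_coeff (pderiv p) > 0" "degree (pderiv p) = degree p - 1"
proof -
  show d: "degree (pderiv p) = degree p - 1" by (rule degree_pderiv)
  show "lead_coeff (pderiv p) > 0"
    unfolding d using assms by (simp add: coeff_pderiv)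
qed

text \<open>Powers of \<open>t\<close> squared give evenness and the outer squares nonnegativity.
  The factor for \<open>j = 0\<close> is always present, which gives the zero at 0 and a degree of
  at least 4, so the first three derivatives have positive leading coefficients.\<close>

definition bump_poly :: "nat \<Rightarrow> real poly" where
  "bump_poly k = (\<Prod>j\<le>k. [:- (real j)\<^sup>2, 0, 1:] ^ 2)"

lemma poly_bump_poly: "poly (bump_poly k) t = (\<Prod>j\<le>k. (t\<^sup>2 - (real j)\<^sup>2)\<^sup>2)"
  by (simp add: bump_poly_def poly_prod power2_eq_square[of t])

lemma lead_coeff_bump_poly: "lead_coeff (bump_poly k) = 1"
  by (simp add: bump_poly_def lead_coeff_prod lead_coeff_power)

lemma degree_bump_poly: "degree (bump_poly k) = 4 * (k + 1)"
  by (simp add: bump_poly_def degree_prod_eq_sum_degree degree_power_eq)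

lemma poly_bump_poly_zero: "j \<le> k \<Longrightarrow> poly (bump_poly k) (real j) = 0"
  by (auto simp: poly_bump_poly prod_zero_iff)

lemma poly_bump_poly_half: "poly (bump_poly k) (real j + 1/2) > 0" "poly (bump_poly k) (real j - 1/2) > 0"
proof -
  have ne: "(real j + 1/2)\<^sup>2 \<noteq> (real i)\<^sup>2" "(real j - 1/2)\<^sup>2 \<noteq> (real i)\<^sup>2" for i
  proof -
    have half: "real_of_int n + 1/2 \<noteq> 0" for n
    proof
      assume "real_of_int n + 1/2 = 0"
      then have "real_of_int (2 * n + 1) = 0" by simp
      then have "2 * n + 1 = 0" by (simp only: of_int_eq_0_iff)
      then show False by presburger
    qed
    have "real j + 1/2 \<noteq> real i" "real j + 1/2 \<noteq> - real i" "real j - 1/2 \<noteq> real i" "real j - 1/2 \<noteq> - real i"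
      using half[of "int j - int i"] half[of "int j + int i"] half[of "int j - int i - 1"]
        half[of "int j + int i - 1"] by auto
    then show "(real j + 1/2)\<^sup>2 \<noteq> (real i)\<^sup>2" "(real j - 1/2)\<^sup>2 \<noteq> (real i)\<^sup>2"
      by (auto simp: power2_eq_iff)
  qed
  show "poly (bump_poly k) (real j + 1/2) > 0" "poly (bump_poly k) (real j - 1/2) > 0"
    using ne by (auto simp: poly_bump_poly intro!: prod_pos)
qed

text \<open>The thresholds \<open>T\<close> and \<open>T1\<close> depend only on the unscaled
  polynomial \<open>p\<close> and on \<open>C\<close>. The scale \<eta> is chosen last, and the tip
  \<open>te\<close> is then found by the intermediate value theorem, since \<open>q\<close> is at
  most 1/8 at \<open>T\<close> and eventually exceeds 1/4.\<close>

lemma exists_bent_profile: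
  obtains q b T te where "bent_profile q b T te" "real k + 1 \<le> T"
    "\<And>j. j < k \<Longrightarrow> poly q (real j) = 0"
    "\<And>j. j < k \<Longrightarrow> 0 < poly q (real j - 1/2) \<and> 0 < poly q (real j + 1/2)"
proof -
  define p where "p = bump_poly k"
  define p1 where "p1 = pderiv p"
  define p2 where "p2 = pderiv p1"
  define p3 where "p3 = pderiv p2"
  have dp: "degree p = 4 * (k + 1)" and lp: "lead_coeff p > 0"
    using lead_coeff_bump_poly[of k] by (simp_all add: p_def degree_bump_poly)
  have d1: "lead_coeff p1 > 0" "degree p1 = 4 * k + 3"
    using lead_coeff_pderiv_pos[OF lp] dp by (simp_all add: p1_def)
  have d2: "lead_coeff p2 > 0" "degree p2 = 4 * k + 2"
    using lead_coeff_pderiv_pos[OF d1(1)] d1 by (simp_all add: p2_def)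
  have d3: "lead_coeff p3 > 0"
    using lead_coeff_pderiv_pos[OF d2(1)] d2 by (simp_all add: p3_def)
  obtain N1 N2 N3 where N: "\<And>x. x \<ge> N1 \<Longrightarrow> poly p1 x > 0" "\<And>x. x \<ge> N2 \<Longrightarrow> poly p2 x > 0"
      "\<And>x. x \<ge> N3 \<Longrightarrow> poly p3 x > 0"
    using poly_eventually_pos[OF d1(1)] poly_eventually_pos[OF d2(1)] poly_eventually_pos[OF d3] by metis
  define T where "T = Max {real k + 1, N1, N2, N3}"
  have T: "real k + 1 \<le> T" "N1 \<le> T" "N2 \<le> T" "N3 \<le> T" by (simp_all add: T_def)
  have T0: "T > 0" using T(1) by linarith
  have bdd: "\<exists>B>0. \<forall>t. \<bar>t\<bar> \<le> S \<longrightarrow> \<bar>poly r t\<bar> \<le> B" for r :: "real poly" and S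
  proof -
    have "compact (poly r ` {-S..S})"
      by (intro compact_continuous_image continuous_intros compact_Icc)
    then obtain B where "B > 0" "\<forall>x\<in>poly r ` {-S..S}. norm x \<le> B"
      using compact_imp_bounded bounded_pos by metis
    then show ?thesis by (intro exI[of _ B]) (auto simp: abs_le_iff)
  qed
  obtain P1 P2 where P: "P1 > 0" "P2 > 0" "\<And>t. \<bar>t\<bar> \<le> T \<Longrightarrow> \<bar>poly p1 t\<bar> \<le> P1"
    "\<And>t. \<bar>t\<bar> \<le> T \<Longrightarrow> \<bar>poly p2 t\<bar> \<le> P2"
    using bdd by metis
  \<comment> \<open>On the core the cube of the half-width is at least 1/24, so the bend term is at
    least \<open>2/3 * C * \<eta>\<close>. This must exceed
    \<open>\<eta> * (P2 + 2 * P1\<^sup>2)\<close>, which holds because \<open>C\<close> exceeds 3/2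
    of the bracket.\<close>
  define C where "C = 2 * (P2 + 2 * P1\<^sup>2) + 1"
  have C: "C > 0" using P by (simp add: C_def add_pos_nonneg)
  have "lead_coeff (p1 - [:0, C:]) > 0"
  proof -
    have lt: "degree [:0, C:] < degree p1" using d1 by simp
    then have "degree (p1 - [:0, C:]) = degree p1"
      by (metis degree_add_eq_left degree_minus diff_conv_add_uminus)
    moreover have "coeff [:0, C:] (degree p1) = 0" using lt by (rule coeff_eq_0)
    ultimately show ?thesis using d1(1) by simp
  qed
  then obtain N4 where N4: "\<And>x. x \<ge> N4 \<Longrightarrow> poly (p1 - [:0, C:]) x > 0"
    using poly_eventually_pos by blast
  \<comment> \<open>Beyond \<open>T1\<close> the polynomial \<open>p1\<close>, of degree at least 3,
    dominates \<open>C * t\<close>; after scaling, the slope of \<open>q\<close> there pays for the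
    bend.\<close>
  define T1 where "T1 = max T N4"
  have T1: "T \<le> T1" "\<And>t. t \<ge> T1 \<Longrightarrow> C * t \<le> poly p1 t"
    using N4 by (force simp: T1_def algebra_simps)+
  obtain A where A: "A > 0" "\<And>t. \<bar>t\<bar> \<le> T1 \<Longrightarrow> \<bar>poly p t\<bar> \<le> A"
    using bdd by metis
  obtain A' where A': "A' > 0" "\<And>t. \<bar>t\<bar> \<le> T1 \<Longrightarrow> \<bar>poly ([:0, 1:] * p1) t\<bar> \<le> A'"
    using bdd by metis
  \<comment> \<open>With \<eta> the reciprocal of \<open>D\<close>, the sizes up to
    \<open>T1\<close> of \<open>q\<close>, of \<open>t * q'\<close> and of
    \<open>b * t\<^sup>2\<close> are all at most 1/8; the summand 1 ensures that \<eta> is at most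
    1.\<close>
  define D where "D = 1 + 8 * A + 8 * A' + 8 * (C * T1\<^sup>2)"
  have D: "D \<ge> 1" "8 * A \<le> D" "8 * A' \<le> D" "8 * (C * T1\<^sup>2) \<le> D"
    using A A' C by (simp_all add: D_def)
  define \<eta> where "\<eta> = 1 / D"
  have \<eta>: "\<eta> > 0" "\<eta> \<le> 1" using D by (simp_all add: \<eta>_def)
  have small: "\<eta> * a \<le> 1/8" if "8 * a \<le> D" for a
    using that D by (simp add: \<eta>_def field_simps)
  define q where "q = smult \<eta> p"
  define b where "b = C * \<eta>"
  have q: "poly q t = \<eta> * poly p t" "poly (pderiv q) t = \<eta> * poly p1 t"
    "poly (pderiv (pderiv q)) t = \<eta> * poly p2 t" "poly (pderiv (pderiv (pderiv q))) t = \<eta> * poly p3 t" for t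
    by (simp_all add: q_def p1_def p2_def p3_def pderiv_smult)
  have q_small: "poly q t \<le> 1/8" if "\<bar>t\<bar> \<le> T1" for t
  proof -
    have "\<eta> * poly p t \<le> \<eta> * A" using A(2)[OF that] \<eta> by (intro mult_left_mono) auto
    then show ?thesis using small[OF D(2)] by (simp add: q)
  qed
  have p_nonneg: "0 \<le> poly p t" for t by (simp add: p_def poly_bump_poly prod_nonneg)
  have "\<exists>te>T. poly q te = 1/4"
  proof -
    have "lead_coeff (p - [:1 / (4 * \<eta>):]) > 0"
    proof -
      have "degree [:1 / (4 * \<eta>):] < degree p" using dp by simp
      then have "degree (p - [:1 / (4 * \<eta>):]) = degree p"
        by (metis degree_add_eq_left degree_minus diff_conv_add_uminus)
      then show ?thesis using lp dp by (simp add: coeff_eq_0)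
    qed
    then obtain N5 where N5: "\<And>x. x \<ge> N5 \<Longrightarrow> poly (p - [:1 / (4 * \<eta>):]) x > 0"
      using poly_eventually_pos by blast
    define S where "S = max T N5"
    have "1 / (4 * \<eta>) < poly p S" using N5[of S] by (simp add: S_def)
    then have "1/4 \<le> poly q S" using \<eta> by (simp add: q field_simps)
    moreover have "poly q T \<le> 1/4" using q_small[of T] T0 T1(1) by simp
    moreover have "continuous_on {T..S} (poly q)" by (intro continuous_intros)
    ultimately obtain te where "T \<le> te" "poly q te = 1/4"
      using IVT'[of "poly q" T "1/4" S] by (auto simp: S_def)
    then show ?thesis using q_small[of T] T0 T1(1) by (intro exI[of _ te]) (auto simp: le_less)
  qed
  then obtain te where te: "T < te" "poly q te = 1/4" by blast
  have "bent_profile q b T te"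
  proof
    show "poly q (- t) = poly q t" for t by (simp add: q p_def poly_bump_poly)
    show "poly q 0 = 0" using poly_bump_poly_zero[of 0 k] by (simp add: q p_def)
    show "0 \<le> poly q t" for t using p_nonneg \<eta> by (simp add: q)
    show "0 < T" "T < te" "poly q te = 1/4" "0 < b" using T0 te C \<eta> by (simp_all add: b_def)
    show "poly q t \<le> 1/8" if "\<bar>t\<bar> \<le> T" for t using q_small that T1 by simp
    show "0 < poly (pderiv q) t" "0 < poly (pderiv (pderiv q)) t" "0 < poly (pderiv (pderiv (pderiv q))) t"
      if "T \<le> t" for t
      using N T that \<eta> by (simp_all add: q)
    show "\<bar>4 * (1/4 - poly q t) * poly (pderiv (pderiv q)) t + 2 * (poly (pderiv q) t)\<^sup>2\<bar>
        < 16 * b * ((1/4 - poly q t) * sqrt (1/4 - poly q t))" if t: "\<bar>t\<bar> \<le> T" for t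
    proof -
      define g where "g = 1/4 - poly q t"
      have g: "1/8 \<le> g" "g \<le> 1/4" using q_small[of t] t T1 p_nonneg \<eta> by (simp_all add: g_def q)
      have "1/3 \<le> sqrt g" using g by (intro real_le_rsqrt) (simp add: power2_eq_square)
      then have "1/8 * (1/3) \<le> g * sqrt g" using g by (intro mult_mono) auto
      then have "16 * b * (1/8 * (1/3)) \<le> 16 * b * (g * sqrt g)"
        using C \<eta> by (intro mult_left_mono) (auto simp: b_def)
      moreover have "\<eta> * (P2 + 2 * P1\<^sup>2) < 16 * b * (1/8 * (1/3))"
      proof -
        have "P2 + 2 * P1\<^sup>2 < 2/3 * C" using P by (simp add: C_def add_pos_nonneg)
        then have "\<eta> * (P2 + 2 * P1\<^sup>2) < \<eta> * (2/3 * C)" using \<eta> by (intro mult_strict_left_mono)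
        then show ?thesis by (simp add: b_def algebra_simps)
      qed
      moreover have "\<bar>4 * g * poly (pderiv (pderiv q)) t + 2 * (poly (pderiv q) t)\<^sup>2\<bar> \<le> \<eta> * (P2 + 2 * P1\<^sup>2)"
      proof -
        have "(4 * g) * \<bar>poly p2 t\<bar> \<le> 1 * P2" using g P(4)[OF t] by (intro mult_mono) auto
        then have "\<eta> * ((4 * g) * \<bar>poly p2 t\<bar>) \<le> \<eta> * (1 * P2)" using \<eta> by (intro mult_left_mono) auto
        then have 1: "\<bar>4 * g * poly (pderiv (pderiv q)) t\<bar> \<le> \<eta> * P2"
          using \<eta> g by (simp add: q abs_mult algebra_simps)
        have "(poly p1 t)\<^sup>2 \<le> P1\<^sup>2" using P(3)[OF t] P(1) abs_le_square_iff[of "poly p1 t" P1] by simp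
        \<comment> \<open>The squared derivative carries two factors \<eta>; as \<eta> is at most 1,
          one of them is given up to match the linear scaling of the bend.\<close>
        then have "\<eta> * (poly p1 t)\<^sup>2 \<le> 1 * P1\<^sup>2" using \<eta> by (intro mult_mono) auto
        then have "\<eta> * (\<eta> * (poly p1 t)\<^sup>2) \<le> \<eta> * (1 * P1\<^sup>2)" using \<eta> by (intro mult_left_mono) auto
        then have 2: "(poly (pderiv q) t)\<^sup>2 \<le> \<eta> * P1\<^sup>2"
          by (simp add: q power2_eq_square algebra_simps)
        have 3: "0 \<le> (poly (pderiv q) t)\<^sup>2" by simp
        have 4: "\<eta> * (P2 + 2 * P1\<^sup>2) = \<eta> * P2 + 2 * (\<eta> * P1\<^sup>2)" by (simp add: algebra_simps)
        show ?thesis using 1 2 3 unfolding 4 by linarith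
      qed
      ultimately show ?thesis unfolding g_def by linarith
    qed
    show "b * t\<^sup>2 * sqrt (1/4 - poly q t) \<le> 1/4 - poly q t + t * poly (pderiv q) t / 2"
      if t: "0 < t" "t < te" for t
    proof -
      define g where "g = 1/4 - poly q t"
      have g4: "g \<le> 1/4" using p_nonneg \<eta> by (simp add: g_def q)
      have sg: "sqrt g \<le> 1/2" using g4 real_sqrt_le_mono[of g "1/4"] by (simp add: real_sqrt_divide)
      have bt: "0 \<le> b * t\<^sup>2" using C \<eta> by (simp add: b_def)
      have step: "b * t\<^sup>2 * sqrt g \<le> b * t\<^sup>2 * (1/2)" using sg bt by (rule mult_left_mono)
      have "b * t\<^sup>2 * (1/2) \<le> g + t * poly (pderiv q) t / 2"
      \<comment> \<open>Up to \<open>T1\<close> the left side is at most 1/16, while the right side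
        is at least 1/8 minus 1/16. Beyond it, \<open>g\<close> is still nonnegative before the tip
        and the slope of \<open>q\<close> suffices.\<close>
      proof (cases "t \<le> T1")
        case True
        then have tT: "\<bar>t\<bar> \<le> T1" using t by simp
        have "1/8 \<le> g" using q_small[OF tT] by (simp add: g_def)
        moreover have "\<bar>t * poly (pderiv q) t\<bar> \<le> 1/8"
        proof -
          have "\<eta> * \<bar>t * poly p1 t\<bar> \<le> \<eta> * A'"
            using A'(2)[OF tT] \<eta> by (intro mult_left_mono) auto
          moreover have "\<bar>t * poly (pderiv q) t\<bar> = \<eta> * \<bar>t * poly p1 t\<bar>"
            using \<eta> by (simp add: q abs_mult)
          ultimately show ?thesis using small[OF D(3)] by linarith
        qed
        moreover have "b * t\<^sup>2 \<le> 1/8"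
        proof -
          have "t\<^sup>2 \<le> T1\<^sup>2" using True t by (intro power_mono) auto
          then have "\<eta> * (C * t\<^sup>2) \<le> \<eta> * (C * T1\<^sup>2)" using C \<eta> by (intro mult_left_mono) auto
          then show ?thesis using small[OF D(4)] by (simp add: b_def algebra_simps)
        qed
        ultimately show ?thesis by linarith
      next
        case False
        have "poly q t \<le> 1/4"
        proof (cases "t = te")
          case False
          have "poly q t < poly q te"
          proof (rule DERIV_pos_imp_increasing[OF t(2)])
            fix x assume "t \<le> x" "x \<le> te"
            then show "\<exists>y. (poly q has_real_derivative y) (at x) \<and> 0 < y"
              using N(1)[of x] T(2) T1(1) \<open>\<not> t \<le> T1\<close> \<eta> poly_DERIV[of q x]
              by (intro exI[of _ "poly (pderiv q) x"]) (simp add: q(2))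
          qed
          then show ?thesis using te by simp
        qed (use te in simp)
        then have "0 \<le> g" by (simp add: g_def)
        have "\<eta> * t * (C * t) \<le> \<eta> * t * poly p1 t"
          using T1(2)[of t] False t \<eta> by (intro mult_left_mono) auto
        then have "b * t\<^sup>2 \<le> t * poly (pderiv q) t"
          by (simp add: b_def q power2_eq_square algebra_simps)
        then show ?thesis using \<open>0 \<le> g\<close> by simp
      qed
      with step show ?thesis unfolding g_def by linarith
    qed
  qed
  then show ?thesis
  proof (rule that[OF _ T(1)])
    show "poly q (real j) = 0" if "j < k" for j
      using poly_bump_poly_zero[of j k] that by (simp add: q p_def)
    show "0 < poly q (real j - 1/2) \<and> 0 < poly q (real j + 1/2)" if "j < k" for j
      using poly_bump_poly_half[where k = k and j = j] \<eta> by (simp add: q p_def)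
  qed
qed

section \<open>The family of domains and the limit of infinite stretch\<close>

theorem mainTheorem3:
  fixes \<beta> :: real and k :: nat
  assumes "\<beta> > 0"
  shows "\<exists>\<Omega> :: real \<Rightarrow> (real^2) set.
    (\<forall>\<epsilon>>0.
       smooth_bounded_domain (\<Omega> \<epsilon>) \<and>
       starlike (\<Omega> \<epsilon>) \<and>
       (\<forall>u. robin_torsion_solution \<beta> (\<Omega> \<epsilon>) u \<longrightarrow>
          (\<exists>A. A \<subseteq> local_max_points (\<Omega> \<epsilon>) u \<and> finite A \<and> card A = k)) \<and>
       (\<exists>p\<in>frontier (\<Omega> \<epsilon>). boundary_curvature (\<Omega> \<epsilon>) p < 0) \<and>
       (\<exists>p\<in>frontier (\<Omega> \<epsilon>). boundary_curvature (\<Omega> \<epsilon>) p > 0) \<and>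
       card {p \<in> frontier (\<Omega> \<epsilon>). boundary_curvature (\<Omega> \<epsilon>) p = 0} = 2) \<and>
    (\<forall>K. compact K \<longrightarrow>
       ((\<lambda>\<epsilon>. measure lebesgue (K \<inter> sym_diff (\<Omega> \<epsilon>) strip)) \<longlongrightarrow> 0) (at_right 0)) \<and>
    (\<exists>m :: real \<Rightarrow> real.
       (\<forall>\<epsilon>>0. m \<epsilon> \<in> boundary_curvature (\<Omega> \<epsilon>) ` frontier (\<Omega> \<epsilon>) \<and>
               (\<forall>p\<in>frontier (\<Omega> \<epsilon>). m \<epsilon> \<le> boundary_curvature (\<Omega> \<epsilon>) p)) \<and>
       (m \<longlongrightarrow> 0) (at_right 0))"
proof -
  obtain q b T te where prof: "bent_profile q b T te" "real k + 1 \<le> T"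
    "\<And>j. j < k \<Longrightarrow> poly q (real j) = 0"
    "\<And>j. j < k \<Longrightarrow> 0 < poly q (real j - 1/2) \<and> 0 < poly q (real j + 1/2)"
    using exists_bent_profile[of k] by metis
  interpret bent_profile q b T te by (rule prof(1))
  obtain X0 where X0: "X0 > 0" "\<forall>X\<ge>X0. \<forall>u. robin_torsion_solution \<beta> (dom X) u \<longrightarrow>
      (\<exists>A. A \<subseteq> local_max_points (dom X) u \<and> finite A \<and> card A = k)"
    using many_local_maxima[OF assms prof(2-4)] by blast
  \<comment> \<open>The summand \<open>X0\<close> secures the maxima for every positive \<epsilon>,
    not only for small ones; \<open>1 / \<epsilon>\<close> sends the stretch to infinity.\<close>
  define X where "X \<epsilon> = X0 + 1 / \<epsilon>" for \<epsilon> :: real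
  have X: "X \<epsilon> \<ge> X0" "X \<epsilon> > 0" if "\<epsilon> > 0" for \<epsilon>
    using that X0 by (auto simp: X_def add_pos_nonneg)
  have "filterlim (\<lambda>\<epsilon>. inverse \<epsilon>) at_top (at_right (0::real))"
    by (rule filterlim_inverse_at_top_right)
  then have lim_X: "filterlim X at_top (at_right 0)"
    unfolding X_def divide_inverse
    by (intro filterlim_tendsto_add_at_top[OF tendsto_const]) simp
  have "\<forall>\<epsilon>. \<exists>m. \<epsilon> > 0 \<longrightarrow> m \<in> boundary_curvature (dom (X \<epsilon>)) ` frontier (dom (X \<epsilon>)) \<and>
    (\<forall>p\<in>frontier (dom (X \<epsilon>)). m \<le> boundary_curvature (dom (X \<epsilon>)) p) \<and> - (4 * b / (X \<epsilon>)\<^sup>2) \<le> m \<and> m \<le> 0"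
    using curvature_attains_min X(2) by meson
  then obtain m where m: "\<And>\<epsilon>. \<epsilon> > 0 \<Longrightarrow> m \<epsilon> \<in> boundary_curvature (dom (X \<epsilon>)) ` frontier (dom (X \<epsilon>)) \<and>
    (\<forall>p\<in>frontier (dom (X \<epsilon>)). m \<epsilon> \<le> boundary_curvature (dom (X \<epsilon>)) p) \<and> - (4 * b / (X \<epsilon>)\<^sup>2) \<le> m \<epsilon> \<and> m \<epsilon> \<le> 0"
    by metis
  have "((\<lambda>x. - (4 * b / x\<^sup>2)) \<longlongrightarrow> - 0) at_top"
    by (intro tendsto_minus real_tendsto_divide_at_top[OF tendsto_const] filterlim_pow_at_top filterlim_ident) simp
  then have lower: "((\<lambda>\<epsilon>. - (4 * b / (X \<epsilon>)\<^sup>2)) \<longlongrightarrow> 0) (at_right 0)"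
    using filterlim_compose[OF _ lim_X] by fastforce
  have between: "\<forall>\<^sub>F \<epsilon> in at_right 0. - (4 * b / (X \<epsilon>)\<^sup>2) \<le> m \<epsilon>" "\<forall>\<^sub>F \<epsilon> in at_right 0. m \<epsilon> \<le> 0"
    using m by (auto simp: eventually_at_right_field intro: exI[of _ 1])
  \<comment> \<open>The minimum is squeezed between
    \<open>- (4 * b / (X \<epsilon>)\<^sup>2)\<close> and 0.\<close>
  have lim_m: "(m \<longlongrightarrow> 0) (at_right 0)"
    by (rule tendsto_sandwich[OF between lower tendsto_const])
  have lim_K: "((\<lambda>\<epsilon>. measure lebesgue (K \<inter> sym_diff (dom (X \<epsilon>)) strip)) \<longlongrightarrow> 0) (at_right 0)"
    if "compact K" for K
    using filterlim_compose[OF dom_converges[OF that] lim_X] .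
  show ?thesis
  proof (intro exI[of _ "\<lambda>\<epsilon>. dom (X \<epsilon>)"] conjI allI impI)
    fix \<epsilon> :: real assume "\<epsilon> > 0"
    note Xe = X[OF this]
    show "smooth_bounded_domain (dom (X \<epsilon>))" by (rule smooth_bounded_domain_dom[OF Xe(2)])
    show "starlike (dom (X \<epsilon>))" by (rule starlike_dom[OF Xe(2)])
    show "\<exists>A. A \<subseteq> local_max_points (dom (X \<epsilon>)) u \<and> finite A \<and> card A = k"
      if "robin_torsion_solution \<beta> (dom (X \<epsilon>)) u" for u
      using X0(2) Xe(1) that by blast
    show "\<exists>p\<in>frontier (dom (X \<epsilon>)). boundary_curvature (dom (X \<epsilon>)) p < 0"
      "\<exists>p\<in>frontier (dom (X \<epsilon>)). boundary_curvature (dom (X \<epsilon>)) p > 0"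
      by (rule curvature_signs[OF Xe(2)])+
    show "card {p \<in> frontier (dom (X \<epsilon>)). boundary_curvature (dom (X \<epsilon>)) p = 0} = 2"
      by (rule curvature_zero_card[OF Xe(2)])
  next
    show "\<exists>m. (\<forall>\<epsilon>>0. m \<epsilon> \<in> boundary_curvature (dom (X \<epsilon>)) ` frontier (dom (X \<epsilon>)) \<and>
               (\<forall>p\<in>frontier (dom (X \<epsilon>)). m \<epsilon> \<le> boundary_curvature (dom (X \<epsilon>)) p)) \<and>
       (m \<longlongrightarrow> 0) (at_right 0)"
      using m lim_m by blast
  qed (rule lim_K)
qed

end
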